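(* For every $q\in(0,1]$ and every $M\in\mathbb{N}_0$ it holds that $$\mathrm{dist}^s\big((\mathrm{Lip}_q(S^1),L_q),(A_M,L_q)\big)\le\varepsilon_M,$$ and hence that $\mathrm{dist}^s\big((\mathrm{Lip}_q(S^1),L_q),(\mathcal{O}(S^1),L_q)\big)=0$. Here $$\varepsilon_M:=\sqrt{2}\cdot\Big(\frac{M}{(M+1)^2}+\sum_{k=M+1}^\infty\frac{1}{k^2}\Big)^{1/2}.$$
   Context: **$q$-integers.** For $q\in(0,1)$ and $n\in\mathbb{Z}$ put $[n]_q := \frac{q^n-q^{-n}}{q-q^{-1}}$; for $q=1$ put $[n]_1 := n$. **Identification of $C(S^1)$.** $\ell^2(\mathbb{Z})$ has standard orthonormal basis $(e_j)_{j\in\mathbb{Z}}$, inner products are linear in the second variable, and $\|\cdot\|_\infty$ denotes the operator norm. For a bounded operator $T$ on $\ell^2(\mathbb{Z})$ write $T_{jk} := \langle e_j, Te_k\rangle$. Let $U$ be the bilateral shift, $U e_j = e_{j+1}$. The $C^*$-algebra $C(S^1)$ is identified with $C^*(U)\subseteq \mathbb{B}(\ell^2(\mathbb{Z}))$ via $z\mapsto U$, where $z:S^1\to\mathbb{C}$ is the inclusion. $\mathcal{O}(S^1):=\mathrm{span}_{\mathbb{C}}\{U^n : n\in\mathbb{Z}\}$, and for $M\in\mathbb{N}_0$ the spectral band is $A_M:=\mathrm{span}_{\mathbb{C}}\{U^n : -M\le n\le M\}\subseteq\mathcal{O}(S^1)$. **$q$-derivative.** $\mathrm{Lip}_q(\ell^2(\mathbb{Z}))$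 is the set of bounded operators $T$ on $\ell^2(\mathbb{Z})$ such that the infinite matrix $(i[j-k]_q T_{jk})_{j,k\in\mathbb{Z}}$ is the matrix of a bounded operator; this bounded operator is denoted $\mathrm{d}_q(T)$. Put $\mathrm{Lip}_q(S^1) := C(S^1)\cap \mathrm{Lip}_q(\ell^2(\mathbb{Z}))$, which contains $\mathcal{O}(S^1)$, and $L_q(T):=\|\mathrm{d}_q(T)\|_\infty$. The pairs $(\mathrm{Lip}_q(S^1),L_q)$, $(\mathcal{O}(S^1),L_q)$ and $(A_M,L_q)$ are compact quantum metric spaces in the sense below. **Compact quantum metric spaces.** An operator system $\mathcal{X}$ is a (not necessarily closed) $*$-invariant subspace containing $1$ of a unital $C^*$-algebra. A slip-norm on $\mathcal{X}$ is a seminorm $L:\mathcal{X}\to[0,\infty)$ with $L(x^* )=L(x)$ for all $x$ and $L(1)=0$. The pair $(\mathcal{X},L)$ is a compact quantum metric space if the metric $\rho_L(\varphi,\psi)=\sup\{|\varphi(x)-\psi(x)| : L(x)\le 1\}$ on the state space $S(\mathcal{X})$ (unital positive linear functionals) induces the weak-$*$ topology. **Kerr's complete Gromov-Hausdorff distance $\mathrm{dist}^s$.** For an operator system $\mathcal{X}$ and $n\in\mathbb{N}$ let $\mathrm{UCP}_n(\mathcal{X})$ be the set of unital completely positive maps $\mathcal{X}\to M_n(\mathbb{C})$; a slip-norm $L$ gives $\rho_{L,n}(\varphi,\psi):=\sup\{\|\varphi(x)-\psi(x)\| : L(x)\le 1\}$ on it. Let $(\mathcal{X},L_{\mathcal{X}})$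 and $(\mathcal{Y},L_{\mathcal{Y}})$ be compact quantum metric spaces. A slip-norm $L$ on the operator system $\mathcal{X}\oplus\mathcal{Y}$ is admissible if $(\mathcal{X}\oplus\mathcal{Y},L)$ is a compact quantum metric space and the quotient seminorms of $L$ under the coordinate projections onto $\mathcal{X}$ and $\mathcal{Y}$ are $L_{\mathcal{X}}$ and $L_{\mathcal{Y}}$, respectively. Composition with the coordinate projections embeds $\mathrm{UCP}_n(\mathcal{X})$ and $\mathrm{UCP}_n(\mathcal{Y})$ in $\mathrm{UCP}_n(\mathcal{X}\oplus\mathcal{Y})$. Then $$\mathrm{dist}^s\big((\mathcal{X},L_{\mathcal{X}}),(\mathcal{Y},L_{\mathcal{Y}})\big):=\inf_{L}\ \sup_{n\in\mathbb{N}}\ \mathrm{dist}_H^{\rho_{L,n}}\big(\mathrm{UCP}_n(\mathcal{X}),\mathrm{UCP}_n(\mathcal{Y})\big),$$ the infimum being over all admissible $L$ and $\mathrm{dist}_H^{\rho_{L,n}}$ denoting the Hausdorff distance with respect to $\rho_{L,n}$. *)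

theory Defs
  imports
    "HOL-Analysis.Analysis"
    "Jordan_Normal_Form.Matrix"
begin

section \<open>The Hilbert space of square-summable families\<close>

typedef 'i ell2 = "{x :: 'i \<Rightarrow> complex. (\<lambda>i. (cmod (x i))\<^sup>2) summable_on UNIV}"
  morphisms coord Abs_ell2
  by (rule exI[of _ "\<lambda>_. 0"]) simp

setup_lifting type_definition_ell2

lemma coord_summable: "(\<lambda>i. (cmod (coord x i))\<^sup>2) summable_on UNIV"
  using coord by blast

lemma ell2_eqI: "(\<And>i. coord x i = coord y i) \<Longrightarrow> x = y"
  by (metis coord_inject ext)

lemma square_summable_add:
  assumes "(\<lambda>i. (cmod (x i))\<^sup>2) summable_on UNIV" "(\<lambda>i. (cmod (y i))\<^sup>2) summable_on UNIV"
  shows "(\<lambda>i::'i. (cmod (x i + y i))\<^sup>2) summable_on UNIV"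
proof (rule summable_on_comparison_test)
  show "(\<lambda>i. 2 * (cmod (x i))\<^sup>2 + 2 * (cmod (y i))\<^sup>2) summable_on UNIV"
    by (intro summable_on_add summable_on_cmult_right assms)
  fix i
  have "(cmod (x i + y i))\<^sup>2 \<le> (cmod (x i) + cmod (y i))\<^sup>2"
    by (intro power_mono norm_triangle_ineq) auto
  also have "\<dots> \<le> 2 * (cmod (x i))\<^sup>2 + 2 * (cmod (y i))\<^sup>2"
    using sum_squares_bound[of "cmod (x i)" "cmod (y i)"] by (simp add: power2_sum)
  finally show "(cmod (x i + y i))\<^sup>2 \<le> 2 * (cmod (x i))\<^sup>2 + 2 * (cmod (y i))\<^sup>2" .
qed auto

lemma square_summable_scale:
  assumes "(\<lambda>i. (cmod (x i))\<^sup>2) summable_on UNIV"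
  shows "(\<lambda>i::'i. (cmod (c * x i))\<^sup>2) summable_on UNIV"
  using summable_on_cmult_right[OF assms, of "(cmod c)\<^sup>2"]
  by (simp add: norm_mult power_mult_distrib)

lemma inner_abs_summable:
  "(\<lambda>i. cmod (cnj (coord x i) * coord y i)) summable_on UNIV"
proof (rule summable_on_comparison_test)
  show "(\<lambda>i. (cmod (coord x i))\<^sup>2 + (cmod (coord y i))\<^sup>2) summable_on UNIV"
    by (intro summable_on_add coord_summable)
  fix i
  show "norm (cnj (coord x i) * coord y i) \<le> (cmod (coord x i))\<^sup>2 + (cmod (coord y i))\<^sup>2"
    using sum_squares_bound[of "cmod (coord x i)" "cmod (coord y i)"]
      mult_nonneg_nonneg[OF norm_ge_zero[of "coord x i"] norm_ge_zero[of "coord y i"]]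
    unfolding norm_mult complex_mod_cnj real_norm_def abs_mult abs_norm_cancel by linarith
qed auto

lemma inner_summable: "(\<lambda>i. cnj (coord x i) * coord y i) summable_on UNIV"
  by (rule abs_summable_summable[OF inner_abs_summable])

definition cinner :: "'i ell2 \<Rightarrow> 'i ell2 \<Rightarrow> complex" where
  "cinner x y = (\<Sum>\<^sub>\<infinity>i. cnj (coord x i) * coord y i)"

lift_definition scaleC_ell2 :: "complex \<Rightarrow> 'i ell2 \<Rightarrow> 'i ell2" (infixr \<open>*\<^sub>C\<close> 75)
  is "\<lambda>c x i. c * x i"
  by (rule square_summable_scale)

lift_definition ket :: "'i \<Rightarrow> 'i ell2" is "\<lambda>j i. if i = j then 1 else 0"
proof -
  fix j :: 'i
  have "(\<lambda>i. (cmod (if i = j then 1 else 0))\<^sup>2) summable_on {j}" by simp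
  then have "(\<lambda>i. (cmod (if i = j then 1 else 0))\<^sup>2) summable_on UNIV"
    by (subst summable_on_cong_neutral[where T = "{j}"]) auto
  then show "(\<lambda>i. (cmod (if i = j then 1 else 0))\<^sup>2) summable_on UNIV" .
qed

text \<open>The real inner product is the real part of \<^const>\<open>cinner\<close>; it induces the usual norm.\<close>

instantiation ell2 :: (type) real_inner
begin

lift_definition zero_ell2 :: "'a ell2" is "\<lambda>_. 0" by simp
lift_definition plus_ell2 :: "'a ell2 \<Rightarrow> 'a ell2 \<Rightarrow> 'a ell2" is "\<lambda>x y i. x i + y i"
  by (rule square_summable_add)
lift_definition uminus_ell2 :: "'a ell2 \<Rightarrow> 'a ell2" is "\<lambda>x i. - x i" by simp
lift_definition minus_ell2 :: "'a ell2 \<Rightarrow> 'a ell2 \<Rightarrow> 'a ell2" is "\<lambda>x y i. x i - y i"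
  subgoal for x y using square_summable_add[of x "\<lambda>i. - y i"] by simp
  done
lift_definition scaleR_ell2 :: "real \<Rightarrow> 'a ell2 \<Rightarrow> 'a ell2" is "\<lambda>r x i. complex_of_real r * x i"
  by (rule square_summable_scale)
definition inner_ell2 :: "'a ell2 \<Rightarrow> 'a ell2 \<Rightarrow> real" where
  "inner_ell2 x y = Re (cinner x y)"
definition norm_ell2 :: "'a ell2 \<Rightarrow> real" where
  "norm_ell2 x = sqrt (inner x x)"
definition sgn_ell2 :: "'a ell2 \<Rightarrow> 'a ell2" where
  "sgn_ell2 x = inverse (norm x) *\<^sub>R x"
definition dist_ell2 :: "'a ell2 \<Rightarrow> 'a ell2 \<Rightarrow> real" where
  "dist_ell2 x y = norm (x - y)"
definition uniformity_ell2 :: "('a ell2 \<times> 'a ell2) filter" where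
  "uniformity_ell2 = (INF e\<in>{0 <..}. principal {(x, y). dist x y < e})"
definition open_ell2 :: "'a ell2 set \<Rightarrow> bool" where
  "open_ell2 S = (\<forall>x\<in>S. \<forall>\<^sub>F (x', y) in uniformity. x' = x \<longrightarrow> y \<in> S)"

lemma cinner_self: "cinner x x = complex_of_real (\<Sum>\<^sub>\<infinity>i. (cmod (coord x i))\<^sup>2)"
proof -
  have "((\<lambda>i. complex_of_real ((cmod (coord x i))\<^sup>2)) has_sum
      complex_of_real (\<Sum>\<^sub>\<infinity>i. (cmod (coord x i))\<^sup>2)) UNIV"
    by (rule has_sum_of_real[OF has_sum_infsum[OF coord_summable]])
  moreover have "complex_of_real ((cmod z)\<^sup>2) = cnj z * z" for z
    using complex_norm_square[of z] by (simp add: mult.commute)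
  ultimately show ?thesis
    unfolding cinner_def by (simp only: infsumI)
qed

lemma cinner_commute: "cinner x y = cnj (cinner y x)"
  unfolding cinner_def infsum_cnj[symmetric] by (intro infsum_cong) simp

instance
proof
  fix x y z :: "'a ell2" and a b :: real
  show "x + y + z = x + (y + z)" by transfer (simp add: add.assoc)
  show "x + y = y + x" by transfer (simp add: add.commute)
  show "0 + x = x" by transfer simp
  show "- x + x = 0" by transfer simp
  show "x - y = x + - y" by transfer simp
  show "a *\<^sub>R (x + y) = a *\<^sub>R x + a *\<^sub>R y" by transfer (simp add: algebra_simps)
  show "(a + b) *\<^sub>R x = a *\<^sub>R x + b *\<^sub>R x" by transfer (simp add: algebra_simps)
  show "a *\<^sub>R b *\<^sub>R x = (a * b) *\<^sub>R x" by transfer (simp add: algebra_simps)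
  show "1 *\<^sub>R x = x" by transfer simp
  show "inner x y = inner y x"
    unfolding inner_ell2_def by (subst cinner_commute) simp
  show "inner (x + y) z = inner x z + inner y z"
    unfolding inner_ell2_def cinner_def
    by (subst plus_complex.sel(1)[symmetric], subst infsum_add[OF inner_summable inner_summable, symmetric])
      (simp add: plus_ell2.rep_eq algebra_simps)
  have "cinner (a *\<^sub>R x) y = of_real a * cinner x y"
    unfolding cinner_def
    by (subst infsum_cmult_right'[symmetric]) (simp add: scaleR_ell2.rep_eq mult.assoc)
  then show "inner (a *\<^sub>R x) y = a * inner x y"
    by (simp add: inner_ell2_def)
  show "0 \<le> inner x x"
    by (simp add: inner_ell2_def cinner_self infsum_nonneg)
  show "(inner x x = 0) = (x = 0)"
  proof
    assume "inner x x = 0"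
    then have s: "(\<Sum>\<^sub>\<infinity>i. (cmod (coord x i))\<^sup>2) \<le> 0" by (simp add: inner_ell2_def cinner_self)
    have "(cmod (coord x i))\<^sup>2 = 0" for i
      using nonneg_infsum_le_0D[OF s coord_summable] by simp
    then show "x = 0" by (intro ell2_eqI) (simp add: zero_ell2.rep_eq)
  qed (simp add: inner_ell2_def cinner_def zero_ell2.rep_eq)
qed (simp_all only: norm_ell2_def sgn_ell2_def dist_ell2_def uniformity_ell2_def open_ell2_def)

end

lemma coord_simps [simp]:
  "coord 0 i = 0" "coord (x + y) i = coord x i + coord y i" "coord (- x) i = - coord x i"
  "coord (x - y) i = coord x i - coord y i" "coord (a *\<^sub>R x) i = of_real a * coord x i"
  "coord (c *\<^sub>C x) i = c * coord x i" "coord (ket j) i = (if i = j then 1 else 0)"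
  by (simp_all add: zero_ell2.rep_eq plus_ell2.rep_eq uminus_ell2.rep_eq minus_ell2.rep_eq
      scaleR_ell2.rep_eq scaleC_ell2.rep_eq ket.rep_eq)

lemma norm_ell2_square: "(norm x)\<^sup>2 = (\<Sum>\<^sub>\<infinity>i. (cmod (coord x i))\<^sup>2)" for x :: "'i ell2"
  by (simp add: norm_eq_sqrt_inner inner_ell2_def cinner_self infsum_nonneg)

lemma norm_scaleC [simp]: "norm (c *\<^sub>C x) = cmod c * norm x"
proof -
  have "(norm (c *\<^sub>C x))\<^sup>2 = (cmod c * norm x)\<^sup>2"
    by (simp add: norm_ell2_square power_mult_distrib norm_mult infsum_cmult_right')
  then show ?thesis by (simp add: power2_eq_iff_nonneg)
qed

lemma cinner_add_right: "cinner x (y + z) = cinner x y + cinner x z"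
  unfolding cinner_def
  by (subst infsum_add[OF inner_summable inner_summable, symmetric]) (simp add: algebra_simps)

lemma cinner_scaleC_right: "cinner x (c *\<^sub>C y) = c * cinner x y"
  unfolding cinner_def by (subst infsum_cmult_right'[symmetric]) (simp add: algebra_simps)

lemma scaleR_scaleC: "a *\<^sub>R x = complex_of_real a *\<^sub>C x"
  by (rule ell2_eqI) simp

lemma cinner_Cauchy_Schwarz: "cmod (cinner x y) \<le> norm x * norm y"
proof (cases "cinner x y = 0")
  case False
  define c where "c = cnj (cinner x y) / cmod (cinner x y)"
  have c1: "cmod c = 1" using False by (simp add: c_def norm_divide)
  have "c * cinner x y = complex_of_real (cmod (cinner x y))"
    using False complex_norm_square[of "cinner x y"]
    by (simp add: c_def field_simps power2_eq_square)
  then have "cmod (cinner x y) = inner x (c *\<^sub>C y)"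
    by (simp add: inner_ell2_def cinner_scaleC_right)
  also have "\<dots> \<le> norm x * norm (c *\<^sub>C y)" by (rule norm_cauchy_schwarz)
  finally show ?thesis by (simp add: c1)
qed simp

lemma bounded_linear_cinner_right: "bounded_linear (cinner x)"
  by (rule bounded_linear_intro[where K = "norm x"])
    (simp_all add: cinner_add_right scaleR_scaleC cinner_scaleC_right scaleR_conv_of_real
      cinner_Cauchy_Schwarz mult.commute[of "norm _" "norm x"])

lemma cinner_ket_left: "cinner (ket j) x = coord x j"
proof -
  have "cinner (ket j) x = (\<Sum>\<^sub>\<infinity>i\<in>{j}. coord x i)"
    unfolding cinner_def by (rule infsum_cong_neutral) auto
  then show ?thesis by simp
qed

lemma ell2_expansion: "((\<lambda>j. coord x j *\<^sub>C ket j) has_sum x) UNIV"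
proof -
  have part: "coord (\<Sum>j\<in>F. coord x j *\<^sub>C ket j) i = (if i \<in> F then coord x i else 0)"
    if "finite F" for F i
    using that by (induction F rule: finite_induct) auto
  have "norm ((\<Sum>j\<in>F. coord x j *\<^sub>C ket j) - x)
      = sqrt ((\<Sum>\<^sub>\<infinity>i. (cmod (coord x i))\<^sup>2) - (\<Sum>i\<in>F. (cmod (coord x i))\<^sup>2))"
    if F: "finite F" for F
  proof -
    have "(norm ((\<Sum>j\<in>F. coord x j *\<^sub>C ket j) - x))\<^sup>2 = (\<Sum>\<^sub>\<infinity>i\<in>UNIV - F. (cmod (coord x i))\<^sup>2)"
      unfolding norm_ell2_square by (rule infsum_cong_neutral) (auto simp: part[OF F])
    also have "\<dots> = (\<Sum>\<^sub>\<infinity>i. (cmod (coord x i))\<^sup>2) - (\<Sum>i\<in>F. (cmod (coord x i))\<^sup>2)"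
      by (subst infsum_Diff) (use F in \<open>auto intro: coord_summable\<close>)
    finally show ?thesis by (metis norm_ge_zero real_sqrt_unique)
  qed
  then have ev: "\<forall>\<^sub>F F in finite_subsets_at_top UNIV.
      sqrt ((\<Sum>\<^sub>\<infinity>i. (cmod (coord x i))\<^sup>2) - (\<Sum>i\<in>F. (cmod (coord x i))\<^sup>2))
      = norm ((\<Sum>j\<in>F. coord x j *\<^sub>C ket j) - x)"
    by (intro eventually_finite_subsets_at_top_weakI) simp
  have "((\<lambda>F. \<Sum>i\<in>F. (cmod (coord x i))\<^sup>2) \<longlongrightarrow> (\<Sum>\<^sub>\<infinity>i. (cmod (coord x i))\<^sup>2))
      (finite_subsets_at_top UNIV)"
    using has_sum_infsum[OF coord_summable[of x]] by (simp add: has_sum_def)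
  then have "((\<lambda>F. sqrt ((\<Sum>\<^sub>\<infinity>i. (cmod (coord x i))\<^sup>2) - (\<Sum>i\<in>F. (cmod (coord x i))\<^sup>2)))
      \<longlongrightarrow> sqrt ((\<Sum>\<^sub>\<infinity>i. (cmod (coord x i))\<^sup>2) - (\<Sum>\<^sub>\<infinity>i. (cmod (coord x i))\<^sup>2)))
      (finite_subsets_at_top UNIV)"
    by (intro tendsto_intros)
  then have "((\<lambda>F. norm ((\<Sum>j\<in>F. coord x j *\<^sub>C ket j) - x)) \<longlongrightarrow> 0) (finite_subsets_at_top UNIV)"
    using Lim_transform_eventually[OF _ ev] by fastforce
  then show ?thesis
    unfolding has_sum_def by (simp add: LIM_zero_iff tendsto_norm_zero_iff)
qed

section \<open>Bounded operators\<close>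

text \<open>
  \<^typ>\<open>'i ell2 \<Rightarrow>\<^sub>L 'i ell2\<close> consists of the bounded real-linear maps, with the operator norm;
  the bounded operators are the complex-linear ones among them.
\<close>

definition bops :: "('i ell2 \<Rightarrow>\<^sub>L 'i ell2) set" where
  "bops = {T :: 'i ell2 \<Rightarrow>\<^sub>L 'i ell2. \<forall>c x. T (c *\<^sub>C x) = c *\<^sub>C T x}"

lemma bounded_linear_scaleC:
  assumes "bounded_linear T"
  shows "bounded_linear (\<lambda>x. c *\<^sub>C T x)"
proof -
  interpret T: bounded_linear T by fact
  obtain K where K: "\<And>x. norm (T x) \<le> norm x * K" using T.bounded by blast
  show ?thesis
    by (rule bounded_linear_intro[where K = "cmod c * K"])
      (auto intro!: ell2_eqI mult_left_mono[OF K, THEN order_trans]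
        simp: T.add T.scaleR algebra_simps)
qed

definition scaleC_op :: "complex \<Rightarrow> ('i ell2 \<Rightarrow>\<^sub>L 'j ell2) \<Rightarrow> ('i ell2 \<Rightarrow>\<^sub>L 'j ell2)"
  where "scaleC_op c T = Blinfun (\<lambda>x. c *\<^sub>C T x)"

lemma scaleC_op_apply: "scaleC_op c T x = c *\<^sub>C T x"
  unfolding scaleC_op_def
  by (simp add: bounded_linear_Blinfun_apply bounded_linear_scaleC blinfun.bounded_linear_right)

interpretation cop: vector_space scaleC_op
  by standard
    (auto intro!: blinfun_eqI ell2_eqI
      simp: scaleC_op_apply blinfun.add_left algebra_simps)

definition adj :: "('i ell2 \<Rightarrow>\<^sub>L 'i ell2) \<Rightarrow> ('i ell2 \<Rightarrow>\<^sub>L 'i ell2)" where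
  "adj T = (THE S. \<forall>x y. cinner (blinfun_apply S x) y = cinner x (T y))"

lemma adj_exists:
  assumes T: "T \<in> bops"
  shows "\<exists>S\<in>bops. \<forall>x y. cinner (S x) y = cinner x (blinfun_apply T y)"
proof -
  define b where "b x j = cinner (T (ket j)) x" for x j
  have T_scale: "T (c *\<^sub>C x) = c *\<^sub>C T x" for c x using T by (simp add: bops_def)
  have fin: "(\<Sum>j\<in>F. (cmod (b x j))\<^sup>2) \<le> (norm T * norm x)\<^sup>2" if F: "finite F" for F x
  proof -
    define v where "v = (\<Sum>j\<in>F. b x j *\<^sub>C ket j)"
    define s where "s = (\<Sum>j\<in>F. (cmod (b x j))\<^sup>2)"
    have cv: "coord v i = (if i \<in> F then b x i else 0)" for i
      unfolding v_def using F by (induction F rule: finite_induct) auto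
    have "(norm v)\<^sup>2 = (\<Sum>\<^sub>\<infinity>i\<in>F. (cmod (b x i))\<^sup>2)"
      unfolding norm_ell2_square by (rule infsum_cong_neutral) (auto simp: cv)
    then have nv: "(norm v)\<^sup>2 = s" using F by (simp add: s_def)
    have "cinner x (T v) = (\<Sum>j\<in>F. cinner x (T (b x j *\<^sub>C ket j)))"
      unfolding v_def
      by (simp add: blinfun.sum_right bounded_linear.linear[OF bounded_linear_cinner_right]
          linear_sum)
    also have "\<dots> = (\<Sum>j\<in>F. complex_of_real ((cmod (b x j))\<^sup>2))"
    proof (rule sum.cong)
      fix j
      have "cinner x (T (ket j)) = cnj (b x j)" unfolding b_def by (rule cinner_commute)
      then show "cinner x (T (b x j *\<^sub>C ket j)) = complex_of_real ((cmod (b x j))\<^sup>2)"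
        by (simp only: T_scale cinner_scaleC_right complex_norm_square)
    qed simp
    finally have "s = cmod (cinner x (T v))"
      by (simp add: s_def sum_nonneg flip: of_real_sum of_real_power)
    also have "\<dots> \<le> norm x * (norm T * norm v)"
      by (rule order_trans[OF cinner_Cauchy_Schwarz]) (simp add: mult_left_mono norm_blinfun)
    finally have "norm v * norm v \<le> (norm T * norm x) * norm v"
      using nv by (simp add: power2_eq_square algebra_simps)
    then have "norm v \<le> norm T * norm x"
      by (cases "norm v = 0") auto
    then have "(norm v)\<^sup>2 \<le> (norm T * norm x)\<^sup>2" by (intro power_mono) auto
    then show ?thesis using nv s_def by simp
  qed
  have summ: "(\<lambda>j. (cmod (b x j))\<^sup>2) summable_on UNIV" for x
    by (rule nonneg_bdd_above_summable_on) (auto intro!: bdd_aboveI2 fin)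
  define S where "S x = Abs_ell2 (b x)" for x
  have cS: "coord (S x) j = b x j" for x j
    using Abs_ell2_inverse[of "b x"] summ by (simp add: S_def)
  have "(norm (S x))\<^sup>2 \<le> (norm T * norm x)\<^sup>2" for x
    unfolding norm_ell2_square cS
    by (rule infsum_le_finite_sums[OF summ]) (auto intro: fin)
  then have nS: "norm (S x) \<le> norm x * norm T" for x
    by (metis mult.commute norm_ge_zero power2_le_imp_le zero_le_mult_iff)
  have S_add: "S (x + y) = S x + S y" for x y
    by (rule ell2_eqI) (simp add: cS b_def cinner_add_right)
  have S_scale: "S (c *\<^sub>C x) = c *\<^sub>C S x" for c x
    by (rule ell2_eqI) (simp add: cS b_def cinner_scaleC_right)
  have bl: "bounded_linear S"
    by (rule bounded_linear_intro[where K = "norm T"])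
      (simp_all add: S_add S_scale scaleR_scaleC nS)
  have "cinner (S x) y = cinner x (T y)" for x y
  proof -
    have "((\<lambda>j. cinner x (T (coord y j *\<^sub>C ket j))) has_sum cinner x (T y)) UNIV"
      by (rule has_sum_bounded_linear[OF bounded_linear_compose[OF bounded_linear_cinner_right
          blinfun.bounded_linear_right] ell2_expansion])
    moreover have "cinner x (T (coord y j *\<^sub>C ket j)) = cnj (coord (S x) j) * coord y j" for j
    proof -
      have "cinner x (T (ket j)) = cnj (coord (S x) j)" unfolding cS b_def by (rule cinner_commute)
      then show ?thesis by (simp add: T_scale cinner_scaleC_right)
    qed
    ultimately show ?thesis unfolding cinner_def by (simp add: infsumI cinner_def)
  qed
  then show ?thesis
    by (intro bexI[of _ "Blinfun S"])
      (simp_all add: bops_def bounded_linear_Blinfun_apply[OF bl] S_scale)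
qed

lemma adj_correct:
  assumes "T \<in> bops"
  shows adj_bops: "adj T \<in> bops"
    and cinner_adj: "cinner (blinfun_apply (adj T) x) y = cinner x (blinfun_apply T y)"
proof -
  obtain S where S: "S \<in> bops" "\<forall>x y. cinner (blinfun_apply S x) y = cinner x (blinfun_apply T y)"
    using adj_exists[OF assms] by blast
  have "S' = S" if "\<forall>x y. cinner (blinfun_apply S' x) y = cinner x (blinfun_apply T y)" for S'
  proof (intro blinfun_eqI ell2_eqI)
    fix x j
    show "coord (S' x) j = coord (S x) j"
      using that S(2) cinner_commute cinner_ket_left by metis
  qed
  then have "adj T = S" unfolding adj_def using S(2) by (intro the_equality) blast+
  then show "adj T \<in> bops" "cinner (blinfun_apply (adj T) x) y = cinner x (blinfun_apply T y)"
    using S by auto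
qed

definition mat_entry :: "('i ell2 \<Rightarrow>\<^sub>L 'i ell2) \<Rightarrow> 'i \<Rightarrow> 'i \<Rightarrow> complex" where
  "mat_entry T j k = cinner (ket j) (T (ket k))"

text \<open>
  Positivity of the element \<open>(x\<^sub>i\<^sub>j)\<close> of \<open>M\<^sub>m(B(H)) = B(H\<^sup>m)\<close>; the case \<open>m = 1\<close> is
  positivity of an operator.
\<close>

definition positive_op_mat :: "nat \<Rightarrow> (nat \<Rightarrow> nat \<Rightarrow> ('i ell2 \<Rightarrow>\<^sub>L 'i ell2)) \<Rightarrow> bool" where
  "positive_op_mat m x \<longleftrightarrow>
     (\<forall>\<xi>. (\<Sum>i<m. \<Sum>j<m. cinner (\<xi> i) (x i j (\<xi> j))) \<in> \<real>\<^sub>\<ge>\<^sub>0)"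

definition positive_op :: "('i ell2 \<Rightarrow>\<^sub>L 'i ell2) \<Rightarrow> bool" where
  "positive_op x \<longleftrightarrow> (\<forall>\<xi>. cinner \<xi> (x \<xi>) \<in> \<real>\<^sub>\<ge>\<^sub>0)"

definition cstar_subalgebra :: "('i ell2 \<Rightarrow>\<^sub>L 'i ell2) set \<Rightarrow> bool" where
  "cstar_subalgebra B \<longleftrightarrow> B \<subseteq> bops \<and> closed B \<and> cop.subspace B \<and>
     (\<forall>S\<in>B. \<forall>T\<in>B. S o\<^sub>L T \<in> B) \<and> (\<forall>T\<in>B. adj T \<in> B)"

definition cstar_generated :: "('i ell2 \<Rightarrow>\<^sub>L 'i ell2) set \<Rightarrow> ('i ell2 \<Rightarrow>\<^sub>L 'i ell2) set" where
  "cstar_generated G = \<Inter>{B. cstar_subalgebra B \<and> G \<subseteq> B}"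

section \<open>Compact quantum metric spaces\<close>

text \<open>
  Operator systems are represented concretely, inside the \<open>C\<^sup>*\<close>-algebra of bounded operators
  on the Hilbert space of square-summable families over some index type.
  Seminorms are functions on the whole type of which only the values on \<open>X\<close> matter, and
  functionals and matrix-valued maps on \<open>X\<close> are extensional functions.
\<close>

definition operator_system :: "('i ell2 \<Rightarrow>\<^sub>L 'i ell2) set \<Rightarrow> bool" where
  "operator_system X \<longleftrightarrow> X \<subseteq> bops \<and> cop.subspace X \<and> (\<forall>x\<in>X. adj x \<in> X) \<and> id_blinfun \<in> X"

definition slip_norm :: "('i ell2 \<Rightarrow>\<^sub>L 'i ell2) set \<Rightarrow> (('i ell2 \<Rightarrow>\<^sub>L 'i ell2) \<Rightarrow> real) \<Rightarrow> bool" where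
  "slip_norm X L \<longleftrightarrow>
     (\<forall>x\<in>X. 0 \<le> L x) \<and>
     (\<forall>x\<in>X. \<forall>y\<in>X. L (x + y) \<le> L x + L y) \<and>
     (\<forall>c. \<forall>x\<in>X. L (scaleC_op c x) = cmod c * L x) \<and>
     (\<forall>x\<in>X. L (adj x) = L x) \<and>
     L id_blinfun = 0"

definition states :: "('i ell2 \<Rightarrow>\<^sub>L 'i ell2) set \<Rightarrow> (('i ell2 \<Rightarrow>\<^sub>L 'i ell2) \<Rightarrow> complex) set" where
  "states X = {\<phi> \<in> extensional X.
     (\<forall>x\<in>X. \<forall>y\<in>X. \<phi> (x + y) = \<phi> x + \<phi> y) \<and>
     (\<forall>c. \<forall>x\<in>X. \<phi> (scaleC_op c x) = c * \<phi> x) \<and>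
     \<phi> id_blinfun = 1 \<and>
     (\<forall>x\<in>X. positive_op x \<longrightarrow> \<phi> x \<in> \<real>\<^sub>\<ge>\<^sub>0)}"

definition weak_star :: "('i ell2 \<Rightarrow>\<^sub>L 'i ell2) set \<Rightarrow> (('i ell2 \<Rightarrow>\<^sub>L 'i ell2) \<Rightarrow> complex) topology" where
  "weak_star X = subtopology (product_topology (\<lambda>_. euclidean) X) (states X)"

text \<open>
  The supremum defining the distance is taken in \<^typ>\<open>ennreal\<close>, which makes its finiteness a separate
  requirement below.
\<close>

definition state_dist :: "('i ell2 \<Rightarrow>\<^sub>L 'i ell2) set \<Rightarrow> (('i ell2 \<Rightarrow>\<^sub>L 'i ell2) \<Rightarrow> real) \<Rightarrow>
    (('i ell2 \<Rightarrow>\<^sub>L 'i ell2) \<Rightarrow> complex) \<Rightarrow> (('i ell2 \<Rightarrow>\<^sub>L 'i ell2) \<Rightarrow> complex) \<Rightarrow> ennreal" where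
  "state_dist X L \<phi> \<psi> = (SUP x\<in>{x\<in>X. L x \<le> 1}. ennreal (cmod (\<phi> x - \<psi> x)))"

definition compact_quantum_metric_space ::
    "('i ell2 \<Rightarrow>\<^sub>L 'i ell2) set \<Rightarrow> (('i ell2 \<Rightarrow>\<^sub>L 'i ell2) \<Rightarrow> real) \<Rightarrow> bool" where
  "compact_quantum_metric_space X L \<longleftrightarrow>
     operator_system X \<and> slip_norm X L \<and>
     (\<forall>\<phi>\<in>states X. \<forall>\<psi>\<in>states X. state_dist X L \<phi> \<psi> < \<infinity>) \<and>
     Metric_space (states X) (\<lambda>\<phi> \<psi>. enn2real (state_dist X L \<phi> \<psi>)) \<and>
     Metric_space.mtopology (states X) (\<lambda>\<phi> \<psi>. enn2real (state_dist X L \<phi> \<psi>)) = weak_star X"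

section \<open>Unital completely positive maps into matrices\<close>

definition vec_l2_norm :: "complex vec \<Rightarrow> real" where
  "vec_l2_norm v = sqrt (Re (v \<bullet>c v))"

definition mat_op_norm :: "complex mat \<Rightarrow> real" where
  "mat_op_norm A = (SUP v\<in>{v \<in> carrier_vec (dim_col A). vec_l2_norm v \<le> 1}. vec_l2_norm (A *\<^sub>v v))"

text \<open>
  Positivity of the block matrix \<open>(a\<^sub>i\<^sub>j)\<close> in \<open>M\<^sub>m(M\<^sub>n)\<close>. The product \<open>u \<bullet>c v\<close> is conjugate-linear
  in \<open>v\<close>.
\<close>

definition positive_block_mat :: "nat \<Rightarrow> nat \<Rightarrow> (nat \<Rightarrow> nat \<Rightarrow> complex mat) \<Rightarrow> bool" where
  "positive_block_mat n m a \<longleftrightarrow>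
     (\<forall>v. (\<forall>i<m. v i \<in> carrier_vec n) \<longrightarrow>
        (\<Sum>i<m. \<Sum>j<m. (a i j *\<^sub>v v j) \<bullet>c v i) \<in> \<real>\<^sub>\<ge>\<^sub>0)"

definition UCP :: "nat \<Rightarrow> ('i ell2 \<Rightarrow>\<^sub>L 'i ell2) set \<Rightarrow> (('i ell2 \<Rightarrow>\<^sub>L 'i ell2) \<Rightarrow> complex mat) set" where
  "UCP n X = {\<phi> \<in> X \<rightarrow>\<^sub>E carrier_mat n n.
     (\<forall>x\<in>X. \<forall>y\<in>X. \<phi> (x + y) = \<phi> x + \<phi> y) \<and>
     (\<forall>c. \<forall>x\<in>X. \<phi> (scaleC_op c x) = c \<cdot>\<^sub>m \<phi> x) \<and>
     \<phi> id_blinfun = 1\<^sub>m n \<and>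
     (\<forall>m x. (\<forall>i<m. \<forall>j<m. x i j \<in> X) \<and> positive_op_mat m x \<longrightarrow>
        positive_block_mat n m (\<lambda>i j. \<phi> (x i j)))}"

definition UCP_dist :: "('i ell2 \<Rightarrow>\<^sub>L 'i ell2) set \<Rightarrow> (('i ell2 \<Rightarrow>\<^sub>L 'i ell2) \<Rightarrow> real) \<Rightarrow>
    (('i ell2 \<Rightarrow>\<^sub>L 'i ell2) \<Rightarrow> complex mat) \<Rightarrow> (('i ell2 \<Rightarrow>\<^sub>L 'i ell2) \<Rightarrow> complex mat) \<Rightarrow> ennreal" where
  "UCP_dist X L \<phi> \<psi> = (SUP x\<in>{x\<in>X. L x \<le> 1}. ennreal (mat_op_norm (\<phi> x - \<psi> x)))"

section \<open>Direct sums\<close>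

text \<open>
  The Hilbert space direct sum of \<open>\<ell>\<^sup>2(I)\<close> and \<open>\<ell>\<^sup>2(J)\<close> is \<open>\<ell>\<^sup>2\<close> of the disjoint union of
  \<open>I\<close> and \<open>J\<close>; the direct sum of operator systems consists of block-diagonal operators.
\<close>

lemma square_summable_case_sum:
  assumes "(\<lambda>i. (cmod (x i))\<^sup>2) summable_on UNIV" "(\<lambda>j. (cmod (y j))\<^sup>2) summable_on UNIV"
  shows "((\<lambda>k. (cmod (case_sum x y k))\<^sup>2) has_sum
      ((\<Sum>\<^sub>\<infinity>i. (cmod (x i))\<^sup>2) + (\<Sum>\<^sub>\<infinity>j. (cmod (y j))\<^sup>2))) UNIV"
proof -
  let ?f = "\<lambda>k. (cmod (case_sum x y k))\<^sup>2"
  have "(?f has_sum (\<Sum>\<^sub>\<infinity>i. (cmod (x i))\<^sup>2)) (range Inl)"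
    using assms(1) by (subst has_sum_reindex) (auto simp: o_def)
  moreover have "(?f has_sum (\<Sum>\<^sub>\<infinity>j. (cmod (y j))\<^sup>2)) (range Inr)"
    using assms(2) by (subst has_sum_reindex) (auto simp: o_def)
  ultimately have "(?f has_sum ((\<Sum>\<^sub>\<infinity>i. (cmod (x i))\<^sup>2) + (\<Sum>\<^sub>\<infinity>j. (cmod (y j))\<^sup>2)))
      (range Inl \<union> range Inr)"
    by (rule has_sum_Un_disjoint) auto
  then show ?thesis by (simp add: UNIV_sum)
qed

lift_definition pair_ell2 :: "'i ell2 \<Rightarrow> 'j ell2 \<Rightarrow> ('i + 'j) ell2" is case_sum
  using square_summable_case_sum has_sum_imp_summable by blast

lemma square_summable_restrict:
  assumes "(\<lambda>k. (cmod (x k))\<^sup>2) summable_on UNIV" and "inj f"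
  shows "(\<lambda>i. (cmod (x (f i)))\<^sup>2) summable_on UNIV"
proof -
  have "(\<lambda>k. (cmod (x k))\<^sup>2) summable_on range f"
    using assms(1) summable_on_subset_banach by blast
  then show ?thesis
    by (subst (asm) summable_on_reindex) (use assms(2) in \<open>auto simp: o_def\<close>)
qed

lift_definition left_ell2 :: "('i + 'j) ell2 \<Rightarrow> 'i ell2" is "\<lambda>x i. x (Inl i)"
  by (rule square_summable_restrict) auto

lift_definition right_ell2 :: "('i + 'j) ell2 \<Rightarrow> 'j ell2" is "\<lambda>x j. x (Inr j)"
  by (rule square_summable_restrict) auto

lemma pair_coord [simp]:
  "coord (pair_ell2 x y) (Inl i) = coord x i" "coord (pair_ell2 x y) (Inr j) = coord y j"
  "coord (left_ell2 z) i = coord z (Inl i)" "coord (right_ell2 z) j = coord z (Inr j)"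
  by (simp_all add: pair_ell2.rep_eq left_ell2.rep_eq right_ell2.rep_eq)

lemma pair_left_right [simp]:
  "left_ell2 (pair_ell2 x y) = x" "right_ell2 (pair_ell2 x y) = y"
  "pair_ell2 (left_ell2 z) (right_ell2 z) = z"
proof -
  show "pair_ell2 (left_ell2 z) (right_ell2 z) = z"
  proof (rule ell2_eqI)
    show "coord (pair_ell2 (left_ell2 z) (right_ell2 z)) k = coord z k" for k
      by (cases k) simp_all
  qed
qed (auto intro: ell2_eqI)

lemma norm_pair: "(norm (pair_ell2 x y))\<^sup>2 = (norm x)\<^sup>2 + (norm y)\<^sup>2"
  unfolding norm_ell2_square pair_ell2.rep_eq
  by (intro infsumI square_summable_case_sum coord_summable)

lemma norm_left_right: "(norm z)\<^sup>2 = (norm (left_ell2 z))\<^sup>2 + (norm (right_ell2 z))\<^sup>2"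
  by (metis norm_pair pair_left_right(3))

lemma bounded_linear_left: "bounded_linear left_ell2"
proof (rule bounded_linear_intro[where K = 1])
  show "norm (left_ell2 z) \<le> norm z * 1" for z
    by (rule power2_le_imp_le) (simp_all add: norm_left_right[of z])
qed (auto intro: ell2_eqI)

lemma bounded_linear_right: "bounded_linear right_ell2"
proof (rule bounded_linear_intro[where K = 1])
  show "norm (right_ell2 z) \<le> norm z * 1" for z
    by (rule power2_le_imp_le) (simp_all add: norm_left_right[of z])
qed (auto intro: ell2_eqI)

lemma pair_zero_norm: "norm (pair_ell2 x 0) = norm x" "norm (pair_ell2 0 y) = norm y"
  using norm_pair[of x 0] norm_pair[of 0 y] by (simp_all add: power2_eq_iff_nonneg)

lemma pair_add: "pair_ell2 (x + x') (y + y') = pair_ell2 x y + pair_ell2 x' y'"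
  and pair_scaleR: "pair_ell2 (r *\<^sub>R x) (r *\<^sub>R y) = r *\<^sub>R pair_ell2 x y"
  and pair_scaleC: "pair_ell2 (c *\<^sub>C x) (c *\<^sub>C y) = c *\<^sub>C pair_ell2 x y"
proof -
  have "coord (pair_ell2 (x + x') (y + y')) k = coord (pair_ell2 x y + pair_ell2 x' y') k"
    "coord (pair_ell2 (r *\<^sub>R x) (r *\<^sub>R y)) k = coord (r *\<^sub>R pair_ell2 x y) k"
    "coord (pair_ell2 (c *\<^sub>C x) (c *\<^sub>C y)) k = coord (c *\<^sub>C pair_ell2 x y) k" for k
    by (cases k; simp)+
  then show "pair_ell2 (x + x') (y + y') = pair_ell2 x y + pair_ell2 x' y'"
    "pair_ell2 (r *\<^sub>R x) (r *\<^sub>R y) = r *\<^sub>R pair_ell2 x y"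
    "pair_ell2 (c *\<^sub>C x) (c *\<^sub>C y) = c *\<^sub>C pair_ell2 x y"
    by (auto intro: ell2_eqI)
qed

lemma norm_pair_le: "norm (pair_ell2 x y) \<le> norm x + norm y"
proof -
  have "pair_ell2 x y = pair_ell2 x 0 + pair_ell2 0 y"
    by (simp flip: pair_add)
  then show ?thesis by (metis norm_triangle_ineq pair_zero_norm)
qed

definition dsum_op :: "('i ell2 \<Rightarrow>\<^sub>L 'i ell2) \<Rightarrow> ('j ell2 \<Rightarrow>\<^sub>L 'j ell2) \<Rightarrow>
    (('i + 'j) ell2 \<Rightarrow>\<^sub>L ('i + 'j) ell2)" where
  "dsum_op S T = Blinfun (\<lambda>z. pair_ell2 (S (left_ell2 z)) (T (right_ell2 z)))"

lemma dsum_op_apply: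
  fixes S :: "'i ell2 \<Rightarrow>\<^sub>L 'i ell2" and T :: "'j ell2 \<Rightarrow>\<^sub>L 'j ell2"
  shows "dsum_op S T z = pair_ell2 (S (left_ell2 z)) (T (right_ell2 z))"
proof -
  interpret S: bounded_linear "\<lambda>z :: ('i + 'j) ell2. S (left_ell2 z)"
    by (intro bounded_linear_compose[OF blinfun.bounded_linear_right] bounded_linear_left)
  interpret T: bounded_linear "\<lambda>z :: ('i + 'j) ell2. T (right_ell2 z)"
    by (intro bounded_linear_compose[OF blinfun.bounded_linear_right] bounded_linear_right)
  obtain K where K: "\<And>z :: ('i + 'j) ell2. norm (S (left_ell2 z)) \<le> norm z * K" using S.bounded by blast
  obtain K' where K': "\<And>z :: ('i + 'j) ell2. norm (T (right_ell2 z)) \<le> norm z * K'" using T.bounded by blast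
  have "bounded_linear (\<lambda>z :: ('i + 'j) ell2. pair_ell2 (S (left_ell2 z)) (T (right_ell2 z)))"
  proof (rule bounded_linear_intro[where K = "K + K'"])
    fix z :: "('i + 'j) ell2"
    show "norm (pair_ell2 (S (left_ell2 z)) (T (right_ell2 z))) \<le> norm z * (K + K')"
      using norm_pair_le[of "S (left_ell2 z)" "T (right_ell2 z)"] K[of z] K'[of z]
      unfolding distrib_left by linarith
  qed (simp_all only: S.add T.add S.scaleR T.scaleR pair_add pair_scaleR)
  then show ?thesis by (simp add: dsum_op_def bounded_linear_Blinfun_apply)
qed

lemma bounded_linear_pair:
  "bounded_linear (\<lambda>x. pair_ell2 x 0)" "bounded_linear (\<lambda>y. pair_ell2 0 y)"
proof -
  show "bounded_linear (\<lambda>x. pair_ell2 x 0)"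
    by (rule bounded_linear_intro[where K = 1])
      (use pair_add[of _ _ 0 0] pair_scaleR[of _ _ 0] in \<open>simp_all add: pair_zero_norm\<close>)
  show "bounded_linear (\<lambda>y. pair_ell2 0 y)"
    by (rule bounded_linear_intro[where K = 1])
      (use pair_add[of 0 0] pair_scaleR[of _ 0] in \<open>simp_all add: pair_zero_norm\<close>)
qed

definition left_corner :: "(('i + 'j) ell2 \<Rightarrow>\<^sub>L ('i + 'j) ell2) \<Rightarrow> ('i ell2 \<Rightarrow>\<^sub>L 'i ell2)" where
  "left_corner R = Blinfun (\<lambda>x. left_ell2 (R (pair_ell2 x 0)))"

definition right_corner :: "(('i + 'j) ell2 \<Rightarrow>\<^sub>L ('i + 'j) ell2) \<Rightarrow> ('j ell2 \<Rightarrow>\<^sub>L 'j ell2)" where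
  "right_corner R = Blinfun (\<lambda>y. right_ell2 (R (pair_ell2 0 y)))"

lemma left_corner_apply: "left_corner R x = left_ell2 (R (pair_ell2 x 0))"
  unfolding left_corner_def
  by (intro bounded_linear_Blinfun_apply[THEN fun_cong] bounded_linear_compose[OF bounded_linear_left]
      bounded_linear_compose[OF blinfun.bounded_linear_right] bounded_linear_pair)

lemma right_corner_apply: "right_corner R y = right_ell2 (R (pair_ell2 0 y))"
  unfolding right_corner_def
  by (intro bounded_linear_Blinfun_apply[THEN fun_cong] bounded_linear_compose[OF bounded_linear_right]
      bounded_linear_compose[OF blinfun.bounded_linear_right] bounded_linear_pair)

lemma corner_dsum [simp]:
  "left_corner (dsum_op S T) = S" "right_corner (dsum_op S T) = T"
  by (auto intro!: blinfun_eqI simp: left_corner_apply right_corner_apply dsum_op_apply)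

definition dsum :: "('i ell2 \<Rightarrow>\<^sub>L 'i ell2) set \<Rightarrow> ('j ell2 \<Rightarrow>\<^sub>L 'j ell2) set \<Rightarrow>
    (('i + 'j) ell2 \<Rightarrow>\<^sub>L ('i + 'j) ell2) set" where
  "dsum X Y = {dsum_op x y | x y. x \<in> X \<and> y \<in> Y}"

section \<open>The complete Gromov-Hausdorff distance\<close>

definition admissible :: "('i ell2 \<Rightarrow>\<^sub>L 'i ell2) set \<Rightarrow> (('i ell2 \<Rightarrow>\<^sub>L 'i ell2) \<Rightarrow> real) \<Rightarrow>
    ('j ell2 \<Rightarrow>\<^sub>L 'j ell2) set \<Rightarrow> (('j ell2 \<Rightarrow>\<^sub>L 'j ell2) \<Rightarrow> real) \<Rightarrow>
    ((('i + 'j) ell2 \<Rightarrow>\<^sub>L ('i + 'j) ell2) \<Rightarrow> real) \<Rightarrow> bool" where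
  "admissible X LX Y LY L \<longleftrightarrow>
     compact_quantum_metric_space (dsum X Y) L \<and>
     (\<forall>x\<in>X. LX x = (INF y\<in>Y. L (dsum_op x y))) \<and>
     (\<forall>y\<in>Y. LY y = (INF x\<in>X. L (dsum_op x y)))"

definition hausdorff_dist :: "('a \<Rightarrow> 'a \<Rightarrow> ennreal) \<Rightarrow> 'a set \<Rightarrow> 'a set \<Rightarrow> ennreal" where
  "hausdorff_dist d A B = max (SUP a\<in>A. INF b\<in>B. d a b) (SUP b\<in>B. INF a\<in>A. d a b)"

text \<open>
  The images of \<open>UCP\<^sub>n(X)\<close> and \<open>UCP\<^sub>n(Y)\<close> under composition with the coordinate projections,
  which are given by the corners (see corner_dsum).
\<close>

definition UCP_left :: "nat \<Rightarrow> ('i ell2 \<Rightarrow>\<^sub>L 'i ell2) set \<Rightarrow> ('j ell2 \<Rightarrow>\<^sub>L 'j ell2) set \<Rightarrow>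
    ((('i + 'j) ell2 \<Rightarrow>\<^sub>L ('i + 'j) ell2) \<Rightarrow> complex mat) set" where
  "UCP_left n X Y = (\<lambda>\<phi>. \<lambda>z\<in>dsum X Y. \<phi> (left_corner z)) ` UCP n X"

definition UCP_right :: "nat \<Rightarrow> ('i ell2 \<Rightarrow>\<^sub>L 'i ell2) set \<Rightarrow> ('j ell2 \<Rightarrow>\<^sub>L 'j ell2) set \<Rightarrow>
    ((('i + 'j) ell2 \<Rightarrow>\<^sub>L ('i + 'j) ell2) \<Rightarrow> complex mat) set" where
  "UCP_right n X Y = (\<lambda>\<psi>. \<lambda>z\<in>dsum X Y. \<psi> (right_corner z)) ` UCP n Y"

definition dist_s :: "('i ell2 \<Rightarrow>\<^sub>L 'i ell2) set \<Rightarrow> (('i ell2 \<Rightarrow>\<^sub>L 'i ell2) \<Rightarrow> real) \<Rightarrow>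
    ('j ell2 \<Rightarrow>\<^sub>L 'j ell2) set \<Rightarrow> (('j ell2 \<Rightarrow>\<^sub>L 'j ell2) \<Rightarrow> real) \<Rightarrow> ennreal" where
  "dist_s X LX Y LY =
     (INF L\<in>{L. admissible X LX Y LY L}. SUP n\<in>{1..}.
        hausdorff_dist (UCP_dist (dsum X Y) L) (UCP_left n X Y) (UCP_right n X Y))"

section \<open>The circle\<close>

definition qint :: "real \<Rightarrow> int \<Rightarrow> real" where
  "qint q n = (if q = 1 then real_of_int n else (q powi n - q powi (- n)) / (q - inverse q))"

text \<open>\<open>shift_pow n\<close> is the power \<open>U\<^sup>n\<close> of the bilateral shift; see the lemmas below.\<close>

lift_definition shift_ell2 :: "int \<Rightarrow> int ell2 \<Rightarrow> int ell2" is "\<lambda>n x j. x (j - n)"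
proof -
  fix n :: int and x :: "int \<Rightarrow> complex"
  assume "(\<lambda>i. (cmod (x i))\<^sup>2) summable_on UNIV"
  moreover have "bij (\<lambda>j::int. j - n)"
    by (rule bij_betw_byWitness[where f' = "\<lambda>j. j + n"]) auto
  ultimately show "(\<lambda>j. (cmod (x (j - n)))\<^sup>2) summable_on UNIV"
    using summable_on_reindex_bij_betw[of "\<lambda>j. j - n" UNIV UNIV "\<lambda>i. (cmod (x i))\<^sup>2"] by simp
qed

lemma norm_shift_ell2: "norm (shift_ell2 n x) = norm x"
proof -
  have b: "bij (\<lambda>j::int. j - n)"
    by (rule bij_betw_byWitness[where f' = "\<lambda>j. j + n"]) auto
  have "(norm (shift_ell2 n x))\<^sup>2 = (norm x)\<^sup>2"
    unfolding norm_ell2_square shift_ell2.rep_eq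
    by (rule infsum_reindex_bij_betw[OF b])
  then show ?thesis by (simp add: power2_eq_iff_nonneg)
qed

definition shift_pow :: "int \<Rightarrow> (int ell2 \<Rightarrow>\<^sub>L int ell2)" where
  "shift_pow n = Blinfun (shift_ell2 n)"

lemma shift_pow_apply: "shift_pow n x = shift_ell2 n x"
proof -
  have "bounded_linear (shift_ell2 n)"
    by (rule bounded_linear_intro[where K = 1])
      (auto intro!: ell2_eqI simp: shift_ell2.rep_eq norm_shift_ell2)
  then show ?thesis by (simp add: shift_pow_def bounded_linear_Blinfun_apply)
qed

abbreviation bilateral_shift :: "int ell2 \<Rightarrow>\<^sub>L int ell2" where
  "bilateral_shift \<equiv> shift_pow 1"

lemma shift_pow_ket: "shift_pow n (ket j) = ket (j + n)"
  by (rule ell2_eqI) (auto simp: shift_pow_apply shift_ell2.rep_eq)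

lemma shift_pow_bops: "shift_pow n \<in> bops"
  by (auto intro!: ell2_eqI simp: bops_def shift_pow_apply shift_ell2.rep_eq)

lemma shift_pow_0: "shift_pow 0 = id_blinfun"
  by (auto intro!: blinfun_eqI ell2_eqI simp: shift_pow_apply shift_ell2.rep_eq)

lemma shift_pow_add: "shift_pow (m + n) = shift_pow m o\<^sub>L shift_pow n"
  by (auto intro!: blinfun_eqI ell2_eqI simp: shift_pow_apply shift_ell2.rep_eq diff_diff_eq)

definition C_circle :: "(int ell2 \<Rightarrow>\<^sub>L int ell2) set" where
  "C_circle = cstar_generated {bilateral_shift}"

definition O_circle :: "(int ell2 \<Rightarrow>\<^sub>L int ell2) set" where
  "O_circle = cop.span (range shift_pow)"

definition spectral_band :: "nat \<Rightarrow> (int ell2 \<Rightarrow>\<^sub>L int ell2) set" where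
  "spectral_band M = cop.span {shift_pow n | n. - int M \<le> n \<and> n \<le> int M}"

definition is_q_derivative :: "real \<Rightarrow> (int ell2 \<Rightarrow>\<^sub>L int ell2) \<Rightarrow> (int ell2 \<Rightarrow>\<^sub>L int ell2) \<Rightarrow> bool" where
  "is_q_derivative q T D \<longleftrightarrow> D \<in> bops \<and>
     (\<forall>j k. mat_entry D j k = \<i> * complex_of_real (qint q (j - k)) * mat_entry T j k)"

lemma bops_eqI:
  assumes "S \<in> bops" "T \<in> bops" "\<And>j k. mat_entry S j k = mat_entry T j k"
  shows "S = T"
proof -
  have ket: "S (ket k) = T (ket k)" for k
    using assms(3) by (intro ell2_eqI) (simp add: mat_entry_def cinner_ket_left)
  have exp: "((\<lambda>j. coord x j *\<^sub>C R (ket j)) has_sum R x) UNIV"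
    if "R \<in> bops" for R :: "'a ell2 \<Rightarrow>\<^sub>L 'a ell2" and x
    using has_sum_bounded_linear[OF blinfun.bounded_linear_right[of R] ell2_expansion[of x]] that
    by (simp add: bops_def)
  show ?thesis
    using exp[OF assms(1)] exp[OF assms(2)] ket
    by (intro blinfun_eqI) (metis (no_types, lifting) has_sum_cong has_sum_unique)
qed

lemma is_q_derivative_unique: "is_q_derivative q T D \<Longrightarrow> is_q_derivative q T D' \<Longrightarrow> D = D'"
  by (auto intro: bops_eqI simp: is_q_derivative_def)

definition Lip_ell2 :: "real \<Rightarrow> (int ell2 \<Rightarrow>\<^sub>L int ell2) set" where
  "Lip_ell2 q = {T \<in> bops. \<exists>D. is_q_derivative q T D}"

definition q_deriv :: "real \<Rightarrow> (int ell2 \<Rightarrow>\<^sub>L int ell2) \<Rightarrow> (int ell2 \<Rightarrow>\<^sub>L int ell2)" where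
  "q_deriv q T = (THE D. is_q_derivative q T D)"

definition Lip_circle :: "real \<Rightarrow> (int ell2 \<Rightarrow>\<^sub>L int ell2) set" where
  "Lip_circle q = C_circle \<inter> Lip_ell2 q"

definition L_q :: "real \<Rightarrow> (int ell2 \<Rightarrow>\<^sub>L int ell2) \<Rightarrow> real" where
  "L_q q T = norm (q_deriv q T)"

definition epsilon :: "nat \<Rightarrow> real" where
  "epsilon M = sqrt 2 * sqrt (real M / (real M + 1)\<^sup>2 + (\<Sum>\<^sub>\<infinity>k\<in>{M + 1..}. 1 / (real k)\<^sup>2))"

end

theory Submission
  imports Defs "HOL-Real_Asymp.Real_Asymp"
begin

text \<open>
  The proof compares \<^term>\<open>Lip_circle q\<close> with a subsystem by means of the Fejer mean
  \<open>\<Phi> = fejer M\<close>, which multiplies the \<open>k\<close>-th Fourier coefficient by \<open>1 - \<bar>k\<bar>/(M + 1)\<close> for \<open>\<bar>k\<bar> \<le> M\<close> and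
  by zero otherwise, and so takes values in the spectral band. Three properties of \<open>\<Phi>\<close> matter.

  First, \<open>\<Phi>\<close> is unital and completely positive and does not increase norms. On Laurent operators (those
  with a matrix constant along diagonals) it is the sum over all integers \<open>l\<close> of the compressions to
  the window from \<open>l\<close> to \<open>l + M\<close>, divided by \<open>M + 1\<close>; this is \<open>fejer_window_has_sum\<close>.

  Second, \<open>\<Phi>\<close> commutes with the \<open>q\<close>-derivative, both being multipliers of Fourier coefficients. The
  \<open>q\<close>-derivative of an element of \<^term>\<open>Lip_circle q\<close> is again a Laurent operator, so \<open>\<Phi>\<close> does not increase
  \<^term>\<open>L_q q\<close>.

  Third, \<open>\<parallel>T - \<Phi> T\<parallel> \<le> epsilon M * L_q q T\<close> (\<open>norm_diff_fejer_le\<close>). The norm of \<open>T - \<Phi> T\<close> is at most the sum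
  of the moduli of its Fourier coefficients. Since \<open>\<bar>[k]\<^sub>q\<bar> \<ge> \<bar>k\<bar>\<close>, these are at most
  \<open>(1 - \<gamma>\<^sub>k)/\<bar>k\<bar>\<close> times those of the \<open>q\<close>-derivative for \<open>k \<noteq> 0\<close>, where \<open>\<gamma>\<^sub>k\<close> is the weight, and zero for \<open>k = 0\<close>.
  Cauchy-Schwarz applies: the
  coefficients of the derivative are square summable with sum at most \<open>(L_q q T)\<^sup>2\<close>, being the coordinates
  of the image of a unit vector, and the squares of the factors sum up to \<open>(epsilon M)\<^sup>2\<close>.

  These properties suffice for the bound on the distance, by the general theorem
  \<open>dist_s_le_of_approximation\<close>: an explicit seminorm on the direct sum is admissible and makes a map on the
  large system close to its restriction, and a map \<open>\<psi>\<close> on the subsystem close to \<open>\<psi> \<circ> \<Phi>\<close>. That the direct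
  sum is a compact quantum metric space is Rieffel's criterion (\<open>compact_quantum_metric_spaceI\<close>): the unit
  ball of the seminorm is totally bounded modulo scalars. For \<^term>\<open>Lip_circle q\<close> this holds by the
  third property again, and it passes to subsystems and to direct sums.

  The argument works for every subsystem that contains the band and is spanned by the shifts
  with exponents in a symmetric set. For the algebraic
  functions \<^const>\<open>O_circle\<close> it applies with every \<open>M\<close>, and \<^const>\<open>epsilon\<close> tends to zero.
\<close>

section \<open>Operators on square-summable families\<close>

lemma cinner_add_left: "cinner (x + y) z = cinner x z + cinner y z"
  by (metis cinner_commute cinner_add_right complex_cnj_add)

lemma cinner_scaleC_left: "cinner (c *\<^sub>C x) y = cnj c * cinner x y"
  by (metis cinner_commute cinner_scaleC_right complex_cnj_mult)

lemma cinner_diff_right: "cinner x (y - z) = cinner x y - cinner x z"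
  using cinner_add_right[of x "y - z" z] by simp

lemma cinner_diff_left: "cinner (x - y) z = cinner x z - cinner y z"
  using cinner_add_left[of "x - y" y z] by simp

lemma cinner_zero [simp]: "cinner x 0 = 0" "cinner 0 x = 0"
  using cinner_diff_right[of x 0 0] cinner_diff_left[of 0 0 x] by simp_all

lemma cinner_sum_right: "cinner x (sum f A) = (\<Sum>a\<in>A. cinner x (f a))"
  by (induction A rule: infinite_finite_induct) (simp_all add: cinner_add_right)

lemma cinner_sum_left: "cinner (sum f A) y = (\<Sum>a\<in>A. cinner (f a) y)"
  by (induction A rule: infinite_finite_induct) (simp_all add: cinner_add_left)

lemma cinner_self_norm: "cinner x x = complex_of_real ((norm x)\<^sup>2)"
  by (simp add: cinner_self norm_ell2_square)

lemma coord_sum: "coord (sum f A) i = (\<Sum>a\<in>A. coord (f a) i)"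
  by (induction A rule: infinite_finite_induct) simp_all

lemma norm_ket [simp]: "norm (ket j) = 1"
proof -
  have "complex_of_real ((norm (ket j))\<^sup>2) = 1"
    unfolding cinner_self_norm[symmetric] by (simp add: cinner_ket_left)
  then have "(norm (ket j))\<^sup>2 = 1\<^sup>2" by (simp only: of_real_eq_1_iff power_one)
  then show ?thesis by (simp only: power2_eq_iff_nonneg norm_ge_zero zero_le_one)
qed

text \<open>
  Fatou's lemma for \<open>\<ell>\<^sup>2\<close>: each finite part of the square sum passes to the limit. It is the
  limit step for the partial sums of a Fourier series in \<open>norm_le_of_fourier_sums\<close>.
\<close>

lemma norm_le_of_coord_tendsto:
  assumes lim: "\<And>i. ((\<lambda>a. coord (x a) i) \<longlongrightarrow> coord y i) A" and "A \<noteq> bot"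
    and bound: "\<forall>\<^sub>F a in A. norm (x a) \<le> B" and "0 \<le> B"
  shows "norm y \<le> B"
proof -
  have "(\<Sum>i\<in>G. (cmod (coord y i))\<^sup>2) \<le> B\<^sup>2" if "finite G" for G
  proof (rule tendsto_upperbound)
    show "((\<lambda>a. \<Sum>i\<in>G. (cmod (coord (x a) i))\<^sup>2) \<longlongrightarrow> (\<Sum>i\<in>G. (cmod (coord y i))\<^sup>2)) A"
      by (intro tendsto_intros lim)
    show "\<forall>\<^sub>F a in A. (\<Sum>i\<in>G. (cmod (coord (x a) i))\<^sup>2) \<le> B\<^sup>2"
      using bound
    proof eventually_elim
      case (elim a)
      have "(\<Sum>i\<in>G. (cmod (coord (x a) i))\<^sup>2) \<le> (norm (x a))\<^sup>2"
        unfolding norm_ell2_square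
        by (rule finite_sum_le_infsum[OF coord_summable that]) auto
      also have "\<dots> \<le> B\<^sup>2" using elim by (intro power_mono) auto
      finally show ?case .
    qed
  qed fact
  then have "(norm y)\<^sup>2 \<le> B\<^sup>2"
    unfolding norm_ell2_square by (intro infsum_le_finite_sums[OF coord_summable]) auto
  then show ?thesis using \<open>0 \<le> B\<close> by (rule power2_le_imp_le)
qed

lemma bopsD: "T \<in> bops \<Longrightarrow> T (c *\<^sub>C x) = c *\<^sub>C T x"
  by (simp add: bops_def)

lemma subspace_bops: "cop.subspace bops"
  by (rule cop.subspaceI)
    (auto simp: bops_def blinfun.add_left scaleC_op_apply algebra_simps intro!: ell2_eqI)

lemmas bops_intros = cop.subspace_0[OF subspace_bops] cop.subspace_add[OF subspace_bops]
  cop.subspace_diff[OF subspace_bops] cop.subspace_scale[OF subspace_bops]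
  cop.subspace_sum[OF subspace_bops] adj_bops shift_pow_bops

lemma bops_id [simp]: "id_blinfun \<in> bops"
  and bops_compose: "S \<in> bops \<Longrightarrow> T \<in> bops \<Longrightarrow> S o\<^sub>L T \<in> bops"
  by (auto simp: bops_def)

lemma norm_scaleC_op [simp]: "norm (scaleC_op c T) = cmod c * norm T"
proof -
  have le: "norm (scaleC_op c T) \<le> cmod c * norm T" for c and T :: "'a ell2 \<Rightarrow>\<^sub>L 'b ell2"
    by (rule norm_blinfun_bound)
      (simp_all add: scaleC_op_apply mult.assoc mult_left_mono norm_blinfun)
  show ?thesis
  proof (cases "c = 0")
    case False
    have "cmod c * norm T = cmod c * norm (scaleC_op (inverse c) (scaleC_op c T))"
      using False by (simp del: cop.scale_scale add: cop.scale_scale)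
    also have "\<dots> \<le> cmod c * (cmod (inverse c) * norm (scaleC_op c T))"
      by (intro mult_left_mono le) auto
    also have "\<dots> = norm (scaleC_op c T)"
      using False by (simp add: norm_inverse)
    finally show ?thesis using le[of c T] by simp
  qed simp
qed

lemma adj_eqI:
  assumes "\<And>x y. cinner (blinfun_apply S x) y = cinner x (blinfun_apply T y)"
  shows "adj T = S"
  unfolding adj_def
proof (rule the_equality)
  fix S' assume "\<forall>x y. cinner (blinfun_apply S' x) y = cinner x (blinfun_apply T y)"
  then show "S' = S"
    using assms by (intro blinfun_eqI ell2_eqI) (metis cinner_commute cinner_ket_left)
qed (use assms in blast)

lemma cinner_adj_right:
  "T \<in> bops \<Longrightarrow> cinner x (adj T y) = cinner (blinfun_apply T x) y"
  by (metis cinner_adj cinner_commute)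

lemma adj_add: "S \<in> bops \<Longrightarrow> T \<in> bops \<Longrightarrow> adj (S + T) = adj S + adj T"
  by (rule adj_eqI) (simp add: blinfun.add_left cinner_add_left cinner_add_right cinner_adj)

lemma adj_scaleC_op: "T \<in> bops \<Longrightarrow> adj (scaleC_op c T) = scaleC_op (cnj c) (adj T)"
  by (rule adj_eqI)
    (simp add: scaleC_op_apply cinner_scaleC_left cinner_scaleC_right cinner_adj)

lemma adj_diff:
  assumes "S \<in> bops" "T \<in> bops"
  shows "adj (S - T) = adj S - adj T"
  by (rule adj_eqI)
    (simp add: blinfun.diff_left cinner_diff_left cinner_diff_right cinner_adj assms)

lemma adj_id [simp]: "adj id_blinfun = id_blinfun"
  by (rule adj_eqI) simp

lemma adj_adj [simp]: "T \<in> bops \<Longrightarrow> adj (adj T) = T"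
  by (rule adj_eqI) (simp add: cinner_adj_right)

lemma norm_adj [simp]:
  assumes "T \<in> bops"
  shows "norm (adj T) = norm T"
proof -
  have le: "norm (adj T) \<le> norm T" if "T \<in> bops" for T :: "'b ell2 \<Rightarrow>\<^sub>L 'b ell2"
  proof (rule norm_blinfun_bound)
    fix x
    have "complex_of_real ((norm (adj T x))\<^sup>2) = cinner x (T (adj T x))"
      unfolding cinner_self_norm[symmetric] by (rule cinner_adj[OF that])
    then have "(norm (adj T x))\<^sup>2 = cmod (cinner x (T (adj T x)))"
      by (metis abs_of_nonneg norm_of_real zero_le_power2)
    also have "\<dots> \<le> norm x * (norm T * norm (adj T x))"
      by (rule order_trans[OF cinner_Cauchy_Schwarz]) (simp add: mult_left_mono norm_blinfun)
    finally have "norm (adj T x) * norm (adj T x) \<le> (norm T * norm x) * norm (adj T x)"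
      by (simp add: power2_eq_square algebra_simps)
    then show "norm (adj T x) \<le> norm T * norm x"
      by (cases "norm (adj T x) = 0") auto
  qed simp
  show ?thesis using le[OF assms] le[OF adj_bops[OF assms]] assms by simp
qed

lemma mat_entry_coord: "mat_entry T j k = coord (T (ket k)) j"
  by (simp add: mat_entry_def cinner_ket_left)

lemma mat_entry_simps [simp]:
  "mat_entry (S + T) j k = mat_entry S j k + mat_entry T j k"
  "mat_entry (S - T) j k = mat_entry S j k - mat_entry T j k"
  "mat_entry (scaleC_op c T) j k = c * mat_entry T j k"
  "mat_entry 0 j k = 0"
  "mat_entry id_blinfun j k = (if j = k then 1 else 0)"
  by (simp_all add: mat_entry_coord blinfun.add_left blinfun.diff_left scaleC_op_apply)

lemma mat_entry_sum: "mat_entry (sum f A) j k = (\<Sum>a\<in>A. mat_entry (f a) j k)"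
  by (induction A rule: infinite_finite_induct) simp_all

lemma mat_entry_adj: "T \<in> bops \<Longrightarrow> mat_entry (adj T) j k = cnj (mat_entry T k j)"
  unfolding mat_entry_def by (simp add: cinner_adj_right) (rule cinner_commute)

lemma norm_mat_entry_le: "cmod (mat_entry T j k) \<le> norm T"
proof -
  have "cmod (mat_entry T j k) \<le> norm (ket j) * norm (T (ket k))"
    unfolding mat_entry_def by (rule cinner_Cauchy_Schwarz)
  also have "\<dots> \<le> norm T" using norm_blinfun[of T "ket k"] by simp
  finally show ?thesis .
qed

text \<open>
  The bound is only asked for in the symmetric form with \<open>\<parallel>x\<parallel>\<^sup>2 + \<parallel>y\<parallel>\<^sup>2\<close>, which is what sums of
  positive terms deliver; rescaling \<open>x\<close> against \<open>y\<close> recovers the product of the norms.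
\<close>

lemma norm_blinfun_le_of_sesquilinear:
  fixes R :: "'i ell2 \<Rightarrow>\<^sub>L 'i ell2"
  assumes "0 \<le> C"
    and bound: "\<And>x y. cmod (cinner x (R y)) \<le> C * ((norm x)\<^sup>2 + (norm y)\<^sup>2) / 2"
  shows "norm R \<le> C"
proof (rule norm_blinfun_bound)
  fix y
  show "norm (R y) \<le> C * norm y"
  proof (cases "R y = 0")
    case False
    \<comment> \<open>the multiple of \<open>R y\<close> that has the norm of \<open>y\<close>, so that both squares on the right agree\<close>
    define t where "t = norm y / norm (R y)"
    have t: "t * norm (R y) = norm y" and "t \<ge> 0" using False by (simp_all add: t_def)
    have "y \<noteq> 0" using False by auto
    have "cinner (t *\<^sub>R R y) (R y) = of_real (t * (norm (R y))\<^sup>2)"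
      by (simp add: scaleR_scaleC cinner_scaleC_left cinner_self_norm)
    then have "cmod (cinner (t *\<^sub>R R y) (R y)) = t * norm (R y) * norm (R y)"
      using \<open>t \<ge> 0\<close> by (simp only: norm_of_real) (simp add: power2_eq_square)
    then have "norm y * norm (R y) = cmod (cinner (t *\<^sub>R R y) (R y))" by (simp add: t)
    also have "\<dots> \<le> C * ((norm (t *\<^sub>R R y))\<^sup>2 + (norm y)\<^sup>2) / 2" by (rule bound)
    also have "\<dots> = norm y * (C * norm y)"
      using t \<open>t \<ge> 0\<close> by (simp add: power2_eq_square)
    finally show ?thesis using \<open>y \<noteq> 0\<close> by simp
  qed (use \<open>0 \<le> C\<close> in simp)
qed fact

section \<open>States and Rieffel's compactness criterion\<close>

lemma operator_system_closed:
  assumes "operator_system X"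
  shows "X \<subseteq> bops" "cop.subspace X" "\<And>x. x \<in> X \<Longrightarrow> adj x \<in> X" "id_blinfun \<in> X"
    "\<And>x y. x \<in> X \<Longrightarrow> y \<in> X \<Longrightarrow> x + y \<in> X" "\<And>x y. x \<in> X \<Longrightarrow> y \<in> X \<Longrightarrow> x - y \<in> X"
    "\<And>c x. x \<in> X \<Longrightarrow> scaleC_op c x \<in> X" "0 \<in> X" "\<And>x. x \<in> X \<Longrightarrow> x \<in> bops"
  using assms
  by (auto simp: operator_system_def cop.subspace_add cop.subspace_diff cop.subspace_scale
      cop.subspace_0)

lemma slip_normD:
  assumes "slip_norm X L"
  shows "\<And>x. x \<in> X \<Longrightarrow> 0 \<le> L x"
    "\<And>x y. x \<in> X \<Longrightarrow> y \<in> X \<Longrightarrow> L (x + y) \<le> L x + L y"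
    "\<And>c x. x \<in> X \<Longrightarrow> L (scaleC_op c x) = cmod c * L x"
    "\<And>x. x \<in> X \<Longrightarrow> L (adj x) = L x" "L id_blinfun = 0"
  using assms by (auto simp: slip_norm_def)

lemma statesD:
  assumes "\<phi> \<in> states X"
  shows "\<And>x y. x \<in> X \<Longrightarrow> y \<in> X \<Longrightarrow> \<phi> (x + y) = \<phi> x + \<phi> y"
    "\<And>c x. x \<in> X \<Longrightarrow> \<phi> (scaleC_op c x) = c * \<phi> x" "\<phi> id_blinfun = 1"
    "\<And>x. x \<in> X \<Longrightarrow> positive_op x \<Longrightarrow> \<phi> x \<in> \<real>\<^sub>\<ge>\<^sub>0"
    "\<phi> \<in> extensional X"
  using assms by (auto simp: states_def)

lemma state_diff:
  assumes "operator_system X" "\<phi> \<in> states X" "x \<in> X" "y \<in> X"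
  shows "\<phi> (x - y) = \<phi> x - \<phi> y"
  using statesD(1)[OF assms(2), of "x - y" y] operator_system_closed(6)[OF assms(1,3,4)] assms
  by simp

lemma nonneg_Reals_of_norm_le:
  assumes "z \<in> \<real>" "cmod z \<le> r"
  shows "complex_of_real r + z \<in> \<real>\<^sub>\<ge>\<^sub>0" "complex_of_real r - z \<in> \<real>\<^sub>\<ge>\<^sub>0"
  using assms by (auto simp: complex_nonneg_Reals_iff Reals_def)

text \<open>
  Both \<open>\<parallel>x\<parallel> + x\<close> and \<open>\<parallel>x\<parallel> - x\<close> are positive, and their images under a state are nonnegative reals.
\<close>

lemma state_selfadjoint_bound:
  fixes X :: "('i ell2 \<Rightarrow>\<^sub>L 'i ell2) set"
  assumes os: "operator_system X" and \<phi>: "\<phi> \<in> states X" and x: "x \<in> X" "adj x = x"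
  shows "cmod (\<phi> x) \<le> norm x"
proof -
  note os' = operator_system_closed[OF os]
  have xb: "x \<in> bops" using x os'(1) by blast
  let ?n = "scaleC_op (complex_of_real (norm x)) id_blinfun :: 'i ell2 \<Rightarrow>\<^sub>L 'i ell2"
  have nX: "?n \<in> X" by (intro os'(4,7))
  have real: "cinner \<xi> (x \<xi>) \<in> \<real>" for \<xi>
    using cinner_adj[OF xb, of \<xi> \<xi>] cinner_commute[of \<xi> "x \<xi>"] x(2) by (simp add: Reals_cnj_iff)
  have le: "cmod (cinner \<xi> (x \<xi>)) \<le> norm x * (norm \<xi>)\<^sup>2" for \<xi>
  proof -
    have "cmod (cinner \<xi> (x \<xi>)) \<le> norm \<xi> * (norm x * norm \<xi>)"
      by (rule order_trans[OF cinner_Cauchy_Schwarz]) (simp add: mult_left_mono norm_blinfun)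
    then show ?thesis by (simp add: power2_eq_square algebra_simps)
  qed
  have "cinner \<xi> (?n \<xi>) = complex_of_real (norm x * (norm \<xi>)\<^sup>2)" for \<xi>
    by (simp add: scaleC_op_apply cinner_scaleC_right cinner_self_norm)
  then have "cinner \<xi> ((?n + x) \<xi>) \<in> \<real>\<^sub>\<ge>\<^sub>0" "cinner \<xi> ((?n - x) \<xi>) \<in> \<real>\<^sub>\<ge>\<^sub>0" for \<xi>
    using nonneg_Reals_of_norm_le[OF real le]
    by (simp_all add: blinfun.add_left blinfun.diff_left cinner_add_right cinner_diff_right)
  then have "positive_op (?n + x)" "positive_op (?n - x)"
    unfolding positive_op_def by blast+
  then have "\<phi> (?n + x) \<in> \<real>\<^sub>\<ge>\<^sub>0" "\<phi> (?n - x) \<in> \<real>\<^sub>\<ge>\<^sub>0"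
    by (auto intro!: statesD(4)[OF \<phi>] os'(5,6) nX x(1))
  moreover have "\<phi> ?n = complex_of_real (norm x)"
    by (simp add: statesD(2,3)[OF \<phi>] os'(4))
  ultimately have p: "complex_of_real (norm x) + \<phi> x \<in> \<real>\<^sub>\<ge>\<^sub>0" "complex_of_real (norm x) - \<phi> x \<in> \<real>\<^sub>\<ge>\<^sub>0"
    using nX x(1) by (simp_all add: statesD(1)[OF \<phi>] state_diff[OF os \<phi>])
  then have "Im (\<phi> x) = 0" "\<bar>Re (\<phi> x)\<bar> \<le> norm x"
    by (auto simp: complex_nonneg_Reals_iff)
  then show ?thesis by (simp add: cmod_eq_Re)
qed

text \<open>
  Splitting into real and imaginary part loses a factor of two, which does no harm: the bound only
  serves to show that states are equicontinuous.
\<close>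

lemma state_bound:
  assumes os: "operator_system X" and \<phi>: "\<phi> \<in> states X" and x: "x \<in> X"
  shows "cmod (\<phi> x) \<le> 2 * norm x"
proof -
  note os' = operator_system_closed[OF os]
  have xb: "x \<in> bops" using x os'(1) by blast
  define a where "a = scaleC_op (1/2) (x + adj x)"
  define b where "b = scaleC_op (- \<i>/2) (x - adj x)"
  have X: "a \<in> X" "b \<in> X" unfolding a_def b_def by (intro os'(3,5-7) x)+
  have sa: "adj a = a"
    using xb by (simp add: a_def adj_scaleC_op adj_add bops_intros add.commute)
  have sb: "adj b = b"
    using xb by (simp add: b_def adj_scaleC_op adj_diff bops_intros cop.scale_right_diff_distrib)
  have eq: "x = a + scaleC_op \<i> b"
    by (rule blinfun_eqI)
      (auto intro!: ell2_eqI simp: a_def b_def scaleC_op_apply blinfun.add_left blinfun.diff_left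
        field_simps)
  have na: "norm a \<le> norm x"
    using norm_triangle_ineq[of x "adj x"] xb by (simp add: a_def)
  have nb: "norm b \<le> norm x"
    using norm_triangle_ineq4[of x "adj x"] xb by (simp add: b_def norm_divide)
  have "\<phi> x = \<phi> a + \<i> * \<phi> b"
    by (subst eq) (simp add: statesD(1,2)[OF \<phi>] os'(7) X)
  then have "cmod (\<phi> x) \<le> cmod (\<phi> a) + cmod (\<phi> b)"
    by (metis norm_triangle_ineq norm_mult norm_ii mult_1)
  then show ?thesis
    using state_selfadjoint_bound[OF os \<phi> X(1) sa] state_selfadjoint_bound[OF os \<phi> X(2) sb] na nb
    by linarith
qed

text \<open>
  Rieffel's condition: modulo the scalars, on which states agree, the unit ball of \<open>L\<close> has a finite
  \<open>\<delta>\<close>-net for every \<open>\<delta>\<close>.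
\<close>

definition totally_bounded_mod_scalars ::
    "('i ell2 \<Rightarrow>\<^sub>L 'i ell2) set \<Rightarrow> (('i ell2 \<Rightarrow>\<^sub>L 'i ell2) \<Rightarrow> real) \<Rightarrow> bool" where
  "totally_bounded_mod_scalars X L \<longleftrightarrow>
     (\<forall>\<delta>>0. \<exists>F. finite F \<and> F \<subseteq> X \<and>
        (\<forall>x\<in>X. L x \<le> 1 \<longrightarrow> (\<exists>f\<in>F. \<exists>c. norm (x - scaleC_op c id_blinfun - f) \<le> \<delta>)))"

text \<open>
  The points of a net for the ball of \<open>X\<close> need not lie in \<open>Y\<close>. Each one that is close to \<open>Y\<close> is
  replaced by a point of \<open>Y\<close>, at the price of doubling the radius.
\<close>

lemma totally_bounded_mod_scalars_subset:
  assumes "totally_bounded_mod_scalars X L" "Y \<subseteq> X"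
  shows "totally_bounded_mod_scalars Y L"
  unfolding totally_bounded_mod_scalars_def
proof (intro allI impI)
  fix \<delta> :: real assume "\<delta> > 0"
  then obtain F where F: "finite F"
    "\<And>x. x \<in> X \<Longrightarrow> L x \<le> 1 \<Longrightarrow> \<exists>f\<in>F. \<exists>c. norm (x - scaleC_op c id_blinfun - f) \<le> \<delta>/2"
    using assms(1) unfolding totally_bounded_mod_scalars_def
    by (metis half_gt_zero)
  define near where "near f y \<longleftrightarrow> y \<in> Y \<and> (\<exists>c. norm (y - scaleC_op c id_blinfun - f) \<le> \<delta>/2)" for f y
  define G where "G = (\<lambda>f. SOME y. near f y) ` {f \<in> F. \<exists>y. near f y}"
  have G: "near f (SOME y. near f y)" if "\<exists>y. near f y" for f using that by (rule someI_ex)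
  show "\<exists>G. finite G \<and> G \<subseteq> Y \<and>
      (\<forall>x\<in>Y. L x \<le> 1 \<longrightarrow> (\<exists>g\<in>G. \<exists>c. norm (x - scaleC_op c id_blinfun - g) \<le> \<delta>))"
  proof (intro exI[of _ G] conjI ballI impI)
    show "finite G" using F by (simp add: G_def)
    show "G \<subseteq> Y" using G unfolding G_def near_def by fastforce
    fix x assume x: "x \<in> Y" "L x \<le> 1"
    then obtain f c where f: "f \<in> F" "norm (x - scaleC_op c id_blinfun - f) \<le> \<delta>/2"
      using F(2) assms(2) by blast
    then have ex: "\<exists>y. near f y" using x near_def by blast
    define y where "y = (SOME y. near f y)"
    obtain d where d: "norm (y - scaleC_op d id_blinfun - f) \<le> \<delta>/2"
      using G[OF ex] unfolding near_def y_def by blast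
    have "x - scaleC_op (c - d) id_blinfun - y
        = (x - scaleC_op c id_blinfun - f) - (y - scaleC_op d id_blinfun - f)"
      unfolding cop.scale_left_diff_distrib by simp
    then have "norm (x - scaleC_op (c - d) id_blinfun - y)
        \<le> norm (x - scaleC_op c id_blinfun - f) + norm (y - scaleC_op d id_blinfun - f)"
      by (simp only: norm_triangle_ineq4)
    then have "norm (x - scaleC_op (c - d) id_blinfun - y) \<le> \<delta>"
      using f(2) d by linarith
    moreover have "y \<in> G" using ex f(1) unfolding G_def y_def by blast
    ultimately show "\<exists>g\<in>G. \<exists>c. norm (x - scaleC_op c id_blinfun - g) \<le> \<delta>" by blast
  qed
qed

text \<open>
  Up to an error of order \<open>\<delta>\<close>, the distance of two states is governed by their values on a finite net
  of the unit ball. So the distance is finite, and a weak-star neighbourhood given by the finitely many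
  elements of the net lies in a given metric ball. The other inclusion of topologies holds for every
  finite seminorm: evaluation at \<open>x\<close> is Lipschitz.
\<close>

lemma compact_quantum_metric_spaceI:
  assumes os: "operator_system X" and slip: "slip_norm X L"
    and tb: "totally_bounded_mod_scalars X L"
  shows "compact_quantum_metric_space X L"
proof -
  note os' = operator_system_closed[OF os] and slip' = slip_normD[OF slip]
  let ?d = "\<lambda>\<phi> \<psi>. enn2real (state_dist X L \<phi> \<psi>)"
  have net: "\<exists>F. finite F \<and> F \<subseteq> X \<and> (\<forall>\<phi>\<in>states X. \<forall>\<psi>\<in>states X. \<forall>x\<in>X. L x \<le> 1 \<longrightarrow>
      cmod (\<phi> x - \<psi> x) \<le> 4 * \<delta> + (\<Sum>f\<in>F. cmod (\<psi> f - \<phi> f)))" if "\<delta> > 0" for \<delta>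
  proof -
    obtain F where F: "finite F" "F \<subseteq> X"
      "\<And>x. x \<in> X \<Longrightarrow> L x \<le> 1 \<Longrightarrow> \<exists>f\<in>F. \<exists>c. norm (x - scaleC_op c id_blinfun - f) \<le> \<delta>"
      using tb \<open>\<delta> > 0\<close> unfolding totally_bounded_mod_scalars_def by metis
    have "cmod (\<phi> x - \<psi> x) \<le> 4 * \<delta> + (\<Sum>f\<in>F. cmod (\<psi> f - \<phi> f))"
      if st: "\<phi> \<in> states X" "\<psi> \<in> states X" and x: "x \<in> X" "L x \<le> 1" for \<phi> \<psi> x
    proof -
      obtain f c where f: "f \<in> F" "norm (x - scaleC_op c id_blinfun - f) \<le> \<delta>"
        using F(3)[OF x] by blast
      define r where "r = x - scaleC_op c id_blinfun - f"
      have X: "f \<in> X" "scaleC_op c id_blinfun \<in> X" "r \<in> X"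
        using f(1) F(2) by (auto simp: r_def intro!: os'(4,6,7) x)
      have val: "\<theta> x = c + \<theta> f + \<theta> r" if "\<theta> \<in> states X" for \<theta>
      proof -
        have "\<theta> r = \<theta> x - \<theta> (scaleC_op c id_blinfun) - \<theta> f"
          unfolding r_def using X x os'(6) by (simp only: state_diff[OF os that])
        then show ?thesis using os'(4) by (simp add: statesD(2,3)[OF that])
      qed
      have "\<phi> x - \<psi> x = (\<phi> r - \<psi> r) + (\<phi> f - \<psi> f)"
        using val[OF st(1)] val[OF st(2)] by simp
      then have "cmod (\<phi> x - \<psi> x) \<le> cmod (\<phi> r - \<psi> r) + cmod (\<psi> f - \<phi> f)"
        using norm_triangle_ineq[of "\<phi> r - \<psi> r" "\<phi> f - \<psi> f"] norm_minus_commute[of "\<phi> f" "\<psi> f"] by simp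
      moreover have "cmod (\<phi> r - \<psi> r) \<le> 4 * \<delta>"
        using norm_triangle_ineq4[of "\<phi> r" "\<psi> r"] state_bound[OF os st(1) X(3)]
          state_bound[OF os st(2) X(3)] f(2) by (simp add: r_def)
      moreover have "cmod (\<psi> f - \<phi> f) \<le> (\<Sum>f\<in>F. cmod (\<psi> f - \<phi> f))"
        using F(1) f(1) by (intro member_le_sum) auto
      ultimately show ?thesis by linarith
    qed
    then show ?thesis using F(1,2) by blast
  qed
  have dist_le: "state_dist X L \<phi> \<psi> \<le> ennreal B"
    if "\<And>x. x \<in> X \<Longrightarrow> L x \<le> 1 \<Longrightarrow> cmod (\<phi> x - \<psi> x) \<le> B" for \<phi> \<psi> B
    unfolding state_dist_def using that by (intro SUP_least ennreal_leI) auto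
  have fin: "state_dist X L \<phi> \<psi> < \<infinity>" if st: "\<phi> \<in> states X" "\<psi> \<in> states X" for \<phi> \<psi>
  proof -
    have "0 < (1::real)" by simp
    from net[OF this] obtain F where "\<forall>x\<in>X. L x \<le> 1 \<longrightarrow> cmod (\<phi> x - \<psi> x) \<le> 4 * 1 + (\<Sum>f\<in>F. cmod (\<psi> f - \<phi> f))"
      using st by blast
    then have "state_dist X L \<phi> \<psi> \<le> ennreal (4 * 1 + (\<Sum>f\<in>F. cmod (\<psi> f - \<phi> f)))"
      by (intro dist_le) blast
    then show ?thesis by (rule le_less_trans) simp
  qed
  have d_le: "?d \<phi> \<psi> \<le> B"
    if "\<And>x. x \<in> X \<Longrightarrow> L x \<le> 1 \<Longrightarrow> cmod (\<phi> x - \<psi> x) \<le> B" "0 \<le> B" for \<phi> \<psi> B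
    using enn2real_mono[OF dist_le[OF that(1)]] that(2) by simp
  have d_ge1: "cmod (\<phi> x - \<psi> x) \<le> ?d \<phi> \<psi>"
    if "\<phi> \<in> states X" "\<psi> \<in> states X" "x \<in> X" "L x \<le> 1" for \<phi> \<psi> x
  proof -
    have "ennreal (cmod (\<phi> x - \<psi> x)) \<le> state_dist X L \<phi> \<psi>"
      unfolding state_dist_def using that by (intro SUP_upper) auto
    then show ?thesis
      using enn2real_mono[of "ennreal (cmod (\<phi> x - \<psi> x))"] fin[OF that(1,2)] by simp
  qed
  have d_ge: "cmod (\<phi> x - \<psi> x) \<le> (L x + 1) * ?d \<phi> \<psi>"
    if "\<phi> \<in> states X" "\<psi> \<in> states X" "x \<in> X" for \<phi> \<psi> x
  proof -
    have pos: "L x + 1 > 0" using slip'(1)[OF that(3)] by simp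
    \<comment> \<open>dividing by \<open>L x + 1\<close> instead of \<open>L x\<close> also covers the case \<open>L x = 0\<close>\<close>
    define c where "c = complex_of_real (inverse (L x + 1))"
    have c: "cmod c = inverse (L x + 1)" using pos by (simp add: c_def del: of_real_inverse of_real_add)
    have "L (scaleC_op c x) \<le> 1"
      using pos that(3) by (simp add: slip'(3) c field_simps)
    then have "cmod (\<phi> (scaleC_op c x) - \<psi> (scaleC_op c x)) \<le> ?d \<phi> \<psi>"
      using that os'(7) by (intro d_ge1) auto
    then have "cmod c * cmod (\<phi> x - \<psi> x) \<le> ?d \<phi> \<psi>"
      using that by (simp add: statesD(2) flip: right_diff_distrib norm_mult)
    then show ?thesis using pos by (simp add: c field_simps)
  qed
  have metric: "Metric_space (states X) ?d"
  proof
    show "?d \<phi> \<psi> = ?d \<psi> \<phi>" for \<phi> \<psi>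
      by (simp add: state_dist_def norm_minus_commute)
    fix \<phi> \<psi> assume st: "\<phi> \<in> states X" "\<psi> \<in> states X"
    show "(?d \<phi> \<psi> = 0) = (\<phi> = \<psi>)"
    proof
      assume z: "?d \<phi> \<psi> = 0"
      show "\<phi> = \<psi>"
      proof (rule extensionalityI)
        show "\<phi> x = \<psi> x" if "x \<in> X" for x using d_ge[OF st that] z by simp
      qed (use st statesD(5) in auto)
    next
      assume "\<phi> = \<psi>"
      then have "?d \<phi> \<psi> \<le> 0" by (intro d_le) auto
      then show "?d \<phi> \<psi> = 0" using enn2real_nonneg[of "state_dist X L \<phi> \<psi>"] by linarith
    qed
    fix \<theta> assume st3: "\<theta> \<in> states X"
    show "?d \<phi> \<theta> \<le> ?d \<phi> \<psi> + ?d \<psi> \<theta>"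
    proof (rule d_le)
      fix x assume "x \<in> X" "L x \<le> 1"
      then show "cmod (\<phi> x - \<theta> x) \<le> ?d \<phi> \<psi> + ?d \<psi> \<theta>"
        using d_ge1[OF st, of x] d_ge1[OF st(2) st3, of x]
          norm_triangle_ineq[of "\<phi> x - \<psi> x" "\<psi> x - \<theta> x"] by simp
    qed simp
  qed simp
  interpret M: Metric_space "states X" ?d by (rule metric)
  have tw: "topspace (weak_star X) = states X"
  proof -
    have "states X \<subseteq> extensional X" by (blast dest: statesD(5))
    then have "states X \<subseteq> (\<Pi>\<^sub>E x\<in>X. UNIV)" by (simp add: subset_iff PiE_iff)
    then show ?thesis by (simp add: weak_star_def Int_absorb1)
  qed
  have eval: "continuous_map (weak_star X) euclidean (\<lambda>\<psi>. \<psi> x)" if "x \<in> X" for x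
    unfolding weak_star_def
    by (intro continuous_map_from_subtopology continuous_map_product_projection that)
  have "openin M.mtopology U \<longleftrightarrow> openin (weak_star X) U" for U
  proof
    assume U: "openin M.mtopology U"
    show "openin (weak_star X) U"
    proof (subst openin_subopen, intro ballI)
      fix \<phi> assume "\<phi> \<in> U"
      then obtain r where r: "r > 0" "M.mball \<phi> r \<subseteq> U" and \<phi>: "\<phi> \<in> states X"
        using U unfolding M.openin_mtopology by blast
      \<comment> \<open>the error \<open>4 * (r/16)\<close> and the sum over the net, at most \<open>r/4\<close>, add up to less than \<open>r\<close>\<close>
      have "r/16 > 0" using r(1) by simp
      from net[OF this] obtain F where F: "finite F" "F \<subseteq> X"
        "\<forall>\<psi>\<in>states X. \<forall>x\<in>X. L x \<le> 1 \<longrightarrow>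
          cmod (\<phi> x - \<psi> x) \<le> 4 * (r/16) + (\<Sum>f\<in>F. cmod (\<psi> f - \<phi> f))"
        using \<phi> by blast
      define T where "T = {\<psi> \<in> topspace (weak_star X). (\<Sum>f\<in>F. cmod (\<psi> f - \<phi> f)) \<in> {..<r/4}}"
      have "continuous_map (weak_star X) euclideanreal (\<lambda>\<psi>. \<Sum>f\<in>F. cmod (\<psi> f - \<phi> f))"
        using F(1,2) by (intro continuous_map_sum continuous_map_norm continuous_map_diff eval) auto
      then have "openin (weak_star X) T"
        unfolding T_def by (rule openin_continuous_map_preimage) simp
      moreover have "\<phi> \<in> T" using \<phi> r(1) by (simp add: T_def tw)
      moreover have "T \<subseteq> U"
      proof
        fix \<psi> assume \<psi>: "\<psi> \<in> T"
        then have "?d \<phi> \<psi> \<le> 4 * (r/16) + r/4"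
          using r(1) F(3) unfolding T_def tw by (intro d_le) force+
        then show "\<psi> \<in> U" using r \<phi> \<psi> by (auto simp: T_def tw)
      qed
      ultimately show "\<exists>T. openin (weak_star X) T \<and> \<phi> \<in> T \<and> T \<subseteq> U" by blast
    qed
  next
    assume U: "openin (weak_star X) U"
    have "continuous_map M.mtopology euclidean (\<lambda>\<phi>. \<phi> x)" if x: "x \<in> X" for x
      unfolding continuous_map_def
    proof (intro conjI allI impI)
      fix V :: "complex set" assume V: "openin euclidean V"
      show "openin M.mtopology {\<phi> \<in> topspace M.mtopology. \<phi> x \<in> V}"
        unfolding M.openin_mtopology
      proof (intro conjI allI impI)
        fix \<phi> assume "\<phi> \<in> {\<phi> \<in> topspace M.mtopology. \<phi> x \<in> V}"
        then have \<phi>: "\<phi> \<in> states X" "\<phi> x \<in> V" by auto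
        then obtain e where e: "e > 0" "ball (\<phi> x) e \<subseteq> V"
          using V open_contains_ball[of V] by auto
        have pos: "L x + 1 > 0" using slip'(1)[OF x] by simp
        have "M.mball \<phi> (e / (L x + 1)) \<subseteq> {\<phi> \<in> topspace M.mtopology. \<phi> x \<in> V}"
        proof
          fix \<psi> assume "\<psi> \<in> M.mball \<phi> (e / (L x + 1))"
          then have \<psi>: "\<psi> \<in> states X" "?d \<phi> \<psi> < e / (L x + 1)" by auto
          then have "(L x + 1) * ?d \<phi> \<psi> < e" using pos by (simp add: field_simps)
          then have "\<psi> x \<in> ball (\<phi> x) e" using d_ge[OF \<phi>(1) \<psi>(1) x] by (simp add: dist_norm)
          then show "\<psi> \<in> {\<phi> \<in> topspace M.mtopology. \<phi> x \<in> V}" using e \<psi> by auto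
        qed
        then show "\<exists>r>0. M.mball \<phi> r \<subseteq> {\<phi> \<in> topspace M.mtopology. \<phi> x \<in> V}"
          using e pos by (intro exI[of _ "e / (L x + 1)"]) auto
      qed auto
    qed auto
    then have "continuous_map M.mtopology (weak_star X) (\<lambda>\<phi>. \<phi>)"
      unfolding weak_star_def continuous_map_in_subtopology continuous_map_componentwise
      by (auto simp: statesD(5))
    from openin_continuous_map_preimage[OF this U]
    have "openin M.mtopology {\<phi> \<in> states X. \<phi> \<in> U}" by simp
    moreover have "U \<subseteq> states X" using openin_subset[OF U] tw by simp
    ultimately show "openin M.mtopology U" by (simp add: Collect_conj_eq Int_absorb1)
  qed
  then have "M.mtopology = weak_star X" by (simp add: topology_eq)
  then show ?thesis
    unfolding compact_quantum_metric_space_def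
    by (intro conjI ballI os slip fin metric)
qed

section \<open>Unital completely positive maps are contractive\<close>

lemma cscalar_prod_sum: "v \<bullet>c w = (\<Sum>i<dim_vec w. v $ i * cnj (w $ i))" for v w :: "complex vec"
  by (simp add: scalar_prod_def lessThan_atLeast0)

lemma cscalar_self: "v \<bullet>c v = complex_of_real ((vec_l2_norm v)\<^sup>2)" for v :: "complex vec"
proof -
  have "v \<bullet>c v = complex_of_real (\<Sum>i<dim_vec v. (cmod (v $ i))\<^sup>2)"
    unfolding cscalar_prod_sum of_real_sum by (simp only: complex_norm_square)
  then show ?thesis by (simp add: vec_l2_norm_def sum_nonneg)
qed

lemma smult_mat_mult_vec:
  "A \<in> carrier_mat n n \<Longrightarrow> w \<in> carrier_vec n \<Longrightarrow> (c \<cdot>\<^sub>m A) *\<^sub>v w = c \<cdot>\<^sub>v (A *\<^sub>v w)"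
  by (rule eq_vecI) (auto simp: scalar_prod_def sum_distrib_left mult.assoc)

lemma UCPD:
  assumes "\<phi> \<in> UCP n X"
  shows "\<And>x. x \<in> X \<Longrightarrow> \<phi> x \<in> carrier_mat n n"
    "\<And>x y. x \<in> X \<Longrightarrow> y \<in> X \<Longrightarrow> \<phi> (x + y) = \<phi> x + \<phi> y"
    "\<And>c x. x \<in> X \<Longrightarrow> \<phi> (scaleC_op c x) = c \<cdot>\<^sub>m \<phi> x" "\<phi> id_blinfun = 1\<^sub>m n"
    "\<And>m x. (\<And>i j. i < m \<Longrightarrow> j < m \<Longrightarrow> x i j \<in> X) \<Longrightarrow> positive_op_mat m x \<Longrightarrow>
      positive_block_mat n m (\<lambda>i j. \<phi> (x i j))"
  using assms by (auto simp: UCP_def)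

lemma UCP_diff:
  assumes "operator_system X" "\<phi> \<in> UCP n X" "x \<in> X" "y \<in> X"
  shows "\<phi> (x - y) = \<phi> x - \<phi> y"
proof -
  have X: "x - y \<in> X" using operator_system_closed(6)[OF assms(1,3,4)] .
  have "\<phi> x = \<phi> (x - y) + \<phi> y"
    using UCPD(2)[OF assms(2) X assms(4)] by simp
  moreover have "\<phi> (x - y) \<in> carrier_mat n n" "\<phi> y \<in> carrier_mat n n"
    using UCPD(1)[OF assms(2)] X assms(4) by blast+
  ultimately show ?thesis by (intro eq_matI) auto
qed

text \<open>
  The matrix with rows \<open>(\<parallel>x\<parallel>, x)\<close> and \<open>(x\<^sup>*, \<parallel>x\<parallel>)\<close> is positive; this is Cauchy-Schwarz together with
  \<open>2 a b \<le> a\<^sup>2 + b\<^sup>2\<close>.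
\<close>

lemma positive_norm_block:
  assumes x: "x \<in> bops"
  shows "positive_op_mat 2 (\<lambda>i j. if i = j then scaleC_op (complex_of_real (norm x)) id_blinfun
    else if i = 0 then x else adj x)"
  unfolding positive_op_mat_def
proof
  fix \<xi> :: "nat \<Rightarrow> 'a ell2"
  define z where "z = cinner (\<xi> 0) (x (\<xi> 1))"
  have "cinner (\<xi> 1) (adj x (\<xi> 0)) = cnj z"
    using x cinner_commute[of "x (\<xi> 1)" "\<xi> 0"] by (simp add: z_def cinner_adj_right)
  then have eq: "(\<Sum>i<2. \<Sum>j<2. cinner (\<xi> i) ((if i = j then scaleC_op (complex_of_real (norm x)) id_blinfun
      else if i = 0 then x else adj x) (\<xi> j)))
    = complex_of_real (norm x * ((norm (\<xi> 0))\<^sup>2 + (norm (\<xi> 1))\<^sup>2)) + (z + cnj z)"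
    by (simp add: numeral_2_eq_2 scaleC_op_apply cinner_scaleC_right cinner_self_norm algebra_simps
        z_def)
  have "cmod z \<le> norm (\<xi> 0) * (norm x * norm (\<xi> 1))"
    unfolding z_def by (rule order_trans[OF cinner_Cauchy_Schwarz]) (simp add: mult_left_mono norm_blinfun)
  also have "2 * \<dots> \<le> norm x * ((norm (\<xi> 0))\<^sup>2 + (norm (\<xi> 1))\<^sup>2)"
    using mult_left_mono[OF sum_squares_bound[of "norm (\<xi> 0)" "norm (\<xi> 1)"], of "norm x"]
    by (simp add: algebra_simps)
  finally have "2 * cmod z \<le> norm x * ((norm (\<xi> 0))\<^sup>2 + (norm (\<xi> 1))\<^sup>2)" by simp
  then have "cmod (z + cnj z) \<le> norm x * ((norm (\<xi> 0))\<^sup>2 + (norm (\<xi> 1))\<^sup>2)"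
    using norm_triangle_ineq[of z "cnj z"] by simp
  moreover have "z + cnj z \<in> \<real>" by (simp add: Reals_cnj_iff add.commute)
  ultimately show "(\<Sum>i<2. \<Sum>j<2. cinner (\<xi> i) ((if i = j then scaleC_op (complex_of_real (norm x)) id_blinfun
      else if i = 0 then x else adj x) (\<xi> j))) \<in> \<real>\<^sub>\<ge>\<^sub>0"
    unfolding eq by (rule nonneg_Reals_of_norm_le(1)[rotated])
qed

text \<open>
  Applying the map to the entries of the positive matrix of \<open>positive_norm_block\<close> gives a positive
  matrix with the scalar \<open>\<parallel>x\<parallel>\<close> on the diagonal, which forces the off-diagonal entry to have norm at most
  \<open>\<parallel>x\<parallel>\<close>. Hence a \<open>2\<close>-positive unital map is contractive on all elements, with constant one, also on
  elements that are not self-adjoint.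
\<close>

lemma UCP_contractive:
  assumes os: "operator_system X" and \<phi>: "\<phi> \<in> UCP n X" and x: "x \<in> X"
  shows "mat_op_norm (\<phi> x) \<le> norm x"
proof -
  note os' = operator_system_closed[OF os]
  have xb: "x \<in> bops" using x os'(1) by blast
  define c where "c = norm x"
  define A where "A = \<phi> x"
  define B where "B = \<phi> (adj x)"
  have AB: "A \<in> carrier_mat n n" "B \<in> carrier_mat n n"
    using UCPD(1)[OF \<phi>] os'(3) x by (auto simp: A_def B_def)
  have pos: "complex_of_real (c * ((vec_l2_norm u)\<^sup>2 + (vec_l2_norm v)\<^sup>2)) +
      ((A *\<^sub>v v) \<bullet>c u + (B *\<^sub>v u) \<bullet>c v) \<in> \<real>\<^sub>\<ge>\<^sub>0"
    if uv: "u \<in> carrier_vec n" "v \<in> carrier_vec n" for u v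
  proof -
    let ?x = "\<lambda>i j. if i = j then scaleC_op (complex_of_real (norm x)) id_blinfun
        else if i = (0::nat) then x else adj x"
    have ident: "\<phi> (scaleC_op (complex_of_real c) id_blinfun) *\<^sub>v w = complex_of_real c \<cdot>\<^sub>v w"
      if "w \<in> carrier_vec n" for w
      using that by (simp add: UCPD(3)[OF \<phi> os'(4)] UCPD(4)[OF \<phi>] smult_mat_mult_vec[of _ n])
    have block: "positive_block_mat n 2 (\<lambda>i j. \<phi> (?x i j))"
      using os'(3,4,7) x by (intro UCPD(5)[OF \<phi>] positive_norm_block xb) auto
    have "(\<Sum>i<2. \<Sum>j<2. (\<phi> (?x i j) *\<^sub>v (if j = 0 then u else v)) \<bullet>c (if i = 0 then u else v)) \<in> \<real>\<^sub>\<ge>\<^sub>0"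
      by (rule block[unfolded positive_block_mat_def, rule_format, of "\<lambda>i. if i = 0 then u else v"])
        (use uv in auto)
    also have "(\<Sum>i<2. \<Sum>j<2. (\<phi> (?x i j) *\<^sub>v (if j = 0 then u else v)) \<bullet>c (if i = 0 then u else v))
        = (\<phi> (scaleC_op (complex_of_real c) id_blinfun) *\<^sub>v u) \<bullet>c u + (A *\<^sub>v v) \<bullet>c u
          + ((B *\<^sub>v u) \<bullet>c v + (\<phi> (scaleC_op (complex_of_real c) id_blinfun) *\<^sub>v v) \<bullet>c v)"
      by (simp add: numeral_2_eq_2 A_def B_def c_def)
    also have "\<dots> = complex_of_real (c * ((vec_l2_norm u)\<^sup>2 + (vec_l2_norm v)\<^sup>2)) +
      ((A *\<^sub>v v) \<bullet>c u + (B *\<^sub>v u) \<bullet>c v)"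
      using uv by (simp add: ident cscalar_self algebra_simps)
    finally show ?thesis .
  qed
  \<comment> \<open>\<open>B\<close> is the adjoint of \<open>A\<close>; this follows from the reality of the form at \<open>u\<close> and at \<open>\<i> u\<close>\<close>
  have real: "Re ((B *\<^sub>v u) \<bullet>c v) = Re ((A *\<^sub>v v) \<bullet>c u)"
    if uv: "u \<in> carrier_vec n" "v \<in> carrier_vec n" for u v
  proof -
    have iu: "\<i> \<cdot>\<^sub>v u \<in> carrier_vec n" using uv by simp
    have "(A *\<^sub>v v) \<bullet>c (\<i> \<cdot>\<^sub>v u) = - \<i> * ((A *\<^sub>v v) \<bullet>c u)"
      using uv AB by (simp add: conjugate_smult_vec)
    moreover have "(B *\<^sub>v (\<i> \<cdot>\<^sub>v u)) \<bullet>c v = \<i> * ((B *\<^sub>v u) \<bullet>c v)"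
      using uv AB by (simp add: mult_mat_vec)
    ultimately show ?thesis
      using pos[OF iu uv(2)] by (simp add: complex_nonneg_Reals_iff)
  qed
  have bound: "- (2 * Re ((A *\<^sub>v v) \<bullet>c u)) \<le> c * ((vec_l2_norm u)\<^sup>2 + (vec_l2_norm v)\<^sup>2)"
    if uv: "u \<in> carrier_vec n" "v \<in> carrier_vec n" for u v
    using pos[OF uv] real[OF uv] by (simp add: complex_nonneg_Reals_iff)
  have "vec_l2_norm (A *\<^sub>v v) \<le> c" if v: "v \<in> carrier_vec n" "vec_l2_norm v \<le> 1" for v
  proof (cases "vec_l2_norm (A *\<^sub>v v) = 0")
    case False
    define w where "w = A *\<^sub>v v"
    have w: "w \<in> carrier_vec n" using AB v by (simp add: w_def)
    have nn: "vec_l2_norm u \<ge> 0" for u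
    proof -
      have "0 \<le> Re (u \<bullet>c u)" unfolding cscalar_self by simp
      then show ?thesis by (simp add: vec_l2_norm_def)
    qed
    have pw: "vec_l2_norm w > 0" using False nn[of w] by (simp add: w_def)
    \<comment> \<open>\<open>s w\<close> is the unit vector pointing opposite to \<open>A v\<close>\<close>
    define s where "s = complex_of_real (- inverse (vec_l2_norm w))"
    have sw: "s \<cdot>\<^sub>v w \<in> carrier_vec n" using w by simp
    have "complex_of_real ((vec_l2_norm (s \<cdot>\<^sub>v w))\<^sup>2) = s * (cnj s * (w \<bullet>c w))"
      unfolding cscalar_self[symmetric] using w by (simp add: conjugate_smult_vec)
    also have "\<dots> = complex_of_real 1"
      unfolding cscalar_self using pw by (simp add: s_def field_simps power2_eq_square)
    finally have n1: "(vec_l2_norm (s \<cdot>\<^sub>v w))\<^sup>2 = 1" by (simp only: of_real_eq_iff)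
    have "w \<bullet>c (s \<cdot>\<^sub>v w) = cnj s * (w \<bullet>c w)" using w by (simp add: conjugate_smult_vec)
    also have "\<dots> = complex_of_real (- vec_l2_norm w)"
      unfolding cscalar_self using pw by (simp add: s_def field_simps power2_eq_square)
    finally have "Re (w \<bullet>c (s \<cdot>\<^sub>v w)) = - vec_l2_norm w" by simp
    then have "2 * vec_l2_norm w \<le> c * (1 + (vec_l2_norm v)\<^sup>2)"
      using bound[OF sw v(1)] n1 by (simp add: w_def)
    also have "\<dots> \<le> c * (1 + 1)"
      using v(2) nn[of v] by (intro mult_left_mono add_left_mono) (auto simp: c_def power_le_one)
    finally show ?thesis by (simp add: w_def)
  qed (simp add: c_def)
  moreover have "(0\<^sub>v n :: complex vec) \<in> {v \<in> carrier_vec n. vec_l2_norm v \<le> 1}"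
    by (simp add: vec_l2_norm_def)
  ultimately show ?thesis
    unfolding mat_op_norm_def A_def[symmetric] c_def[symmetric] carrier_matD(2)[OF AB(1)]
    by (intro cSUP_least) blast+
qed

section \<open>Direct sums of operator systems\<close>

lemma cinner_left_right:
  "cinner z w = cinner (left_ell2 z) (left_ell2 w) + cinner (right_ell2 z) (right_ell2 w)"
proof -
  let ?f = "\<lambda>k. cnj (coord z k) * coord w k"
  have s: "?f summable_on A" for A
    using inner_summable[of z w] summable_on_subset_banach by blast
  have "cinner z w = infsum ?f (range Inl) + infsum ?f (range Inr)"
    unfolding cinner_def UNIV_sum using s by (intro infsum_Un_disjoint) auto
  then show ?thesis by (simp add: cinner_def infsum_reindex o_def)
qed

lemma dsum_op_simps [simp]:
  "dsum_op S T + dsum_op S' T' = dsum_op (S + S') (T + T')"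
  "dsum_op S T - dsum_op S' T' = dsum_op (S - S') (T - T')"
  "scaleC_op c (dsum_op S T) = dsum_op (scaleC_op c S) (scaleC_op c T)"
proof -
  have minus: "pair_ell2 (a - b) (a' - b') = pair_ell2 a a' - pair_ell2 b b'"
    for a b :: "'x ell2" and a' b' :: "'y ell2"
    using pair_add[of "a - b" b "a' - b'" b'] by simp
  show "dsum_op S T + dsum_op S' T' = dsum_op (S + S') (T + T')"
    "dsum_op S T - dsum_op S' T' = dsum_op (S - S') (T - T')"
    "scaleC_op c (dsum_op S T) = dsum_op (scaleC_op c S) (scaleC_op c T)"
    by (auto intro!: blinfun_eqI simp: dsum_op_apply blinfun.add_left blinfun.diff_left pair_add
        minus scaleC_op_apply pair_scaleC)
qed

lemma dsum_op_id: "dsum_op id_blinfun id_blinfun = id_blinfun"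
  by (rule blinfun_eqI) (simp add: dsum_op_apply)

lemma dsum_op_bops:
  assumes "S \<in> bops" "T \<in> bops"
  shows "dsum_op S T \<in> bops"
proof -
  have "left_ell2 (c *\<^sub>C z) = c *\<^sub>C left_ell2 z" "right_ell2 (c *\<^sub>C z) = c *\<^sub>C right_ell2 z"
    for c and z :: "('a + 'b) ell2"
    by (auto intro: ell2_eqI)
  then show ?thesis using assms by (simp add: bops_def dsum_op_apply pair_scaleC)
qed

lemma adj_dsum_op:
  assumes "S \<in> bops" "T \<in> bops"
  shows "adj (dsum_op S T) = dsum_op (adj S) (adj T)"
  by (rule adj_eqI) (simp add: cinner_left_right dsum_op_apply cinner_adj assms)

lemma norm_dsum_op_le:
  fixes S :: "'i ell2 \<Rightarrow>\<^sub>L 'i ell2" and T :: "'j ell2 \<Rightarrow>\<^sub>L 'j ell2"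
  shows "norm (dsum_op S T) \<le> norm S + norm T"
proof (rule norm_blinfun_bound)
  fix z :: "('i + 'j) ell2"
  have "norm (left_ell2 z) \<le> norm z" "norm (right_ell2 z) \<le> norm z"
    by (rule power2_le_imp_le; simp add: norm_left_right[of z])+
  then have "norm S * norm (left_ell2 z) + norm T * norm (right_ell2 z) \<le> (norm S + norm T) * norm z"
    by (simp add: distrib_right add_mono mult_left_mono)
  then show "norm (dsum_op S T z) \<le> (norm S + norm T) * norm z"
    unfolding dsum_op_apply
    using norm_pair_le[of "S (left_ell2 z)" "T (right_ell2 z)"] norm_blinfun[of S "left_ell2 z"]
      norm_blinfun[of T "right_ell2 z"] by linarith
qed simp

lemma dsum_cases:
  assumes "z \<in> dsum X Y"
  obtains x y where "z = dsum_op x y" "x \<in> X" "y \<in> Y"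
  using assms by (auto simp: dsum_def)

lemma dsum_opI: "x \<in> X \<Longrightarrow> y \<in> Y \<Longrightarrow> dsum_op x y \<in> dsum X Y"
  by (auto simp: dsum_def)

lemma operator_system_dsum:
  assumes X: "operator_system X" and Y: "operator_system Y"
  shows "operator_system (dsum X Y)"
proof -
  note X' = operator_system_closed[OF X] and Y' = operator_system_closed[OF Y]
  have sub: "dsum X Y \<subseteq> bops"
    using X'(1) Y'(1) by (auto simp: dsum_def intro!: dsum_op_bops)
  have zero: "0 = dsum_op (0 :: 'a ell2 \<Rightarrow>\<^sub>L 'a ell2) (0 :: 'b ell2 \<Rightarrow>\<^sub>L 'b ell2)"
    using dsum_op_simps(2)[of 0 0 0 0] by simp
  have "cop.subspace (dsum X Y)"
  proof (rule cop.subspaceI)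
    show "0 \<in> dsum X Y" unfolding zero by (rule dsum_opI[OF X'(8) Y'(8)])
    show "z + w \<in> dsum X Y" if "z \<in> dsum X Y" "w \<in> dsum X Y" for z w
      using that by (auto elim!: dsum_cases intro!: dsum_opI X'(5) Y'(5))
    show "scaleC_op c z \<in> dsum X Y" if "z \<in> dsum X Y" for z c
      using that by (auto elim!: dsum_cases intro!: dsum_opI X'(7) Y'(7))
  qed
  moreover have "adj z \<in> dsum X Y" if z: "z \<in> dsum X Y" for z
  proof -
    obtain x y where "z = dsum_op x y" "x \<in> X" "y \<in> Y" using z by (rule dsum_cases)
    then show ?thesis using X'(9) Y'(9) by (simp add: adj_dsum_op dsum_opI X'(3) Y'(3))
  qed
  moreover have "id_blinfun \<in> dsum X Y"
    unfolding dsum_op_id[symmetric] by (rule dsum_opI[OF X'(4) Y'(4)])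
  ultimately show ?thesis using sub by (simp add: operator_system_def)
qed

section \<open>Slip-norms\<close>

lemma slip_norm_max:
  assumes "slip_norm X L" "slip_norm X L'"
  shows "slip_norm X (\<lambda>x. max (L x) (L' x))"
  unfolding slip_norm_def
proof (intro conjI ballI allI)
  fix x y c assume xy: "x \<in> X" "y \<in> X"
  show "max (L (x + y)) (L' (x + y)) \<le> max (L x) (L' x) + max (L y) (L' y)"
    using slip_normD(2)[OF assms(1) xy] slip_normD(2)[OF assms(2) xy] by linarith
next
  fix x c assume x: "x \<in> X"
  show "0 \<le> max (L x) (L' x)" using slip_normD(1)[OF assms(1) x] by linarith
  show "max (L (scaleC_op c x)) (L' (scaleC_op c x)) = cmod c * max (L x) (L' x)"
    by (simp add: slip_normD(3)[OF assms(1) x] slip_normD(3)[OF assms(2) x] max_mult_distrib_left)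
  show "max (L (adj x)) (L' (adj x)) = max (L x) (L' x)"
    by (simp add: slip_normD(4)[OF assms(1) x] slip_normD(4)[OF assms(2) x])
qed (simp add: slip_normD(5)[OF assms(1)] slip_normD(5)[OF assms(2)])

lemma slip_norm_divide:
  assumes "slip_norm X L" "0 < \<epsilon>"
  shows "slip_norm X (\<lambda>x. L x / \<epsilon>)"
  using assms by (auto simp: slip_norm_def divide_right_mono simp flip: add_divide_distrib)

lemma slip_norm_norm:
  assumes "\<And>x y. x \<in> X \<Longrightarrow> y \<in> X \<Longrightarrow> F (x + y) = F x + F y"
    and "\<And>c x. x \<in> X \<Longrightarrow> F (scaleC_op c x) = scaleC_op c (F x)"
    and "\<And>x. x \<in> X \<Longrightarrow> F (adj x) = adj (F x)" and "\<And>x. x \<in> X \<Longrightarrow> F x \<in> bops"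
    and "F id_blinfun = 0"
  shows "slip_norm X (\<lambda>x. norm (F x))"
  using assms by (auto simp: slip_norm_def norm_triangle_ineq)

lemma slip_norm_corner:
  fixes X :: "('i ell2 \<Rightarrow>\<^sub>L 'i ell2) set" and Y :: "('j ell2 \<Rightarrow>\<^sub>L 'j ell2) set"
  assumes X: "operator_system X" "slip_norm X LX" and Y: "operator_system Y" "slip_norm Y LY"
  shows "slip_norm (dsum X Y) (\<lambda>z. LX (left_corner z))"
    and "slip_norm (dsum X Y) (\<lambda>z. LY (right_corner z))"
proof -
  note X' = operator_system_closed[OF X(1)] and Y' = operator_system_closed[OF Y(1)]
  have "left_corner (id_blinfun :: ('i + 'j) ell2 \<Rightarrow>\<^sub>L ('i + 'j) ell2) = id_blinfun"
    "right_corner (id_blinfun :: ('i + 'j) ell2 \<Rightarrow>\<^sub>L ('i + 'j) ell2) = id_blinfun"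
    by (simp_all flip: dsum_op_id)
  then show "slip_norm (dsum X Y) (\<lambda>z. LX (left_corner z))"
    and "slip_norm (dsum X Y) (\<lambda>z. LY (right_corner z))"
    using X'(9) Y'(9) slip_normD[OF X(2)] slip_normD[OF Y(2)]
    by (auto simp: slip_norm_def adj_dsum_op elim!: dsum_cases)
qed

section \<open>Comparing an operator system with a subsystem\<close>

lemma norm_scalar_op: "norm (scaleC_op c (id_blinfun :: 'i ell2 \<Rightarrow>\<^sub>L 'i ell2)) = cmod c"
proof (rule antisym)
  show "norm (scaleC_op c (id_blinfun :: 'i ell2 \<Rightarrow>\<^sub>L 'i ell2)) \<le> cmod c"
    using mult_left_mono[OF norm_blinfun_id_le, of "cmod c"] by simp
  show "cmod c \<le> norm (scaleC_op c (id_blinfun :: 'i ell2 \<Rightarrow>\<^sub>L 'i ell2))"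
    using norm_mat_entry_le[of "scaleC_op c id_blinfun" "undefined :: 'i" undefined] by simp
qed

text \<open>
  The nets of scalars used both for direct sums and for trigonometric polynomials.
\<close>

lemma finite_disc_net:
  assumes "0 < \<delta>"
  obtains N where "finite N" "\<And>c::complex. cmod c \<le> R \<Longrightarrow> \<exists>d\<in>N. cmod (c - d) \<le> \<delta>"
proof -
  obtain N where N: "finite N" "cball (0::complex) R \<subseteq> (\<Union>x\<in>N. ball x \<delta>)"
    using assms compact_cball[of "0::complex" R] unfolding compact_eq_totally_bounded by blast
  show thesis
  proof (rule that[OF N(1)])
    fix c :: complex assume "cmod c \<le> R"
    then obtain d where "d \<in> N" "c \<in> ball d \<delta>" using N(2) by fastforce
    then show "\<exists>d\<in>N. cmod (c - d) \<le> \<delta>"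
      by (intro bexI[of _ d]) (simp_all add: dist_norm norm_minus_commute)
  qed
qed

text \<open>
  Nets for \<open>X\<close> and \<open>Y\<close> approximate the two summands modulo two separate scalars \<open>c\<close> and \<open>c'\<close>, while in
  the direct sum only a common scalar may be divided out. The term \<open>\<parallel>x - y\<parallel>\<close> under the control of \<open>L\<close>
  bounds \<open>c' - c\<close>, so that a finite net for a disc of scalars takes care of the difference.
\<close>

lemma totally_bounded_mod_scalars_dsum:
  assumes X: "operator_system X" "totally_bounded_mod_scalars X LX"
    and Y: "operator_system Y" "totally_bounded_mod_scalars Y LY"
    and L: "\<And>x y. x \<in> X \<Longrightarrow> y \<in> Y \<Longrightarrow> L (dsum_op x y) \<le> 1 \<Longrightarrow>
      LX x \<le> 1 \<and> LY y \<le> 1 \<and> norm (x - y) \<le> \<epsilon>"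
  shows "totally_bounded_mod_scalars (dsum X Y) L"
  unfolding totally_bounded_mod_scalars_def
proof (intro allI impI)
  fix \<delta> :: real assume "\<delta> > 0"
  then have \<delta>3: "\<delta>/3 > 0" by simp
  obtain F where F: "finite F" "F \<subseteq> X"
    "\<And>x. x \<in> X \<Longrightarrow> LX x \<le> 1 \<Longrightarrow> \<exists>f\<in>F. \<exists>c. norm (x - scaleC_op c id_blinfun - f) \<le> \<delta>/3"
    using X(2) \<delta>3 unfolding totally_bounded_mod_scalars_def by metis
  obtain G where G: "finite G" "G \<subseteq> Y"
    "\<And>y. y \<in> Y \<Longrightarrow> LY y \<le> 1 \<Longrightarrow> \<exists>g\<in>G. \<exists>c. norm (y - scaleC_op c id_blinfun - g) \<le> \<delta>/3"
    using Y(2) \<delta>3 unfolding totally_bounded_mod_scalars_def by metis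
  define R where "R = \<epsilon> + 2 * (\<delta>/3) + (\<Sum>f\<in>F. norm f) + (\<Sum>g\<in>G. norm g)"
  obtain N where N: "finite N" "\<And>c::complex. cmod c \<le> R \<Longrightarrow> \<exists>d\<in>N. cmod (c - d) \<le> \<delta>/3"
    using finite_disc_net[OF \<delta>3] by blast
  define H where "H = (\<lambda>(f, g, d). dsum_op f (g + scaleC_op d id_blinfun)) ` (F \<times> G \<times> N)"
  show "\<exists>H. finite H \<and> H \<subseteq> dsum X Y \<and> (\<forall>z\<in>dsum X Y. L z \<le> 1 \<longrightarrow>
      (\<exists>h\<in>H. \<exists>c. norm (z - scaleC_op c id_blinfun - h) \<le> \<delta>))"
  proof (intro exI[of _ H] conjI ballI impI)
    show "finite H" using F(1) G(1) N(1) by (simp add: H_def)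
    show "H \<subseteq> dsum X Y"
      using F(2) G(2)
      by (auto simp: H_def intro!: dsum_opI operator_system_closed(4,5,7)[OF Y(1)])
    fix z assume "z \<in> dsum X Y" "L z \<le> 1"
    then obtain x y where z: "z = dsum_op x y" "x \<in> X" "y \<in> Y"
      and xy: "LX x \<le> 1" "LY y \<le> 1" "norm (x - y) \<le> \<epsilon>"
      using L by (metis dsum_cases)
    obtain f c where f: "f \<in> F" "norm (x - scaleC_op c id_blinfun - f) \<le> \<delta>/3"
      using F(3)[OF z(2) xy(1)] by blast
    obtain g c' where g: "g \<in> G" "norm (y - scaleC_op c' id_blinfun - g) \<le> \<delta>/3"
      using G(3)[OF z(3) xy(2)] by blast
    define r where "r = x - scaleC_op c id_blinfun - f"
    define s where "s = y - scaleC_op c' id_blinfun - g"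
    have "norm f \<le> (\<Sum>f\<in>F. norm f)" "norm g \<le> (\<Sum>g\<in>G. norm g)"
      using f(1) g(1) F(1) G(1) by (auto intro!: member_le_sum)
    moreover have "scaleC_op (c' - c) id_blinfun = (((y - x) + f) - g) + (r - s)"
      unfolding cop.scale_left_diff_distrib by (simp add: r_def s_def)
    then have "cmod (c' - c) = norm ((((y - x) + f) - g) + (r - s))"
      using norm_scalar_op[of "c' - c"] by metis
    moreover have "norm ((((y - x) + f) - g) + (r - s)) \<le> norm (x - y) + norm f + norm g + (norm r + norm s)"
      using norm_triangle_ineq[of "((y - x) + f) - g" "r - s"] norm_triangle_ineq4[of "(y - x) + f" g]
        norm_triangle_ineq[of "y - x" f] norm_triangle_ineq4[of r s] norm_minus_commute[of x y]
      by linarith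
    ultimately have "cmod (c' - c) \<le> R"
      using xy(3) f(2) g(2) unfolding R_def r_def s_def by linarith
    then obtain d where d: "d \<in> N" "cmod (c' - c - d) \<le> \<delta>/3" using N(2) by blast
    have "z - scaleC_op c id_blinfun - dsum_op f (g + scaleC_op d id_blinfun)
        = dsum_op r (s + scaleC_op (c' - c - d) id_blinfun)"
      unfolding z dsum_op_id[symmetric] dsum_op_simps cop.scale_left_diff_distrib
      by (simp add: r_def s_def algebra_simps)
    then have "norm (z - scaleC_op c id_blinfun - dsum_op f (g + scaleC_op d id_blinfun))
        \<le> norm r + norm (s + scaleC_op (c' - c - d) id_blinfun)"
      by (simp only: norm_dsum_op_le)
    also have "\<dots> \<le> norm r + (norm s + cmod (c' - c - d))"
      using norm_triangle_ineq[of s "scaleC_op (c' - c - d) id_blinfun"]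
      by (simp only: norm_scalar_op add_le_cancel_left)
    also have "\<dots> \<le> \<delta>"
      using f(2) g(2) d(2) unfolding r_def s_def by linarith
    finally show "\<exists>h\<in>H. \<exists>c. norm (z - scaleC_op c id_blinfun - h) \<le> \<delta>"
      using f(1) g(1) d(1) unfolding H_def by force
  qed
qed

text \<open>
  Let \<open>\<Phi>\<close> be a unital completely positive map from \<open>X\<close> to the subsystem \<open>Y\<close> which does not increase \<open>L\<close>
  and moves elements by at most \<open>\<epsilon> L\<close>. The seminorm
  \<open>B(x, y) = max (L x, L y, \<parallel>x - y\<parallel>/\<epsilon>, \<parallel>\<Phi> x - y\<parallel>/\<epsilon>)\<close>
  is admissible: \<open>y = \<Phi> x\<close> attains the quotient seminorm at \<open>x\<close>, and \<open>x = y\<close> attains it at \<open>y\<close>. The third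
  entry makes a map on \<open>X\<close> and its restriction to \<open>Y\<close> \<open>\<epsilon>\<close>-close; the fourth does the same for a map \<open>\<psi>\<close>
  on \<open>Y\<close> and \<open>\<psi> \<circ> \<Phi>\<close>, which takes the place of an extension of \<open>\<psi>\<close> to \<open>X\<close>. From the third entry alone,
  \<open>\<psi>\<close> and \<open>\<psi> \<circ> \<Phi>\<close> would only be \<open>2 \<epsilon>\<close>-close.
\<close>

theorem dist_s_le_of_approximation:
  fixes X Y :: "('i ell2 \<Rightarrow>\<^sub>L 'i ell2) set"
  assumes X: "operator_system X" and Y: "operator_system Y" "Y \<subseteq> X"
    and slip: "slip_norm X L" and tb: "totally_bounded_mod_scalars X L" and "0 < \<epsilon>"
    and \<Phi>: "\<And>x. x \<in> X \<Longrightarrow> \<Phi> x \<in> Y"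
    and add: "\<And>x y. x \<in> X \<Longrightarrow> y \<in> X \<Longrightarrow> \<Phi> (x + y) = \<Phi> x + \<Phi> y"
    and scale: "\<And>c x. x \<in> X \<Longrightarrow> \<Phi> (scaleC_op c x) = scaleC_op c (\<Phi> x)"
    and star: "\<And>x. x \<in> X \<Longrightarrow> \<Phi> (adj x) = adj (\<Phi> x)"
    and unit: "\<Phi> id_blinfun = id_blinfun"
    and cp: "\<And>m x. (\<And>i j. i < m \<Longrightarrow> j < m \<Longrightarrow> x i j \<in> X) \<Longrightarrow> positive_op_mat m x \<Longrightarrow>
      positive_op_mat m (\<lambda>i j. \<Phi> (x i j))"
    and contr: "\<And>x. x \<in> X \<Longrightarrow> L (\<Phi> x) \<le> L x"
    and approx: "\<And>x. x \<in> X \<Longrightarrow> norm (x - \<Phi> x) \<le> \<epsilon> * L x"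
  shows "dist_s X L Y L \<le> ennreal \<epsilon>"
proof -
  note X' = operator_system_closed[OF X] and Y' = operator_system_closed[OF Y(1)]
  have slipY: "slip_norm Y L" using slip Y(2) by (auto simp: slip_norm_def subset_iff)
  define B :: "(('i + 'i) ell2 \<Rightarrow>\<^sub>L ('i + 'i) ell2) \<Rightarrow> real" where
    "B z = max (max (L (left_corner z)) (L (right_corner z)))
      (max (norm (left_corner z - right_corner z) / \<epsilon>) (norm (\<Phi> (left_corner z) - right_corner z) / \<epsilon>))" for z
  have B_le1: "L x \<le> 1 \<and> L y \<le> 1 \<and> norm (x - y) \<le> \<epsilon> \<and> norm (\<Phi> x - y) \<le> \<epsilon>"
    if "B (dsum_op x y) \<le> 1" for x y
    using that \<open>0 < \<epsilon>\<close> by (simp add: B_def)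
  have corner_id: "left_corner (id_blinfun :: ('i + 'i) ell2 \<Rightarrow>\<^sub>L ('i + 'i) ell2) = id_blinfun"
    "right_corner (id_blinfun :: ('i + 'i) ell2 \<Rightarrow>\<^sub>L ('i + 'i) ell2) = id_blinfun"
    by (simp_all flip: dsum_op_id)
  have slip1: "slip_norm (dsum X Y) (\<lambda>z. norm (left_corner z - right_corner z))"
  proof (rule slip_norm_norm)
    show "left_corner (adj z) - right_corner (adj z) = adj (left_corner z - right_corner z)"
      "left_corner z - right_corner z \<in> bops" if "z \<in> dsum X Y" for z
      using that X'(9) Y'(9) by (auto elim!: dsum_cases simp: adj_dsum_op adj_diff bops_intros)
  qed (auto elim!: dsum_cases simp: cop.scale_right_diff_distrib corner_id)
  have \<Phi>b: "\<Phi> x \<in> bops" if "x \<in> X" for x using \<Phi>[OF that] Y'(9) by blast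
  have slip2: "slip_norm (dsum X Y) (\<lambda>z. norm (\<Phi> (left_corner z) - right_corner z))"
  proof (rule slip_norm_norm)
    show "\<Phi> (left_corner (adj z)) - right_corner (adj z) = adj (\<Phi> (left_corner z) - right_corner z)"
      "\<Phi> (left_corner z) - right_corner z \<in> bops" if "z \<in> dsum X Y" for z
      using that X'(9) Y'(9) \<Phi>b
      by (auto elim!: dsum_cases simp: adj_dsum_op adj_diff bops_intros star)
  qed (auto elim!: dsum_cases simp: cop.scale_right_diff_distrib corner_id add scale unit)
  have slipB: "slip_norm (dsum X Y) B"
    unfolding B_def[abs_def]
    by (intro slip_norm_max slip_norm_divide slip_norm_corner[OF X slip Y(1) slipY] slip1 slip2 \<open>0 < \<epsilon>\<close>)
  have tbB: "totally_bounded_mod_scalars (dsum X Y) B"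
    by (rule totally_bounded_mod_scalars_dsum[OF X tb Y(1) totally_bounded_mod_scalars_subset[OF tb Y(2)]])
      (use B_le1 in blast)
  have cqms: "compact_quantum_metric_space (dsum X Y) B"
    by (rule compact_quantum_metric_spaceI[OF operator_system_dsum[OF X Y(1)] slipB tbB])
  have Bx: "B (dsum_op x (\<Phi> x)) = L x" if "x \<in> X" for x
    using contr[OF that] approx[OF that] slip_normD(1)[OF slip that] \<open>0 < \<epsilon>\<close>
    by (simp add: B_def field_simps)
  have By: "B (dsum_op y y) = L y" if "y \<in> Y" for y
    using approx[of y] slip_normD(1)[OF slipY that] \<open>0 < \<epsilon>\<close> Y(2) that
    by (auto simp: B_def field_simps norm_minus_commute)
  have "L x = (INF y\<in>Y. B (dsum_op x y))" if "x \<in> X" for x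
    by (rule cInf_eq_minimum[symmetric])
      (use Bx[OF that] \<Phi>[OF that] in \<open>force simp: B_def\<close>)+
  moreover have "L y = (INF x\<in>X. B (dsum_op x y))" if "y \<in> Y" for y
    by (rule cInf_eq_minimum[symmetric])
      (use By[OF that] Y(2) that in \<open>force simp: B_def\<close>)+
  ultimately have adm: "admissible X L Y L B"
    using cqms by (simp add: admissible_def)
  have left_close: "\<exists>b\<in>UCP_right n X Y. UCP_dist (dsum X Y) B a b \<le> ennreal \<epsilon>"
    if a: "a \<in> UCP_left n X Y" for a n
  proof -
    obtain \<phi> where \<phi>: "\<phi> \<in> UCP n X" and a: "a = (\<lambda>z\<in>dsum X Y. \<phi> (left_corner z))"
      using a by (auto simp: UCP_left_def)
    have \<psi>: "restrict \<phi> Y \<in> UCP n Y"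
      unfolding UCP_def
    proof (intro CollectI conjI ballI allI impI)
      fix m x assume x: "(\<forall>i<m. \<forall>j<m. x i j \<in> Y) \<and> positive_op_mat m x"
      then have "positive_block_mat n m (\<lambda>i j. \<phi> (x i j))"
        using Y(2) by (intro UCPD(5)[OF \<phi>]) auto
      then show "positive_block_mat n m (\<lambda>i j. restrict \<phi> Y (x i j))"
        using x by (simp add: positive_block_mat_def)
    qed (use UCPD(1-4)[OF \<phi>] Y(2) Y'(4,5,7) in \<open>auto simp: subset_iff\<close>)
    define b where "b = (\<lambda>z\<in>dsum X Y. restrict \<phi> Y (right_corner z))"
    have "mat_op_norm (a z - b z) \<le> \<epsilon>" if z: "z \<in> dsum X Y" "B z \<le> 1" for z
    proof -
      obtain x y where xy: "z = dsum_op x y" "x \<in> X" "y \<in> Y" using z(1) by (rule dsum_cases)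
      have "a z - b z = \<phi> (x - y)"
        using xy z(1) Y(2) by (auto simp: a b_def UCP_diff[OF X \<phi>])
      then have "mat_op_norm (a z - b z) \<le> norm (x - y)"
        using UCP_contractive[OF X \<phi>, of "x - y"] X'(6) xy Y(2) by auto
      then show ?thesis using B_le1[of x y] z(2) xy(1) by simp
    qed
    then have "UCP_dist (dsum X Y) B a b \<le> ennreal \<epsilon>"
      unfolding UCP_dist_def by (intro SUP_least ennreal_leI) auto
    moreover have "b \<in> UCP_right n X Y" using \<psi> unfolding UCP_right_def b_def by blast
    ultimately show ?thesis by blast
  qed
  have right_close: "\<exists>a\<in>UCP_left n X Y. UCP_dist (dsum X Y) B a b \<le> ennreal \<epsilon>"
    if b: "b \<in> UCP_right n X Y" for b n
  proof -
    obtain \<psi> where \<psi>: "\<psi> \<in> UCP n Y" and b: "b = (\<lambda>z\<in>dsum X Y. \<psi> (right_corner z))"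
      using b by (auto simp: UCP_right_def)
    have \<phi>: "restrict (\<psi> \<circ> \<Phi>) X \<in> UCP n X"
      unfolding UCP_def
    proof (intro CollectI conjI ballI allI impI)
      fix m x assume x: "(\<forall>i<m. \<forall>j<m. x i j \<in> X) \<and> positive_op_mat m x"
      then have "positive_block_mat n m (\<lambda>i j. \<psi> (\<Phi> (x i j)))"
        using \<Phi> by (intro UCPD(5)[OF \<psi>] cp) auto
      then show "positive_block_mat n m (\<lambda>i j. restrict (\<psi> \<circ> \<Phi>) X (x i j))"
        using x by (simp add: positive_block_mat_def)
    qed (use UCPD[OF \<psi>] \<Phi> X'(4,5,7) in \<open>auto simp: add scale unit\<close>)
    define a where "a = (\<lambda>z\<in>dsum X Y. restrict (\<psi> \<circ> \<Phi>) X (left_corner z))"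
    have "mat_op_norm (a z - b z) \<le> \<epsilon>" if z: "z \<in> dsum X Y" "B z \<le> 1" for z
    proof -
      obtain x y where xy: "z = dsum_op x y" "x \<in> X" "y \<in> Y" using z(1) by (rule dsum_cases)
      have "a z - b z = \<psi> (\<Phi> x - y)"
        using xy z(1) \<Phi> by (auto simp: b a_def UCP_diff[OF Y(1) \<psi>])
      then have "mat_op_norm (a z - b z) \<le> norm (\<Phi> x - y)"
        using UCP_contractive[OF Y(1) \<psi>, of "\<Phi> x - y"] Y'(6) xy \<Phi> by auto
      then show ?thesis using B_le1[of x y] z(2) xy(1) by simp
    qed
    then have "UCP_dist (dsum X Y) B a b \<le> ennreal \<epsilon>"
      unfolding UCP_dist_def by (intro SUP_least ennreal_leI) auto
    moreover have "a \<in> UCP_left n X Y" using \<phi> unfolding UCP_left_def a_def by blast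
    ultimately show ?thesis by blast
  qed
  have "hausdorff_dist (UCP_dist (dsum X Y) B) (UCP_left n X Y) (UCP_right n X Y) \<le> ennreal \<epsilon>" for n
    unfolding hausdorff_dist_def
    by (intro max.boundedI SUP_least)
      (use left_close right_close in \<open>blast intro: INF_lower2\<close>)+
  then have "(SUP n\<in>{1..}. hausdorff_dist (UCP_dist (dsum X Y) B) (UCP_left n X Y) (UCP_right n X Y))
      \<le> ennreal \<epsilon>"
    by (intro SUP_least)
  then show ?thesis
    unfolding dist_s_def using adm by (intro INF_lower2[of B]) auto
qed

section \<open>Laurent operators and their Fourier coefficients\<close>

definition fourier :: "(int ell2 \<Rightarrow>\<^sub>L int ell2) \<Rightarrow> int \<Rightarrow> complex" where
  "fourier T k = mat_entry T k 0"

text \<open>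
  The operators whose matrix is constant along diagonals, that is, the commutant of the bilateral shift
  (\<open>laurent_iff_commute\<close>). On them \<^const>\<open>fourier\<close> gives the Fourier coefficients of the symbol.
\<close>

definition laurent :: "(int ell2 \<Rightarrow>\<^sub>L int ell2) set" where
  "laurent = {T \<in> bops. \<forall>j k. mat_entry T j k = fourier T (j - k)}"

lemma laurentD:
  assumes "T \<in> laurent"
  shows "T \<in> bops" "mat_entry T j k = fourier T (j - k)"
  using assms by (auto simp: laurent_def)

lemma laurent_eqI:
  assumes "S \<in> laurent" "T \<in> laurent" "\<And>k. fourier S k = fourier T k"
  shows "S = T"
  using assms by (intro bops_eqI) (auto simp: laurentD)

lemma fourier_simps [simp]:
  "fourier (S + T) k = fourier S k + fourier T k" "fourier (S - T) k = fourier S k - fourier T k"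
  "fourier (scaleC_op c T) k = c * fourier T k" "fourier 0 k = 0"
  "fourier id_blinfun k = (if k = 0 then 1 else 0)"
  by (simp_all add: fourier_def)

lemma fourier_sum: "fourier (sum f A) k = (\<Sum>a\<in>A. fourier (f a) k)"
  by (simp add: fourier_def mat_entry_sum)

lemma norm_fourier_le: "cmod (fourier T k) \<le> norm T"
  by (simp add: fourier_def norm_mat_entry_le)

lemma mat_entry_shift_pow: "mat_entry (shift_pow n) j k = (if j - k = n then 1 else 0)"
  by (auto simp: mat_entry_coord shift_pow_ket)

lemma fourier_shift_pow [simp]: "fourier (shift_pow n) k = (if k = n then 1 else 0)"
  by (simp add: fourier_def mat_entry_shift_pow)

lemma fourier_adj: "T \<in> laurent \<Longrightarrow> fourier (adj T) k = cnj (fourier T (- k))"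
  using laurentD(2)[of T 0 k] laurentD(1)[of T] by (simp add: fourier_def mat_entry_adj)

lemma adj_shift_pow: "adj (shift_pow n) = shift_pow (- n)"
proof (rule adj_eqI)
  fix x y
  show "cinner (shift_pow (- n) x) y = cinner x (shift_pow n y)"
    unfolding cinner_def shift_pow_apply shift_ell2.rep_eq
    by (rule infsum_reindex_bij_witness[where i = "\<lambda>j. j - n" and j = "\<lambda>j. j + n"]) auto
qed

lemma norm_shift_pow_le: "norm (shift_pow n) \<le> 1"
  by (rule norm_blinfun_bound) (simp_all add: shift_pow_apply norm_shift_ell2)

lemma subspace_laurent: "cop.subspace laurent"
  by (rule cop.subspaceI) (auto simp: laurent_def bops_intros)

lemma shift_pow_laurent: "shift_pow n \<in> laurent"
  by (simp add: laurent_def shift_pow_bops mat_entry_shift_pow)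

lemma laurent_adj:
  assumes T: "T \<in> laurent"
  shows "adj T \<in> laurent"
proof -
  have "mat_entry (adj T) j k = fourier (adj T) (j - k)" for j k
    using laurentD(1)[OF T] laurentD(2)[OF T, of k j]
    by (simp add: fourier_adj[OF T] mat_entry_adj)
  then show ?thesis using laurentD(1)[OF T] by (simp add: laurent_def bops_intros)
qed

lemma laurent_iff_commute: "T \<in> laurent \<longleftrightarrow> T \<in> bops \<and> (\<forall>n. T o\<^sub>L shift_pow n = shift_pow n o\<^sub>L T)"
proof -
  have l: "mat_entry (T o\<^sub>L shift_pow n) j k = mat_entry T j (k + n)"
    and r: "mat_entry (shift_pow n o\<^sub>L T) j k = mat_entry T (j - n) k" for n j k
    by (simp add: mat_entry_coord shift_pow_ket)
      (simp add: mat_entry_coord shift_pow_apply shift_ell2.rep_eq)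
  show ?thesis
  proof (intro iffI conjI allI)
    assume T: "T \<in> laurent"
    then show "T \<in> bops" by (rule laurentD)
    fix n
    show "T o\<^sub>L shift_pow n = shift_pow n o\<^sub>L T"
      using T by (intro bops_eqI bops_compose)
        (auto simp: l r laurentD shift_pow_bops algebra_simps)
  next
    assume T: "T \<in> bops \<and> (\<forall>n. T o\<^sub>L shift_pow n = shift_pow n o\<^sub>L T)"
    have "mat_entry T j k = fourier T (j - k)" for j k
      using l[of k j 0] r[of k j 0] T by (simp add: fourier_def)
    then show "T \<in> laurent" using T by (simp add: laurent_def)
  qed
qed

lemma closed_laurent: "closed laurent"
proof -
  have bl: "bounded_linear (\<lambda>T :: int ell2 \<Rightarrow>\<^sub>L int ell2. T x)" for x
    by (rule blinfun.bounded_linear_left)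
  have c1: "continuous_on UNIV (\<lambda>T :: int ell2 \<Rightarrow>\<^sub>L int ell2. mat_entry T j k)" for j k
    unfolding mat_entry_def
    by (intro linear_continuous_on bounded_linear_compose[OF bounded_linear_cinner_right bl])
  have c2: "continuous_on UNIV (\<lambda>T :: int ell2 \<Rightarrow>\<^sub>L int ell2. c *\<^sub>C T x)" for c x
    by (intro linear_continuous_on
        bounded_linear_compose[OF bounded_linear_scaleC[OF bounded_linear_ident] bl])
  have eq: "laurent = {T :: int ell2 \<Rightarrow>\<^sub>L int ell2. \<forall>c x. T (c *\<^sub>C x) = c *\<^sub>C T x} \<inter> {T. \<forall>j k. mat_entry T j k = mat_entry T (j - k) 0}"
    by (auto simp: laurent_def bops_def fourier_def)
  show ?thesis
    unfolding eq by (intro closed_Int closed_Collect_all closed_Collect_eq c1 c2 linear_continuous_on bl)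
qed

text \<open>
  The Laurent operators form a \<open>C\<^sup>*\<close>-algebra that contains the shift. So the
  elements of \<^const>\<open>C_circle\<close> are determined by their Fourier coefficients.
\<close>

lemma C_circle_subset_laurent: "C_circle \<subseteq> laurent"
proof -
  have assoc: "(A o\<^sub>L B) o\<^sub>L C = A o\<^sub>L (B o\<^sub>L C)" for A B C :: "int ell2 \<Rightarrow>\<^sub>L int ell2"
    by (rule blinfun_eqI) simp
  have "S o\<^sub>L T \<in> laurent" if "S \<in> laurent" "T \<in> laurent" for S T
    unfolding laurent_iff_commute
  proof (intro conjI allI)
    show "S o\<^sub>L T \<in> bops" using that by (intro bops_compose laurentD)
    show "S o\<^sub>L T o\<^sub>L shift_pow n = shift_pow n o\<^sub>L (S o\<^sub>L T)" for n
      using that assoc by (metis laurent_iff_commute)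
  qed
  then have "cstar_subalgebra laurent"
    unfolding cstar_subalgebra_def
    by (auto simp: closed_laurent subspace_laurent laurent_adj laurentD)
  then show ?thesis
    unfolding C_circle_def cstar_generated_def using shift_pow_laurent by blast
qed

lemma cstar_subalgebra_C_circle: "cstar_subalgebra C_circle"
proof -
  have "C_circle \<subseteq> bops" using C_circle_subset_laurent laurentD(1) by blast
  then show ?thesis
    unfolding C_circle_def cstar_generated_def cstar_subalgebra_def[of "\<Inter> _"]
    by (auto simp: cstar_subalgebra_def intro!: cop.subspace_Inter closed_Inter)
qed

lemma shift_pow_C_circle: "shift_pow n \<in> C_circle"
proof -
  have C: "S o\<^sub>L T \<in> C_circle" "adj T \<in> C_circle" if "S \<in> C_circle" "T \<in> C_circle" for S T
    using cstar_subalgebra_C_circle that by (auto simp: cstar_subalgebra_def)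
  have U: "shift_pow 1 \<in> C_circle" by (simp add: C_circle_def cstar_generated_def)
  have U': "shift_pow (- 1) \<in> C_circle" using C(2)[OF U U] by (simp add: adj_shift_pow)
  have pow: "shift_pow (int m) \<in> C_circle \<and> shift_pow (- int m) \<in> C_circle" for m
  proof (induction m)
    case 0
    have "shift_pow (1 + - 1) \<in> C_circle" unfolding shift_pow_add using C(1)[OF U U'] .
    then show ?case by simp
  next
    case (Suc m)
    then show ?case
      using C(1)[OF U, of "shift_pow (int m)"] C(1)[OF U', of "shift_pow (- int m)"]
      by (simp flip: shift_pow_add)
  qed
  show ?thesis
    using pow[of "nat n"] pow[of "nat (- n)"] by (cases "n \<ge> 0") auto
qed

text \<open>
  The partial sums of the Fourier series, applied to a vector, obey the bound and converge coordinatewise,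
  so that \<open>norm_le_of_coord_tendsto\<close> applies.
\<close>

lemma norm_le_of_fourier_sums:
  assumes R: "R \<in> laurent" and "0 \<le> C"
    and bound: "\<And>F. finite F \<Longrightarrow> (\<Sum>k\<in>F. cmod (fourier R k)) \<le> C"
  shows "norm R \<le> C"
proof (rule norm_blinfun_bound)
  fix x
  define S where "S F = (\<Sum>k\<in>F. fourier R k *\<^sub>C shift_ell2 k x)" for F
  have coord_S: "coord (S F) j = (\<Sum>k\<in>F. fourier R k * coord x (j - k))" for F j
    by (simp add: S_def coord_sum shift_ell2.rep_eq)
  show "norm (R x) \<le> C * norm x"
  proof (rule norm_le_of_coord_tendsto)
    fix j
    have "((\<lambda>i. cinner (ket j) (R (coord x i *\<^sub>C ket i))) has_sum cinner (ket j) (R x)) UNIV"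
      by (rule has_sum_bounded_linear[OF bounded_linear_compose[OF bounded_linear_cinner_right
          blinfun.bounded_linear_right] ell2_expansion])
    moreover have "cinner (ket j) (R (coord x i *\<^sub>C ket i)) = fourier R (j - i) * coord x i" for i
      using R laurentD(2)[OF R, of j i]
      by (simp add: bopsD laurentD(1) cinner_scaleC_right mat_entry_def)
    ultimately have "((\<lambda>i. fourier R (j - i) * coord x i) has_sum coord (R x) j) UNIV"
      by (simp add: cinner_ket_left)
    then have "((\<lambda>k. fourier R k * coord x (j - k)) has_sum coord (R x) j) UNIV"
      by (subst has_sum_reindex_bij_witness[where i = "\<lambda>i. j - i" and j = "\<lambda>k. j - k"]) auto
    then show "((\<lambda>F. coord (S F) j) \<longlongrightarrow> coord (R x) j) (finite_subsets_at_top UNIV)"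
      by (simp add: has_sum_def coord_S)
  next
    have "norm (S F) \<le> C * norm x" if "finite F" for F
    proof -
      have "norm (S F) \<le> (\<Sum>k\<in>F. cmod (fourier R k) * norm x)"
        unfolding S_def by (rule order_trans[OF norm_sum]) (simp add: norm_shift_ell2)
      also have "\<dots> \<le> C * norm x"
        unfolding sum_distrib_right[symmetric] by (rule mult_right_mono[OF bound[OF that]]) simp
      finally show ?thesis .
    qed
    then show "\<forall>\<^sub>F F in finite_subsets_at_top UNIV. norm (S F) \<le> C * norm x"
      by (intro eventually_finite_subsets_at_top_weakI) simp
  qed (use \<open>0 \<le> C\<close> in simp_all)
qed fact

section \<open>Fejer means\<close>

text \<open>
  The Fejer mean, written as a sum over pairs of positions in a window of length \<open>M + 1\<close>. In this form it
  is the sum of the compressions of \<open>T\<close> to all such windows, divided by \<open>M + 1\<close>; see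
  \<open>fejer_window_has_sum\<close>. The pairs \<open>(s, t)\<close> with \<open>s - t = k\<close> are \<open>M + 1 - \<bar>k\<bar>\<close> in number, which produces the
  usual weight \<open>1 - \<bar>k\<bar>/(M + 1)\<close> of the \<open>k\<close>-th coefficient (\<open>fourier_fejer\<close>).
\<close>

definition fejer :: "nat \<Rightarrow> (int ell2 \<Rightarrow>\<^sub>L int ell2) \<Rightarrow> (int ell2 \<Rightarrow>\<^sub>L int ell2)" where
  "fejer M T = scaleC_op (1 / of_nat (M + 1))
     (\<Sum>s\<le>M. \<Sum>t\<le>M. scaleC_op (fourier T (int s - int t)) (shift_pow (int s - int t)))"

definition fejer_weight :: "nat \<Rightarrow> int \<Rightarrow> real" where
  "fejer_weight M k = (if \<bar>k\<bar> \<le> int M then 1 - \<bar>real_of_int k\<bar> / (real M + 1) else 0)"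

lemma fejer_in_span: "fejer M T \<in> spectral_band M"
  unfolding fejer_def spectral_band_def
  by (intro cop.span_scale cop.span_sum cop.span_base) auto

lemma fejer_laurent: "fejer M T \<in> laurent"
  unfolding fejer_def
  by (intro cop.subspace_scale cop.subspace_sum subspace_laurent shift_pow_laurent)

lemma sum_fejer_pairs:
  "(\<Sum>s\<le>M. \<Sum>t\<le>M. if k = int s - int t then 1 else 0 :: real) = (real M + 1) * fejer_weight M k"
proof -
  have weight: "(real M + 1) * fejer_weight M k = (if \<bar>k\<bar> \<le> int M then real M + 1 - \<bar>real_of_int k\<bar> else 0)"
    by (simp add: fejer_weight_def right_diff_distrib)
  have inner: "(\<Sum>t\<le>M. if k = int s - int t then 1 else 0 :: real) = (if k \<le> int s \<and> int s \<le> k + int M then 1 else 0)" for s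
  proof -
    have "(\<Sum>t\<le>M. if k = int s - int t then 1 else 0 :: real) = (\<Sum>t\<le>M. if t = nat (int s - k) \<and> k \<le> int s then 1 else 0)"
      by (rule sum.cong) auto
    also have "\<dots> = (if k \<le> int s \<and> int s \<le> k + int M then 1 else 0)"
      by (cases "k \<le> int s") (auto simp: nat_le_iff)
    finally show ?thesis .
  qed
  have "(\<Sum>s\<le>M. if k \<le> int s \<and> int s \<le> k + int M then 1 else 0 :: real) = real (card {s \<in> {..M}. k \<le> int s \<and> int s \<le> k + int M})"
    by (simp add: sum.If_cases Int_def)
  also have "card {s \<in> {..M}. k \<le> int s \<and> int s \<le> k + int M} = card (int ` {s \<in> {..M}. k \<le> int s \<and> int s \<le> k + int M})"
    by (simp add: card_image)
  also have "int ` {s \<in> {..M}. k \<le> int s \<and> int s \<le> k + int M} = {max 0 k..min (int M) (k + int M)}"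
  proof (intro equalityI subsetI)
    fix i assume "i \<in> {max 0 k..min (int M) (k + int M)}"
    then show "i \<in> int ` {s \<in> {..M}. k \<le> int s \<and> int s \<le> k + int M}"
      by (intro image_eqI[of _ _ "nat i"]) auto
  qed auto
  also have "real (card {max 0 k..min (int M) (k + int M)}) = (real M + 1) * fejer_weight M k"
    by (auto simp: weight max_def min_def)
  finally show ?thesis by (simp only: inner)
qed

lemma fourier_fejer: "fourier (fejer M T) k = of_real (fejer_weight M k) * fourier T k"
proof -
  have "(\<Sum>s\<le>M. \<Sum>t\<le>M. fourier T (int s - int t) * (if k = int s - int t then 1 else 0))
      = fourier T k * of_real (\<Sum>s\<le>M. \<Sum>t\<le>M. if k = int s - int t then 1 else 0)"
    unfolding of_real_sum sum_distrib_left by (intro sum.cong) auto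
  also have "\<dots> = fourier T k * of_real ((real M + 1) * fejer_weight M k)"
    by (simp only: sum_fejer_pairs)
  also have "\<dots> = of_nat (M + 1) * (of_real (fejer_weight M k) * fourier T k)"
    by (simp add: algebra_simps)
  finally have "fourier (fejer M T) k =
      1 / of_nat (M + 1) * (of_nat (M + 1) * (of_real (fejer_weight M k) * fourier T k))"
    unfolding fejer_def by (simp only: fourier_simps fourier_sum fourier_shift_pow)
  moreover have "of_nat (M + 1) \<noteq> (0::complex)" by (simp only: of_nat_eq_0_iff)
  moreover have "1 / n * (n * z) = z" if "n \<noteq> 0" for n z :: complex
    using that by simp
  ultimately show ?thesis by metis
qed

lemma has_sum_finite_sum:
  fixes f :: "'a \<Rightarrow> 'b \<Rightarrow> 'c::topological_comm_monoid_add"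
  assumes "\<And>a. a \<in> A \<Longrightarrow> (f a has_sum s a) B"
  shows "((\<lambda>x. \<Sum>a\<in>A. f a x) has_sum (\<Sum>a\<in>A. s a)) B"
  using assms
proof (induction A rule: infinite_finite_induct)
  case (insert a A)
  then show ?case by (simp add: has_sum_add)
qed simp_all

text \<open>
  The restriction of \<open>\<xi>\<close> to the interval from \<open>l\<close> to \<open>l + M\<close>, moved to the origin. For a Laurent operator the
  move makes no difference.
\<close>

definition window :: "nat \<Rightarrow> int \<Rightarrow> int ell2 \<Rightarrow> int ell2" where
  "window M l \<xi> = (\<Sum>s\<le>M. coord \<xi> (l + int s) *\<^sub>C ket (int s))"

text \<open>
  The reason why the Fejer mean is completely positive and contractive: its sesquilinear form
  is, up to the factor \<open>M + 1\<close>, the sum of the forms of \<open>T\<close> on windows. For fixed offsets \<open>s\<close> and \<open>t\<close> inside the window, summing over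
  all positions \<open>l\<close> gives the inner product with the shift by \<open>s - t\<close>.
\<close>

lemma fejer_window_has_sum:
  assumes T: "T \<in> laurent"
  shows "((\<lambda>l. cinner (window M l \<xi>) (T (window M l \<eta>))) has_sum
    (of_nat (M + 1) * cinner \<xi> (fejer M T \<eta>))) UNIV"
proof -
  have "cinner (window M l \<xi>) (T (window M l \<eta>)) = (\<Sum>s\<le>M. \<Sum>t\<le>M.
      fourier T (int s - int t) * (cnj (coord \<xi> (l + int s)) * coord \<eta> (l + int t)))" for l
    unfolding window_def cinner_sum_left unfolding blinfun.sum_right cinner_sum_right
    using laurentD[OF T]
    by (intro sum.cong)
      (auto simp: bopsD cinner_scaleC_left cinner_scaleC_right simp flip: mat_entry_def)
  moreover have "((\<lambda>l. cnj (coord \<xi> (l + int s)) * coord \<eta> (l + int t)) has_sum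
      cinner \<xi> (shift_pow (int s - int t) \<eta>)) UNIV" for s t
  proof -
    have "((\<lambda>j. cnj (coord \<xi> j) * coord (shift_pow (int s - int t) \<eta>) j) has_sum
        cinner \<xi> (shift_pow (int s - int t) \<eta>)) UNIV"
      unfolding cinner_def by (rule has_sum_infsum[OF inner_summable])
    then show ?thesis
      by (subst has_sum_reindex_bij_witness[where i = "\<lambda>j. j - int s" and j = "\<lambda>l. l + int s"])
        (auto simp: shift_pow_apply shift_ell2.rep_eq algebra_simps)
  qed
  then have "((\<lambda>l. \<Sum>s\<le>M. \<Sum>t\<le>M. fourier T (int s - int t) * (cnj (coord \<xi> (l + int s)) * coord \<eta> (l + int t)))
      has_sum (\<Sum>s\<le>M. \<Sum>t\<le>M. fourier T (int s - int t) * cinner \<xi> (shift_pow (int s - int t) \<eta>))) UNIV"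
    by (intro has_sum_finite_sum has_sum_cmult_right)
  moreover have "of_nat (M + 1) * cinner \<xi> (fejer M T \<eta>)
      = (\<Sum>s\<le>M. \<Sum>t\<le>M. fourier T (int s - int t) * cinner \<xi> (shift_pow (int s - int t) \<eta>))"
    by (simp add: fejer_def scaleC_op_apply cinner_scaleC_right blinfun.sum_left cinner_sum_right
        del: of_nat_Suc)
  ultimately show ?thesis by simp
qed

lemma fejer_add: "fejer M (S + T) = fejer M S + fejer M T"
  and fejer_scale: "fejer M (scaleC_op c T) = scaleC_op c (fejer M T)"
  and fejer_id: "fejer M id_blinfun = id_blinfun"
proof -
  show "fejer M (S + T) = fejer M S + fejer M T"
    by (rule laurent_eqI)
      (auto simp: fejer_laurent fourier_fejer distrib_left intro!: cop.subspace_add[OF subspace_laurent])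
  show "fejer M (scaleC_op c T) = scaleC_op c (fejer M T)"
    by (rule laurent_eqI)
      (auto simp: fejer_laurent fourier_fejer intro!: cop.subspace_scale[OF subspace_laurent])
  show "fejer M id_blinfun = id_blinfun"
    using shift_pow_laurent[of 0]
    by (intro laurent_eqI) (auto simp: fejer_laurent fourier_fejer shift_pow_0 fejer_weight_def)
qed

lemma fejer_adj: "T \<in> laurent \<Longrightarrow> fejer M (adj T) = adj (fejer M T)"
  by (rule laurent_eqI)
    (auto simp: fejer_laurent laurent_adj fourier_fejer fourier_adj fejer_weight_def)

lemma fejer_positive:
  assumes x: "\<And>i j. i < m \<Longrightarrow> j < m \<Longrightarrow> x i j \<in> laurent" and pos: "positive_op_mat m x"
  shows "positive_op_mat m (\<lambda>i j. fejer M (x i j))"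
  unfolding positive_op_mat_def
proof
  fix \<xi> :: "nat \<Rightarrow> int ell2"
  define Q where "Q = (\<Sum>i<m. \<Sum>j<m. cinner (\<xi> i) (fejer M (x i j) (\<xi> j)))"
  have "((\<lambda>l. \<Sum>i<m. \<Sum>j<m. cinner (window M l (\<xi> i)) (x i j (window M l (\<xi> j)))) has_sum
      (\<Sum>i<m. \<Sum>j<m. of_nat (M + 1) * cinner (\<xi> i) (fejer M (x i j) (\<xi> j)))) UNIV"
    by (intro has_sum_finite_sum fejer_window_has_sum x) auto
  also have "(\<Sum>i<m. \<Sum>j<m. of_nat (M + 1) * cinner (\<xi> i) (fejer M (x i j) (\<xi> j))) = of_nat (M + 1) * Q"
    by (simp only: Q_def sum_distrib_left)
  finally have lim: "((\<lambda>F. \<Sum>l\<in>F. \<Sum>i<m. \<Sum>j<m. cinner (window M l (\<xi> i)) (x i j (window M l (\<xi> j))))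
      \<longlongrightarrow> of_nat (M + 1) * Q) (finite_subsets_at_top UNIV)"
    by (simp add: has_sum_def)
  have "of_nat (M + 1) * Q \<in> \<real>\<^sub>\<ge>\<^sub>0"
  proof (rule Lim_in_closed_set[OF closed_nonneg_Reals_complex _ _ lim])
    have "(\<Sum>l\<in>F. \<Sum>i<m. \<Sum>j<m. cinner (window M l (\<xi> i)) (x i j (window M l (\<xi> j)))) \<in> \<real>\<^sub>\<ge>\<^sub>0" for F
      using pos[unfolded positive_op_mat_def, rule_format, of "\<lambda>i. window M _ (\<xi> i)"]
      by (induction F rule: infinite_finite_induct) (auto intro: nonneg_Reals_add_I)
    then show "\<forall>\<^sub>F F in finite_subsets_at_top UNIV.
        (\<Sum>l\<in>F. \<Sum>i<m. \<Sum>j<m. cinner (window M l (\<xi> i)) (x i j (window M l (\<xi> j)))) \<in> \<real>\<^sub>\<ge>\<^sub>0"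
      by simp
  qed simp
  then show "Q \<in> \<real>\<^sub>\<ge>\<^sub>0"
    by (auto simp: complex_nonneg_Reals_iff zero_le_mult_iff simp flip: of_nat_Suc)
qed

text \<open>
  The window identity for \<open>T\<close> is estimated termwise, and the window identity for the identity operator
  adds up the squared norms of the windows.
\<close>

lemma norm_fejer_le:
  assumes T: "T \<in> laurent"
  shows "norm (fejer M T) \<le> norm T"
proof (rule norm_blinfun_le_of_sesquilinear)
  fix \<xi> \<eta> :: "int ell2"
  have sq: "((\<lambda>l. (norm (window M l \<xi>))\<^sup>2) has_sum ((real M + 1) * (norm \<xi>)\<^sup>2)) UNIV" for \<xi>
  proof -
    have "id_blinfun \<in> laurent" using shift_pow_laurent[of 0] by (simp add: shift_pow_0)
    from fejer_window_has_sum[OF this, of M \<xi> \<xi>]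
    have "((\<lambda>l. complex_of_real ((norm (window M l \<xi>))\<^sup>2)) has_sum complex_of_real ((real M + 1) * (norm \<xi>)\<^sup>2)) UNIV"
      by (simp add: fejer_id cinner_self_norm add.commute)
    then show ?thesis by (simp only: has_sum_of_real_iff)
  qed
  have "cmod (of_nat (M + 1) * cinner \<xi> (fejer M T \<eta>))
      \<le> norm T / 2 * ((real M + 1) * (norm \<xi>)\<^sup>2 + (real M + 1) * (norm \<eta>)\<^sup>2)"
  proof (rule norm_infsum_le[OF fejer_window_has_sum[OF T]])
    show "((\<lambda>l. norm T / 2 * ((norm (window M l \<xi>))\<^sup>2 + (norm (window M l \<eta>))\<^sup>2)) has_sum
        (norm T / 2 * ((real M + 1) * (norm \<xi>)\<^sup>2 + (real M + 1) * (norm \<eta>)\<^sup>2))) UNIV"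
      by (intro has_sum_cmult_right has_sum_add sq)
    fix l
    have "cmod (cinner (window M l \<xi>) (T (window M l \<eta>))) \<le> norm (window M l \<xi>) * (norm T * norm (window M l \<eta>))"
      by (rule order_trans[OF cinner_Cauchy_Schwarz]) (simp add: mult_left_mono norm_blinfun)
    also have "\<dots> \<le> norm T / 2 * ((norm (window M l \<xi>))\<^sup>2 + (norm (window M l \<eta>))\<^sup>2)"
      using mult_left_mono[OF sum_squares_bound[of "norm (window M l \<xi>)" "norm (window M l \<eta>)"], of "norm T / 2"]
      by (simp add: algebra_simps)
    finally show "cmod (cinner (window M l \<xi>) (T (window M l \<eta>))) \<le> \<dots>" .
  qed
  then have "(real M + 1) * cmod (cinner \<xi> (fejer M T \<eta>)) \<le> (real M + 1) * (norm T * ((norm \<xi>)\<^sup>2 + (norm \<eta>)\<^sup>2) / 2)"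
    by (simp add: norm_mult algebra_simps flip: of_nat_Suc)
  then show "cmod (cinner \<xi> (fejer M T \<eta>)) \<le> norm T * ((norm \<xi>)\<^sup>2 + (norm \<eta>)\<^sup>2) / 2"
    by (subst (asm) mult_le_cancel_left_pos) auto
qed simp

section \<open>The q-derivative\<close>

lemma qint_0 [simp]: "qint q 0 = 0"
  by (simp add: qint_def)

lemma qint_minus: "qint q (- k) = - qint q k"
  by (simp add: qint_def divide_simps)

text \<open>
  Stepping by two turns the quotient into a sum of two reciprocal positive numbers, hence at least two;
  this yields \<open>[n]\<^sub>q \<ge> n\<close> by induction.
\<close>

lemma qint_step:
  assumes "0 < q" "q < 1"
  shows "qint q (k + 1) - qint q (k - 1) = q powi k + q powi (- k)"
proof -
  have "q \<noteq> 0" "q \<noteq> 1" "q - inverse q \<noteq> 0"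
    using assms by (auto simp: field_simps power2_eq_square[symmetric] power2_eq_1_iff)
  moreover define a where "a = q powi k"
  have "a \<noteq> 0" using \<open>q \<noteq> 0\<close> by (simp add: a_def)
  have p: "q powi (k + 1) = a * q" "q powi (k - 1) = a / q"
    using \<open>q \<noteq> 0\<close> by (simp_all add: a_def power_int_add power_int_diff)
  have "(q powi (k + 1) - q powi (- (k + 1))) - (q powi (k - 1) - q powi (- (k - 1)))
      = (q powi k + q powi (- k)) * (q - inverse q)"
    using \<open>q \<noteq> 0\<close> \<open>a \<noteq> 0\<close> unfolding power_int_minus p a_def[symmetric]
    by (simp add: field_simps)
  ultimately show ?thesis by (simp add: qint_def flip: diff_divide_distrib)
qed

lemma powi_plus_inverse_ge_2:
  fixes q :: real and k :: int
  assumes "0 < q"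
  shows "2 \<le> q powi k + q powi (- k)"
proof -
  define a where "a = q powi k"
  have "a > 0" using assms by (simp add: a_def)
  then have "2 \<le> a + inverse a"
    using zero_le_power2[of "a - 1"] by (simp add: field_simps power2_eq_square)
  then show ?thesis by (simp add: a_def power_int_minus)
qed

lemma qint_ge:
  assumes q: "0 < q" "q \<le> 1"
  shows "real n \<le> qint q (int n)"
proof (cases "q = 1")
  case False
  then have q1: "q < 1" using q by simp
  have "q - inverse q \<noteq> 0"
    using q q1 by (auto simp: field_simps power2_eq_square[symmetric] power2_eq_1_iff)
  then have one: "qint q 1 = 1" using False by (simp add: qint_def power_int_minus)
  show ?thesis
  proof (induction n rule: induct_nat_012)
    case (ge2 n)
    have "int (Suc (Suc n)) = int (Suc n) + 1" "int n = int (Suc n) - 1" by simp_all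
    then have "qint q (int (Suc (Suc n))) - qint q (int n)
        = q powi (int (Suc n)) + q powi (- int (Suc n))"
      using qint_step[OF q(1) q1, of "int (Suc n)"] by metis
    moreover have "real (Suc (Suc n)) = real n + 2" by simp
    ultimately show ?case
      using ge2(1) powi_plus_inverse_ge_2[OF q(1), of "int (Suc n)"] by linarith
  qed (simp_all add: one)
qed (simp add: qint_def)

lemma abs_qint_ge:
  assumes "0 < q" "q \<le> 1"
  shows "\<bar>real_of_int k\<bar> \<le> \<bar>qint q k\<bar>"
proof (cases "k \<ge> 0")
  case True
  then show ?thesis using qint_ge[OF assms, of "nat k"] by simp
next
  case False
  then show ?thesis using qint_ge[OF assms, of "nat (- k)"] qint_minus[of q k] by simp
qed

lemma q_deriv_eqI: "is_q_derivative q T D \<Longrightarrow> q_deriv q T = D"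
  unfolding q_deriv_def by (blast intro: the_equality is_q_derivative_unique)

lemma Lip_ell2_iff: "T \<in> Lip_ell2 q \<longleftrightarrow> T \<in> bops \<and> is_q_derivative q T (q_deriv q T)"
  unfolding Lip_ell2_def using q_deriv_eqI by blast

lemma is_q_derivative_add:
  "is_q_derivative q S D \<Longrightarrow> is_q_derivative q T E \<Longrightarrow> is_q_derivative q (S + T) (D + E)"
  by (simp add: is_q_derivative_def bops_intros algebra_simps)

lemma is_q_derivative_scale:
  "is_q_derivative q T D \<Longrightarrow> is_q_derivative q (scaleC_op c T) (scaleC_op c D)"
  by (simp add: is_q_derivative_def bops_intros algebra_simps)

lemma is_q_derivative_adj:
  assumes "T \<in> bops" "is_q_derivative q T D"
  shows "is_q_derivative q (adj T) (adj D)"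
proof -
  have "mat_entry (adj D) j k = \<i> * complex_of_real (qint q (j - k)) * mat_entry (adj T) j k" for j k
    using assms qint_minus[of q "j - k"] by (simp add: is_q_derivative_def mat_entry_adj)
  then show ?thesis using assms by (simp add: is_q_derivative_def bops_intros)
qed

lemma is_q_derivative_shift_pow:
  "is_q_derivative q (shift_pow n) (scaleC_op (\<i> * complex_of_real (qint q n)) (shift_pow n))"
  by (auto simp: is_q_derivative_def bops_intros mat_entry_shift_pow)

lemma Lip_circleD:
  assumes "T \<in> Lip_circle q"
  shows "T \<in> bops" "T \<in> C_circle" "T \<in> laurent" "is_q_derivative q T (q_deriv q T)"
  using assms C_circle_subset_laurent by (auto simp: Lip_circle_def Lip_ell2_iff)

lemma Lip_circleI: "T \<in> C_circle \<Longrightarrow> is_q_derivative q T D \<Longrightarrow> T \<in> Lip_circle q"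
  using C_circle_subset_laurent laurentD(1) by (auto simp: Lip_circle_def Lip_ell2_def)

lemma shift_pow_Lip_circle: "shift_pow n \<in> Lip_circle q"
  by (rule Lip_circleI[OF shift_pow_C_circle is_q_derivative_shift_pow])

lemma operator_system_Lip_circle: "operator_system (Lip_circle q)"
proof -
  have C: "cop.subspace C_circle" "\<And>T. T \<in> C_circle \<Longrightarrow> adj T \<in> C_circle"
    using cstar_subalgebra_C_circle by (auto simp: cstar_subalgebra_def)
  note D = Lip_circleD
  have zero: "0 = scaleC_op 0 (shift_pow 0)" by simp
  have "cop.subspace (Lip_circle q)"
  proof (rule cop.subspaceI)
    show sc: "scaleC_op c T \<in> Lip_circle q" if "T \<in> Lip_circle q" for c T
      using that
      by (intro Lip_circleI[OF _ is_q_derivative_scale[OF D(4)]] cop.subspace_scale[OF C(1)] D(2))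
    show "0 \<in> Lip_circle q"
      unfolding zero by (rule sc[OF shift_pow_Lip_circle])
    show "S + T \<in> Lip_circle q" if "S \<in> Lip_circle q" "T \<in> Lip_circle q" for S T
      using that
      by (intro Lip_circleI[OF _ is_q_derivative_add[OF D(4) D(4)]] cop.subspace_add[OF C(1)] D(2))
  qed
  moreover have "adj T \<in> Lip_circle q" if "T \<in> Lip_circle q" for T
    using that by (intro Lip_circleI[OF C(2) is_q_derivative_adj[OF D(1) D(4)]] D(2))
  moreover have "id_blinfun \<in> Lip_circle q"
    using shift_pow_Lip_circle[of 0] by (simp add: shift_pow_0)
  ultimately show ?thesis by (auto simp: operator_system_def dest: D(1))
qed

lemma slip_norm_L_q: "slip_norm (Lip_circle q) (L_q q)"
  unfolding L_q_def[abs_def]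
proof (rule slip_norm_norm)
  show "q_deriv q (S + T) = q_deriv q S + q_deriv q T"
    if "S \<in> Lip_circle q" "T \<in> Lip_circle q" for S T
    using that by (intro q_deriv_eqI is_q_derivative_add Lip_circleD(4))
  show "q_deriv q (scaleC_op c T) = scaleC_op c (q_deriv q T)" if "T \<in> Lip_circle q" for c T
    using that by (intro q_deriv_eqI is_q_derivative_scale Lip_circleD(4))
  show "q_deriv q (adj T) = adj (q_deriv q T)" if "T \<in> Lip_circle q" for T
    using that by (intro q_deriv_eqI is_q_derivative_adj Lip_circleD(1,4))
  show "q_deriv q T \<in> bops" if "T \<in> Lip_circle q" for T
    using Lip_circleD(4)[OF that] by (simp add: is_q_derivative_def)
  show "q_deriv q id_blinfun = 0"
    using q_deriv_eqI[OF is_q_derivative_shift_pow[of q 0]] by (simp add: shift_pow_0)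
qed

lemma q_deriv_laurent:
  assumes T: "T \<in> Lip_circle q"
  shows "q_deriv q T \<in> laurent" "fourier (q_deriv q T) k = \<i> * complex_of_real (qint q k) * fourier T k"
proof -
  have D: "q_deriv q T \<in> bops"
    "mat_entry (q_deriv q T) j k = \<i> * complex_of_real (qint q (j - k)) * fourier T (j - k)" for j k
    using Lip_circleD(4)[OF T] laurentD(2)[OF Lip_circleD(3)[OF T]] by (auto simp: is_q_derivative_def)
  show f: "fourier (q_deriv q T) k = \<i> * complex_of_real (qint q k) * fourier T k" for k
    using D(2)[of k 0] by (simp add: fourier_def)
  show "q_deriv q T \<in> laurent" by (simp add: laurent_def D f)
qed

lemma fejer_Lip_circle: "fejer M T \<in> Lip_circle q"
proof -
  have "spectral_band M \<subseteq> Lip_circle q"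
    unfolding spectral_band_def
    using operator_system_closed(2)[OF operator_system_Lip_circle] shift_pow_Lip_circle
    by (intro cop.span_minimal) auto
  then show ?thesis using fejer_in_span by blast
qed

text \<open>
  Both maps multiply the \<open>k\<close>-th Fourier coefficient by a factor.
\<close>

lemma q_deriv_fejer:
  assumes T: "T \<in> Lip_circle q"
  shows "q_deriv q (fejer M T) = fejer M (q_deriv q T)"
  by (rule laurent_eqI)
    (simp_all add: q_deriv_laurent fejer_Lip_circle fejer_laurent fourier_fejer assms)

lemma L_q_fejer_le:
  assumes T: "T \<in> Lip_circle q"
  shows "L_q q (fejer M T) \<le> L_q q T"
  by (simp add: L_q_def q_deriv_fejer[OF T] norm_fejer_le[OF q_deriv_laurent(1)[OF T]])

lemma abs_mult_fourier_le:
  assumes "0 < q" "q \<le> 1" and T: "T \<in> Lip_circle q"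
  shows "\<bar>real_of_int k\<bar> * cmod (fourier T k) \<le> cmod (fourier (q_deriv q T) k)"
  using abs_qint_ge[OF assms(1,2), of k]
  by (simp add: q_deriv_laurent(2)[OF T] norm_mult mult_right_mono)

section \<open>Approximation by Fejer means\<close>

lemma summable_inverse_squares: "(\<lambda>k. 1 / (real k)\<^sup>2) summable_on A"
proof -
  have "(\<lambda>k. 1 / (real k)\<^sup>2) summable_on UNIV"
    using inverse_power_summable[of 2, where ?'a = real]
    by (subst summable_on_UNIV_nonneg_real_iff) (simp_all add: field_simps)
  then show ?thesis using summable_on_subset_banach by blast
qed

lemma epsilon_square:
  "(epsilon M)\<^sup>2 = 2 * (real M / (real M + 1)\<^sup>2 + (\<Sum>\<^sub>\<infinity>k\<in>{M + 1..}. 1 / (real k)\<^sup>2))"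
proof -
  have "0 \<le> (\<Sum>\<^sub>\<infinity>k\<in>{M + 1..}. 1 / (real k)\<^sup>2)" by (rule infsum_nonneg) simp
  then show ?thesis by (simp add: epsilon_def power_mult_distrib)
qed

lemma epsilon_pos: "0 < epsilon M"
proof -
  have "(\<Sum>k\<in>{M + 1}. 1 / (real k)\<^sup>2) \<le> (\<Sum>\<^sub>\<infinity>k\<in>{M + 1..}. 1 / (real k)\<^sup>2)"
    by (rule finite_sum_le_infsum[OF summable_inverse_squares]) auto
  moreover have "0 < (\<Sum>k\<in>{M + 1}. 1 / (real k)\<^sup>2)" by simp
  ultimately have "0 < (\<Sum>\<^sub>\<infinity>k\<in>{M + 1..}. 1 / (real k)\<^sup>2)" by linarith
  then show ?thesis 
    unfolding epsilon_def by (intro mult_pos_pos real_sqrt_gt_zero add_nonneg_pos) simp_all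
qed

lemma epsilon_tendsto_0: "epsilon \<longlonglongrightarrow> 0"
proof -
  let ?f = "\<lambda>k. 1 / (real k)\<^sup>2"
  have tail: "(\<Sum>\<^sub>\<infinity>k\<in>{M + 1..}. ?f k) = (\<Sum>\<^sub>\<infinity>k. ?f k) - (\<Sum>k\<le>M. ?f k)" for M
  proof -
    have "{M + 1..} = UNIV - {..M}" by auto
    then show ?thesis by (simp add: infsum_Diff summable_inverse_squares)
  qed
  have "?f sums (\<Sum>\<^sub>\<infinity>k. ?f k)"
    using has_sum_imp_sums[OF has_sum_infsum[OF summable_inverse_squares]] .
  then have "(\<lambda>M. \<Sum>k\<le>M. ?f k) \<longlonglongrightarrow> (\<Sum>\<^sub>\<infinity>k. ?f k)" by (simp add: sums_def_le)
  then have "(\<lambda>M. (\<Sum>\<^sub>\<infinity>k. ?f k) - (\<Sum>k\<le>M. ?f k)) \<longlonglongrightarrow> (\<Sum>\<^sub>\<infinity>k. ?f k) - (\<Sum>\<^sub>\<infinity>k. ?f k)"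
    by (intro tendsto_intros)
  then have t: "(\<lambda>M. \<Sum>\<^sub>\<infinity>k\<in>{M + 1..}. ?f k) \<longlonglongrightarrow> 0" by (simp only: tail diff_self)
  have m: "(\<lambda>M. real M / (real M + 1)\<^sup>2) \<longlonglongrightarrow> 0" by real_asymp
  have "(\<lambda>M. sqrt 2 * sqrt (real M / (real M + 1)\<^sup>2 + (\<Sum>\<^sub>\<infinity>k\<in>{M + 1..}. ?f k))) \<longlonglongrightarrow> sqrt 2 * sqrt (0 + 0)"
    by (intro tendsto_intros m t)
  then show ?thesis by (simp add: epsilon_def[abs_def])
qed

text \<open>
  The factor by which the moduli of the \<open>k\<close>-th Fourier coefficients of \<open>T - fejer M T\<close> and of the ordinary
  derivative of \<open>T\<close> differ. It is zero for \<open>k = 0\<close> since division by zero gives zero.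
\<close>

definition fejer_defect :: "nat \<Rightarrow> int \<Rightarrow> real" where
  "fejer_defect M k = (1 - fejer_weight M k) / \<bar>real_of_int k\<bar>"

text \<open>
  The square of \<^const>\<open>epsilon\<close> is the sum of the squared factors over all \<open>k\<close>: for \<open>0 < \<bar>k\<bar> \<le> M\<close> they equal
  \<open>1/(M + 1)\<close>, for \<open>\<bar>k\<bar> > M\<close> they equal \<open>1/\<bar>k\<bar>\<close>, and the two signs of \<open>k\<close> account for the factor two.
\<close>

lemma sum_fejer_defect_le:
  assumes "finite F"
  shows "(\<Sum>k\<in>F. (fejer_defect M k)\<^sup>2) \<le> (epsilon M)\<^sup>2"
proof -
  let ?h = "\<lambda>k. (fejer_defect M k)\<^sup>2"
  have even: "fejer_defect M (- k) = fejer_defect M k" for k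
    by (simp add: fejer_defect_def fejer_weight_def)
  define b where "b = (\<Sum>k\<in>F. \<bar>k\<bar>)"
  have b: "\<bar>k\<bar> \<le> b" if "k \<in> F" for k
    unfolding b_def by (rule member_le_sum[OF that]) (use assms in auto)
  define N where "N = max M (nat b)"
  have split: "{1..N} = {1..M} \<union> {M + 1..N}" by (auto simp: N_def)
  define P where "P = int ` {1..N}"
  define Q where "Q = (\<lambda>n. - int n) ` {1..N}"
  have sub: "F \<subseteq> insert 0 (P \<union> Q)"
  proof
    fix k assume "k \<in> F"
    then have "\<bar>k\<bar> \<le> int N" using b unfolding N_def by fastforce
    then consider "k = 0" | "k = int (nat k)" "nat k \<in> {1..N}"
      | "k = - int (nat (- k))" "nat (- k) \<in> {1..N}"
      by (cases "k = 0"; cases "k > 0") (auto simp: Suc_le_eq nat_le_iff)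
    then show "k \<in> insert 0 (P \<union> Q)"
      unfolding P_def Q_def by cases blast+
  qed
  have fin: "finite P" "finite Q" by (simp_all add: P_def Q_def)
  have "(\<Sum>k\<in>F. ?h k) \<le> (\<Sum>k\<in>insert 0 (P \<union> Q). ?h k)"
    using sub fin by (intro sum_mono2) auto
  also have "\<dots> = ?h 0 + ((\<Sum>k\<in>P. ?h k) + (\<Sum>k\<in>Q. ?h k))"
    using fin by (subst sum.insert; (subst sum.union_disjoint)?) (auto simp: P_def Q_def)
  also have "?h 0 = 0" by (simp add: fejer_defect_def)
  also have "(\<Sum>k\<in>P. ?h k) = (\<Sum>n=1..N. ?h (int n))"
    by (simp add: P_def sum.reindex)
  also have "(\<Sum>k\<in>Q. ?h k) = (\<Sum>n=1..N. ?h (int n))"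
    by (simp add: Q_def sum.reindex inj_on_def even)
  also have "(\<Sum>n=1..N. ?h (int n)) = (\<Sum>n=1..M. ?h (int n)) + (\<Sum>n=M+1..N. ?h (int n))"
    unfolding split by (rule sum.union_disjoint) auto
  also have "(\<Sum>n=1..M. ?h (int n)) = (\<Sum>n=1..M. (1 / (real M + 1))\<^sup>2)"
    by (intro sum.cong) (auto simp: fejer_defect_def fejer_weight_def)
  also have "\<dots> = real M / (real M + 1)\<^sup>2" by (simp add: power_divide)
  also have "(\<Sum>n=M+1..N. ?h (int n)) = (\<Sum>n=M+1..N. 1 / (real n)\<^sup>2)"
    by (intro sum.cong) (auto simp: fejer_defect_def fejer_weight_def power_divide)
  also have "\<dots> \<le> (\<Sum>\<^sub>\<infinity>k\<in>{M + 1..}. 1 / (real k)\<^sup>2)"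
    by (rule finite_sum_le_infsum[OF summable_inverse_squares]) auto
  finally show ?thesis by (simp add: epsilon_square)
qed

text \<open>
  The Fourier coefficients are the coordinates of the image of a unit vector.
\<close>

lemma sum_fourier_square_le:
  assumes "finite F"
  shows "(\<Sum>k\<in>F. (cmod (fourier D k))\<^sup>2) \<le> (norm D)\<^sup>2"
proof -
  have "(\<Sum>k\<in>F. (cmod (fourier D k))\<^sup>2) \<le> (norm (D (ket 0)))\<^sup>2"
    unfolding norm_ell2_square fourier_def mat_entry_coord
    by (rule finite_sum_le_infsum[OF coord_summable assms]) auto
  also have "\<dots> \<le> (norm D)\<^sup>2"
    using norm_blinfun[of D "ket 0"] by (intro power_mono) auto
  finally show ?thesis .
qed

text \<open>
  Cauchy-Schwarz for the Fourier coefficients of \<open>T - fejer M T\<close>: up to the factors \<^const>\<open>fejer_defect\<close>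
  they are dominated by the coefficients of the \<open>q\<close>-derivative, because \<open>\<bar>[k]\<^sub>q\<bar> \<ge> \<bar>k\<bar>\<close>.
\<close>

lemma norm_diff_fejer_le:
  assumes q: "0 < q" "q \<le> 1" and T: "T \<in> Lip_circle q"
  shows "norm (T - fejer M T) \<le> epsilon M * L_q q T"
proof (rule norm_le_of_fourier_sums)
  show "T - fejer M T \<in> laurent"
    by (intro cop.subspace_diff subspace_laurent Lip_circleD(3)[OF T] fejer_laurent)
  show "0 \<le> epsilon M * L_q q T" using epsilon_pos[of M] by (simp add: L_q_def)
  fix F :: "int set" assume F: "finite F"
  let ?D = "q_deriv q T"
  have weight: "0 \<le> 1 - fejer_weight M k" for k
    by (simp add: fejer_weight_def)
  have "cmod (fourier (T - fejer M T) k) \<le> \<bar>fejer_defect M k\<bar> * \<bar>cmod (fourier ?D k)\<bar>" for k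
  proof -
    have "fourier (T - fejer M T) k = of_real (1 - fejer_weight M k) * fourier T k"
      by (simp add: fourier_fejer algebra_simps)
    then have eq: "cmod (fourier (T - fejer M T) k) = (1 - fejer_weight M k) * cmod (fourier T k)"
      using weight[of k] by (simp only: norm_mult norm_of_real abs_of_nonneg)
    show ?thesis
    proof (cases "k = 0")
      case True
      then show ?thesis using eq by (simp add: fejer_weight_def)
    next
      case False
      then have "(1 - fejer_weight M k) * cmod (fourier T k)
          = fejer_defect M k * (\<bar>real_of_int k\<bar> * cmod (fourier T k))"
        by (simp add: fejer_defect_def)
      also have "\<dots> \<le> fejer_defect M k * cmod (fourier ?D k)"
        using weight[of k] by (intro mult_left_mono abs_mult_fourier_le[OF q T]) (simp add: fejer_defect_def)
      finally show ?thesis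
        unfolding eq using weight[of k] by (simp add: fejer_defect_def)
    qed
  qed
  then have "(\<Sum>k\<in>F. cmod (fourier (T - fejer M T) k)) \<le> (\<Sum>k\<in>F. \<bar>fejer_defect M k\<bar> * \<bar>cmod (fourier ?D k)\<bar>)"
    by (rule sum_mono)
  also have "\<dots> \<le> L2_set (fejer_defect M) F * L2_set (\<lambda>k. cmod (fourier ?D k)) F"
    by (rule L2_set_mult_ineq)
  also have "\<dots> \<le> epsilon M * norm ?D"
    unfolding L2_set_def
    using sum_fejer_defect_le[OF F, of M] sum_fourier_square_le[OF F, of ?D] epsilon_pos[of M]
    by (intro mult_mono real_le_lsqrt) (auto intro: sum_nonneg)
  finally show "(\<Sum>k\<in>F. cmod (fourier (T - fejer M T) k)) \<le> epsilon M * L_q q T"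
    by (simp add: L_q_def)
qed

text \<open>
  Up to \<open>\<delta>/2\<close> an element of the unit ball is a trigonometric polynomial of fixed degree \<open>M\<close>. Its
  coefficients other than the constant one have modulus at most one, so they can be rounded to a finite net
  of the unit disc.
\<close>

lemma totally_bounded_Lip_circle:
  assumes q: "0 < q" "q \<le> 1"
  shows "totally_bounded_mod_scalars (Lip_circle q) (L_q q)"
  unfolding totally_bounded_mod_scalars_def
proof (intro allI impI)
  fix \<delta> :: real assume "\<delta> > 0"
  then have "\<forall>\<^sub>F M in sequentially. epsilon M < \<delta> / 2"
    using order_tendstoD(2)[OF epsilon_tendsto_0, of "\<delta> / 2"] by simp
  then obtain M where M: "epsilon M < \<delta> / 2" by (auto simp: eventually_sequentially)
  define K where "K = {- int M..int M}"
  \<comment> \<open>rounding \<open>2 M + 1\<close> coefficients with this precision costs at most \<open>\<delta>/2\<close>\<close>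
  define \<eta> where "\<eta> = \<delta> / (2 * (2 * real M + 1))"
  have K: "finite K" "real (card K) = 2 * real M + 1" by (simp_all add: K_def)
  have "\<eta> > 0" using \<open>\<delta> > 0\<close> by (simp add: \<eta>_def)
  then obtain N where N: "finite N" "\<And>c::complex. cmod c \<le> 1 \<Longrightarrow> \<exists>d\<in>N. cmod (c - d) \<le> \<eta>"
    using finite_disc_net by blast
  define poly where "poly c = (\<Sum>k\<in>K. scaleC_op (c k) (shift_pow k))" for c
  define G where "G = poly ` (K \<rightarrow>\<^sub>E N)"
  show "\<exists>G. finite G \<and> G \<subseteq> Lip_circle q \<and> (\<forall>T\<in>Lip_circle q. L_q q T \<le> 1 \<longrightarrow>
      (\<exists>g\<in>G. \<exists>c. norm (T - scaleC_op c id_blinfun - g) \<le> \<delta>))"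
  proof (intro exI[of _ G] conjI ballI impI)
    show "finite G" using K N(1) by (auto simp: G_def intro!: finite_PiE)
    have sub: "cop.subspace (Lip_circle q)"
      by (rule operator_system_closed(2)[OF operator_system_Lip_circle])
    show "G \<subseteq> Lip_circle q"
      by (auto simp: G_def poly_def intro!: cop.subspace_sum[OF sub] cop.subspace_scale[OF sub]
          shift_pow_Lip_circle)
    fix T assume T: "T \<in> Lip_circle q" "L_q q T \<le> 1"
    \<comment> \<open>the coefficients of the Fejer mean without the constant one, which is the scalar to be divided out\<close>
    define b where "b k = (if k = 0 then 0 else of_real (fejer_weight M k) * fourier T k)" for k
    have "cmod (b k) \<le> 1" for k
    proof (cases "k = 0")
      case False
      have w: "0 \<le> fejer_weight M k" "fejer_weight M k \<le> 1"
        by (auto simp: fejer_weight_def field_simps)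
      have "1 \<le> \<bar>real_of_int k\<bar>" using False by linarith
      then have "cmod (b k) \<le> \<bar>real_of_int k\<bar> * cmod (fourier T k)"
        using w False unfolding b_def by (auto simp: norm_mult intro!: mult_right_mono)
      also have "\<dots> \<le> cmod (fourier (q_deriv q T) k)" by (rule abs_mult_fourier_le[OF q T(1)])
      also have "\<dots> \<le> 1" using norm_fourier_le[of "q_deriv q T" k] T(2) by (simp add: L_q_def)
      finally show ?thesis .
    qed (simp add: b_def)
    then have "\<forall>k. \<exists>d\<in>N. cmod (b k - d) \<le> \<eta>" using N(2) by blast
    then obtain d where d: "\<And>k. d k \<in> N" "\<And>k. cmod (b k - d k) \<le> \<eta>" by metis
    define g where "g = poly (restrict d K)"
    have g: "g \<in> G" using d(1) by (auto simp: g_def G_def)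
    have poly_laurent: "poly c \<in> laurent" for c
      unfolding poly_def
      by (intro cop.subspace_sum cop.subspace_scale subspace_laurent shift_pow_laurent)
    have fourier_poly: "fourier (poly c) k = (if k \<in> K then c k else 0)" for c k
      using K(1) by (simp add: poly_def fourier_sum if_distrib cong: if_cong)
    have "fejer M T = scaleC_op (fourier T 0) (shift_pow 0) + poly b"
      by (rule laurent_eqI)
        (auto simp: fejer_laurent fourier_poly fourier_fejer b_def K_def fejer_weight_def
          intro!: cop.subspace_add[OF subspace_laurent] cop.subspace_scale[OF subspace_laurent]
            shift_pow_laurent poly_laurent)
    then have "T - scaleC_op (fourier T 0) id_blinfun - g = (T - fejer M T) + (poly b - g)"
      by (simp add: shift_pow_0)
    then have "norm (T - scaleC_op (fourier T 0) id_blinfun - g) \<le> norm (T - fejer M T) + norm (poly b - g)"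
      by (simp only: norm_triangle_ineq)
    moreover have "norm (T - fejer M T) \<le> \<delta> / 2"
      using norm_diff_fejer_le[OF q T(1), of M] M T(2) epsilon_pos[of M]
        mult_left_le[of "L_q q T" "epsilon M"] by linarith
    moreover have "norm (poly b - g) \<le> \<delta> / 2"
    proof -
      have "poly b - g = (\<Sum>k\<in>K. scaleC_op (b k - d k) (shift_pow k))"
        by (simp add: g_def poly_def cop.scale_left_diff_distrib sum_subtractf)
      also have "norm \<dots> \<le> (\<Sum>k\<in>K. \<eta>)"
        using d(2) norm_shift_pow_le
        by (intro sum_norm_le) (simp add: mult_mono[of _ \<eta> _ 1, simplified] order_trans[OF mult_right_le_one_le])
      also have "\<dots> = \<delta> / 2" using K(2) by (simp add: \<eta>_def field_simps)
      finally show ?thesis .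
    qed
    ultimately have "norm (T - scaleC_op (fourier T 0) id_blinfun - g) \<le> \<delta>" by linarith
    then show "\<exists>g\<in>G. \<exists>c. norm (T - scaleC_op c id_blinfun - g) \<le> \<delta>" using g by blast
  qed
qed

lemma operator_system_span_shifts:
  assumes "0 \<in> K" "\<And>k. k \<in> K \<Longrightarrow> - k \<in> K"
  shows "operator_system (cop.span (shift_pow ` K))" and "cop.span (shift_pow ` K) \<subseteq> Lip_circle q"
proof -
  let ?Y = "cop.span (shift_pow ` K)"
  show sub: "?Y \<subseteq> Lip_circle q" for q
    using operator_system_closed(2)[OF operator_system_Lip_circle] shift_pow_Lip_circle
    by (intro cop.span_minimal) auto
  have "?Y \<subseteq> {x \<in> bops. adj x \<in> ?Y}"
  proof (rule cop.span_minimal)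
    show "shift_pow ` K \<subseteq> {x \<in> bops. adj x \<in> ?Y}"
      using assms(2) by (auto simp: shift_pow_bops adj_shift_pow intro: cop.span_base)
    have "adj (0 :: int ell2 \<Rightarrow>\<^sub>L int ell2) = 0" by (rule adj_eqI) simp
    then show "cop.subspace {x \<in> bops. adj x \<in> ?Y}"
      by (intro cop.subspaceI)
        (auto simp: bops_intros adj_add adj_scaleC_op cop.span_zero intro: cop.span_add cop.span_scale)
  qed
  moreover have "id_blinfun \<in> ?Y"
    using assms(1) by (auto simp flip: shift_pow_0 intro: cop.span_base)
  ultimately show "operator_system ?Y"
    by (auto simp: operator_system_def)
qed

lemma dist_s_Lip_circle_span_le:
  assumes q: "0 < q" "q \<le> 1" and K: "\<And>k. k \<in> K \<Longrightarrow> - k \<in> K" "{- int M..int M} \<subseteq> K"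
  shows "dist_s (Lip_circle q) (L_q q) (cop.span (shift_pow ` K)) (L_q q) \<le> ennreal (epsilon M)"
proof (rule dist_s_le_of_approximation[where \<Phi> = "fejer M"])
  have "0 \<in> K" using K(2) by auto
  then show "operator_system (cop.span (shift_pow ` K))" "cop.span (shift_pow ` K) \<subseteq> Lip_circle q"
    using operator_system_span_shifts K(1) by blast+
  have "spectral_band M \<subseteq> cop.span (shift_pow ` K)"
    unfolding spectral_band_def using K(2) by (intro cop.span_mono) auto
  then show "fejer M x \<in> cop.span (shift_pow ` K)" for x using fejer_in_span by blast
  show "positive_op_mat m (\<lambda>i j. fejer M (x i j))"
    if "\<And>i j. i < m \<Longrightarrow> j < m \<Longrightarrow> x i j \<in> Lip_circle q" "positive_op_mat m x" for m x
    using that by (intro fejer_positive) (auto dest: Lip_circleD(3))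
qed (simp_all add: operator_system_Lip_circle slip_norm_L_q totally_bounded_Lip_circle q epsilon_pos
  fejer_add fejer_scale fejer_id fejer_adj Lip_circleD(3) L_q_fejer_le norm_diff_fejer_le)

theorem proposition7p2:
  fixes q :: real
  assumes "0 < q" and "q \<le> 1"
  shows "(\<forall>M::nat. dist_s (Lip_circle q) (L_q q) (spectral_band M) (L_q q) \<le> ennreal (epsilon M))
    \<and> dist_s (Lip_circle q) (L_q q) O_circle (L_q q) = 0"
proof (intro conjI allI)
  fix M :: nat
  have "spectral_band M = cop.span (shift_pow ` {- int M..int M})"
    unfolding spectral_band_def by (rule arg_cong[where f = cop.span]) auto
  then show "dist_s (Lip_circle q) (L_q q) (spectral_band M) (L_q q) \<le> ennreal (epsilon M)"
    using dist_s_Lip_circle_span_le[OF assms, of "{- int M..int M}" M] by simp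
next
  \<comment> \<open>the bound for the bands holds for every larger symmetric span of shifts, and \<^const>\<open>epsilon\<close> tends to zero\<close>
  have "dist_s (Lip_circle q) (L_q q) O_circle (L_q q) \<le> ennreal (epsilon M)" for M
    unfolding O_circle_def using dist_s_Lip_circle_span_le[OF assms, of UNIV M] by simp
  moreover have "(\<lambda>M. ennreal (epsilon M)) \<longlonglongrightarrow> ennreal 0"
    by (rule tendsto_ennrealI[OF epsilon_tendsto_0])
  ultimately have "dist_s (Lip_circle q) (L_q q) O_circle (L_q q) \<le> ennreal 0"
    by (intro LIMSEQ_le_const[where X = "\<lambda>M. ennreal (epsilon M)"]) auto
  then show "dist_s (Lip_circle q) (L_q q) O_circle (L_q q) = 0" by simp
qed

end
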